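(* Let $X$ be a CAT(0) cube complex of finite dimension. Then $X$ has finite asymptotic dimension.
   Context: A cube complex is a polyhedral complex in which each cell is isometric to a Euclidean cube and the gluing maps are isometries; its dimension is the maximum of the dimensions of its cubes. It is CAT(0) iff it is simply connected and the link of each vertex is a flag complex. The metric used is the edge-path metric $d$ on the vertex set $V=X^{(0)}$: $d(x,y)$ is the minimal number of edges of the 1-skeleton $X^{(1)}$ in a path from $x$ to $y$. A metric space $(Y,d)$ satisfies $\operatorname{asdim} Y\leqslant n$ if for every $r>0$ one can write $Y=\bigcup_{i=0}^n Y_i$ with each $Y_i$ a union of a family $\{Y_{ij}\}_j$ of subsets that is $r$-disjoint (i.e. $\inf\{d(a,b):a\in Y_{ij},b\in Y_{ij'}\}\geqslant r$ for distinct members $Y_{ij}\ne Y_{ij'}$), and $\sup_{i,j}\operatorname{diam} Y_{ij}<\infty$. Finite asymptotic dimension means $\operatorname{asdim} Y\leqslant n$ for some $n\in\mathbb N$. *)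

theory Defs
  imports "HOL-Analysis.Analysis"
begin

section \<open>Euclidean unit cubes\<close>

text \<open>
  The cube \<open>[0,1]\<^sup>n\<close> is the extensional product over the index set \<open>{..<n}\<close>, so that cubes of all
  dimensions live in the one type \<open>nat \<Rightarrow> real\<close>; for \<open>n = 0\<close> it is a single point.
\<close>

definition cube :: "nat \<Rightarrow> (nat \<Rightarrow> real) set"
  where "cube n = PiE {..<n} (\<lambda>_. {0..1})"

definition cube_topology :: "nat \<Rightarrow> (nat \<Rightarrow> real) topology"
  where "cube_topology n = product_topology (\<lambda>_. top_of_set {0..1}) {..<n}"

definition cube_dist :: "nat \<Rightarrow> (nat \<Rightarrow> real) \<Rightarrow> (nat \<Rightarrow> real) \<Rightarrow> real"
  where "cube_dist n x y = L2_set (\<lambda>i. x i - y i) {..<n}"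

definition corners :: "nat \<Rightarrow> (nat \<Rightarrow> real) set"
  where "corners n = PiE {..<n} (\<lambda>_. {0, 1})"

text \<open>
  \<open>face n x F\<close> is the set of points that agree with \<open>x\<close> outside the directions \<open>F\<close>. It is a face
  of the cube whenever \<open>x i \<in> {0, 1}\<close> for all \<open>i < n\<close> not in \<open>F\<close>, and every face has this form.
\<close>

definition face :: "nat \<Rightarrow> (nat \<Rightarrow> real) \<Rightarrow> nat set \<Rightarrow> (nat \<Rightarrow> real) set"
  where "face n x F = {y \<in> cube n. \<forall>i \<in> {..<n} - F. y i = x i}"

text \<open>
  The support of \<open>x\<close> is the unique face containing \<open>x\<close> in its interior; the interior of a face is
  therefore the set of points having that face as support.
\<close>

definition support :: "nat \<Rightarrow> (nat \<Rightarrow> real) \<Rightarrow> (nat \<Rightarrow> real) set"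
  where "support n x = face n x {i. i < n \<and> 0 < x i \<and> x i < 1}"

definition cube_isometry ::
    "nat \<Rightarrow> (nat \<Rightarrow> real) set \<Rightarrow> nat \<Rightarrow> (nat \<Rightarrow> real) set \<Rightarrow> ((nat \<Rightarrow> real) \<Rightarrow> nat \<Rightarrow> real) \<Rightarrow> bool"
  where "cube_isometry m A n B h \<longleftrightarrow>
    bij_betw h A B \<and> (\<forall>z\<in>A. \<forall>w\<in>A. cube_dist n (h z) (h w) = cube_dist m z w)"


section \<open>Cube complexes\<close>

text \<open>
  A polyhedral complex is a quotient of a disjoint union of cells. Here \<open>cells\<close> is the index set of
  the cells, the cell \<open>c\<close> is a copy of the cube of dimension \<open>cdim c\<close>, \<open>realization\<close> is the quotient
  space, and \<open>chart c\<close> is the restriction of the quotient map to \<open>c\<close>. Faces of cells need not be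
  listed as cells of their own.
\<close>

record ('c, 'p) cube_data =
  cells :: "'c set"
  cdim :: "'c \<Rightarrow> nat"
  chart :: "'c \<Rightarrow> (nat \<Rightarrow> real) \<Rightarrow> 'p"
  realization :: "'p topology"

text \<open>
  This is the definition of a polyhedral complex in Bridson and Haefliger, Metric Spaces of
  Non-Positive Curvature, I.7.37, with unit cubes as cells. Distinct faces of the same cell
  may be glued to each other, and two cells may share several faces.
\<close>

definition cube_complex :: "('c, 'p) cube_data \<Rightarrow> bool"
  where "cube_complex X \<longleftrightarrow>
    quotient_map (sum_topology (\<lambda>c. cube_topology (cdim X c)) (cells X)) (realization X)
      (\<lambda>(c, x). chart X c x) \<and>
    (\<forall>c\<in>cells X. \<forall>x\<in>cube (cdim X c). \<forall>y\<in>cube (cdim X c).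
       support (cdim X c) x = support (cdim X c) y \<and> chart X c x = chart X c y \<longrightarrow> x = y) \<and>
    (\<forall>c\<in>cells X. \<forall>d\<in>cells X. \<forall>x\<in>cube (cdim X c). \<forall>y\<in>cube (cdim X d).
       chart X c x = chart X d y \<longrightarrow>
       (\<exists>h. cube_isometry (cdim X c) (support (cdim X c) x) (cdim X d) (support (cdim X d) y) h \<and>
            (\<forall>z\<in>support (cdim X c) x. chart X c z = chart X d (h z))))"

definition finite_dimensional :: "('c, 'p) cube_data \<Rightarrow> bool"
  where "finite_dimensional X \<longleftrightarrow> (\<exists>N. \<forall>c\<in>cells X. cdim X c \<le> N)"

definition vertices :: "('c, 'p) cube_data \<Rightarrow> 'p set"
  where "vertices X = (\<Union>c\<in>cells X. chart X c ` corners (cdim X c))"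

definition edges :: "('c, 'p) cube_data \<Rightarrow> ('p \<times> 'p) set"
  where "edges X = {(chart X c x, chart X c (x(i := 1 - x i))) | c x i.
    c \<in> cells X \<and> x \<in> corners (cdim X c) \<and> i < cdim X c}"

text \<open>
  If no edge path joins \<open>u\<close> to \<open>v\<close>, the value is unspecified; this does not occur in a
  path-connected complex.
\<close>

definition edge_dist :: "('c, 'p) cube_data \<Rightarrow> 'p \<Rightarrow> 'p \<Rightarrow> nat"
  where "edge_dist X u v = (LEAST n. (u, v) \<in> edges X ^^ n)"


section \<open>Links of vertices\<close>

text \<open>
  The triple \<open>(c, x, F)\<close> stands for the spherical simplex cut off at the corner \<open>x\<close> from the face
  \<open>face (cdim X c) x F\<close> of the cell \<open>c\<close>. Its vertices are the directions in \<open>F\<close>, so its dimension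
  is \<open>card F - 1\<close>. The link of the vertex \<open>v\<close> is assembled from all such simplices with
  \<open>chart X c x = v\<close>; two of them are the same simplex of the link iff the gluing of the complex
  identifies the two faces by an isometry that matches the two corners.
\<close>

type_synonym 'c cube_corner = "'c \<times> (nat \<Rightarrow> real) \<times> nat set"

definition link_corners :: "('c, 'p) cube_data \<Rightarrow> 'p \<Rightarrow> 'c cube_corner set"
  where "link_corners X v = {(c, x, F). c \<in> cells X \<and> x \<in> corners (cdim X c) \<and>
    F \<subseteq> {..<cdim X c} \<and> F \<noteq> {} \<and> chart X c x = v}"

definition link_rel :: "('c, 'p) cube_data \<Rightarrow> 'p \<Rightarrow> ('c cube_corner \<times> 'c cube_corner) set"
  where "link_rel X v = {((c, x, F), (d, y, G)).
    (c, x, F) \<in> link_corners X v \<and> (d, y, G) \<in> link_corners X v \<and>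
    (\<exists>h. cube_isometry (cdim X c) (face (cdim X c) x F) (cdim X d) (face (cdim X d) y G) h \<and>
         h x = y \<and> (\<forall>z\<in>face (cdim X c) x F. chart X c z = chart X d (h z)))}"

text \<open>The vertices of the link are the \<open>link_rel\<close>-classes of the one-direction corners.\<close>

fun simplex_vertices ::
    "('c, 'p) cube_data \<Rightarrow> 'p \<Rightarrow> 'c cube_corner \<Rightarrow> 'c cube_corner set set"
  where "simplex_vertices X v (c, x, F) = (\<lambda>i. link_rel X v `` {(c, x, {i})}) ` F"

text \<open>
  In a general cube complex the link is only a complex of glued simplices. It is a simplicial complex
  iff the vertices of each simplex are distinct and a simplex is determined by its vertices.
\<close>

definition link_simplicial :: "('c, 'p) cube_data \<Rightarrow> 'p \<Rightarrow> bool"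
  where "link_simplicial X v \<longleftrightarrow>
    (\<forall>(c, x, F) \<in> link_corners X v. inj_on (\<lambda>i. link_rel X v `` {(c, x, {i})}) F) \<and>
    (\<forall>\<sigma>\<in>link_corners X v. \<forall>\<tau>\<in>link_corners X v.
       simplex_vertices X v \<sigma> = simplex_vertices X v \<tau> \<longrightarrow> (\<sigma>, \<tau>) \<in> link_rel X v)"

definition link_complex :: "('c, 'p) cube_data \<Rightarrow> 'p \<Rightarrow> 'c cube_corner set set set"
  where "link_complex X v = simplex_vertices X v ` link_corners X v"

text \<open>
  For an abstract simplicial complex, given by the set \<open>K\<close> of the vertex sets of its nonempty
  simplices: pairwise adjacent vertices span a simplex. (The case \<open>s = t\<close> says that \<open>s\<close> is a vertex.)
\<close>

definition flag :: "'a set set \<Rightarrow> bool"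
  where "flag K \<longleftrightarrow>
    (\<forall>S. finite S \<and> S \<noteq> {} \<and> (\<forall>s\<in>S. \<forall>t\<in>S. {s, t} \<in> K) \<longrightarrow> S \<in> K)"

definition link_flag :: "('c, 'p) cube_data \<Rightarrow> 'p \<Rightarrow> bool"
  where "link_flag X v \<longleftrightarrow> link_simplicial X v \<and> flag (link_complex X v)"


section \<open>CAT(0) cube complexes\<close>

text \<open>
  Path connected with trivial fundamental groups. The library's \<^const>\<open>simply_connected\<close> is for
  subsets of a type of class \<open>topological_space\<close>; the lemma below shows that the notions agree on
  subsets of normed spaces.
\<close>

definition simply_connected_space :: "'a topology \<Rightarrow> bool"
  where "simply_connected_space T \<longleftrightarrow> path_connected_space T \<and>
    (\<forall>p. pathin T p \<and> p 0 = p 1 \<longrightarrow>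
      homotopic_with (\<lambda>q. q 0 = p 0 \<and> q 1 = p 1) (top_of_set {0..1}) T p (\<lambda>_. p 0))"

lemma simply_connected_space_top_of_set:
  fixes S :: "'a::real_normed_vector set"
  shows "simply_connected_space (top_of_set S) \<longleftrightarrow> simply_connected S"
proof -
  have "path_connected_space (top_of_set S) \<longleftrightarrow> path_connected S"
    by (auto simp: path_connected_space_def path_connected_def pathin_canon_iff path_image_def
        pathstart_def pathfinish_def image_subset_iff_funcset)
  then show ?thesis
    by (auto simp: simply_connected_space_def simply_connected_eq_contractible_path
        pathin_canon_iff path_image_def pathstart_def pathfinish_def homotopic_paths_def
        image_subset_iff_funcset linepath_refl)
qed

definition CAT0_cube_complex :: "('c, 'p) cube_data \<Rightarrow> bool"
  where "CAT0_cube_complex X \<longleftrightarrow>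
    cube_complex X \<and> simply_connected_space (realization X) \<and> (\<forall>v\<in>vertices X. link_flag X v)"


section \<open>Asymptotic dimension\<close>

definition r_disjoint :: "('a \<Rightarrow> 'a \<Rightarrow> real) \<Rightarrow> real \<Rightarrow> 'a set set \<Rightarrow> bool"
  where "r_disjoint d r \<U> \<longleftrightarrow>
    (\<forall>A\<in>\<U>. \<forall>B\<in>\<U>. A \<noteq> B \<longrightarrow> (\<forall>a\<in>A. \<forall>b\<in>B. r \<le> d a b))"

definition asdim_le :: "'a set \<Rightarrow> ('a \<Rightarrow> 'a \<Rightarrow> real) \<Rightarrow> nat \<Rightarrow> bool"
  where "asdim_le Y d n \<longleftrightarrow> (\<forall>r>0. \<exists>\<U> :: nat \<Rightarrow> 'a set set.
    Y = (\<Union>i\<le>n. \<Union>(\<U> i)) \<and>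
    (\<forall>i\<le>n. r_disjoint d r (\<U> i)) \<and>
    (\<exists>D. \<forall>i\<le>n. \<forall>A\<in>\<U> i. \<forall>a\<in>A. \<forall>b\<in>A. d a b \<le> D))"

definition finite_asdim :: "'a set \<Rightarrow> ('a \<Rightarrow> 'a \<Rightarrow> real) \<Rightarrow> bool"
  where "finite_asdim Y d \<longleftrightarrow> (\<exists>n. asdim_le Y d n)"

end

theory Submission
  imports Defs "HOL-Library.Nat_Bijection"
begin

text \<open>
  Call an edge path reduced if no sequence of square flips creates a backtrack. Flag links make
  the edges of the complex act on the flip classes of reduced paths, compatibly with squares, so
  these classes form a local system on the complex. It is trivial because the
  realization is simply connected: reduced paths with the same ends differ by square flips. Hence
  the 1-skeleton is bipartite, satisfies the quadrangle condition for every base point and contains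
  no \<open>K\<^sub>2\<^sub>,\<^sub>3\<close>, i.e. it is a median graph. Fix a base point. Sending a vertex \<open>x\<close> to the set of
  vertices with a unique lower neighbour that lie below \<open>x\<close> (one for each hyperplane separating \<open>x\<close>
  from the base point) turns the edge distance into the cardinality of the symmetric difference of
  downsets of a poset. Antichains in these downsets have at most as many elements as the
  dimension.

  Finite asymptotic dimension of such families of downsets follows by induction on the width.
  After a decomposition into annuli according to height, every downset \<open>x\<close> in an annulus contains
  an element \<open>a\<close> somewhat below the annulus, and the sets \<open>{x. a \<in> x}\<close> form a cover of the annulus of
  bounded multiplicity and large Lebesgue number. Up to boundedly many elements, a member of such
  a set is determined by its elements incomparable to \<open>a\<close>, and these have smaller width.
\<close>

section \<open>Families of downsets of a poset\<close>

text \<open>The definition of a cube complex allows self-gluings and is purely local, so neither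
  hyperplanes nor medians are available at the start. Everything global comes from simple
  connectedness, a statement on continuous paths in a quotient space. The bridge to edge paths is a
  covering whose points are points of cells equipped with flat sections; trivial monodromy, applied
  to the class of the empty path, shows that the class of a reduced path depends only on its ends.
  Oriented edges are parametrised maps and not pairs of vertices, since loops and multiple edges
  cannot be excluded before that point. The target of the coarse part is a colouring: if the
  components of each colour under jumps of length at most \<open>r\<close> are uniformly bounded,
  they form the families in the definition of asymptotic dimension, one family per colour. The set
  of colours must be independent of \<open>r\<close>, whereas the bound may depend on it. That bound
  must also be uniform over all families of a given width, since the induction applies the
  hypothesis to the links of all elements at once.\<close>

definition sdist :: "'a set \<Rightarrow> 'a set \<Rightarrow> nat"
  where "sdist x y = card ((x - y) \<union> (y - x))"

lemma sdist_commute: "sdist x y = sdist y x"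
  by (simp add: sdist_def Un_commute)

lemma sdist_triangle:
  assumes "finite x" "finite y" "finite z"
  shows "sdist x z \<le> sdist x y + sdist y z"
proof -
  have "sdist x z \<le> card (((x - y) \<union> (y - x)) \<union> ((y - z) \<union> (z - y)))"
    unfolding sdist_def using assms by (intro card_mono) auto
  also have "\<dots> \<le> sdist x y + sdist y z"
    unfolding sdist_def by (rule card_Un_le)
  finally show ?thesis .
qed

lemma card_diff_le_sdist: "finite x \<Longrightarrow> finite y \<Longrightarrow> card (x - y) \<le> sdist x y"
  unfolding sdist_def by (intro card_mono) auto

text \<open>The reflexive transitive closure describes the \<open>r\<close>-components of the colour
  classes of \<open>\<kappa>\<close> in \<open>F\<close>.\<close>

definition r_step :: "('a \<Rightarrow> 'a \<Rightarrow> nat) \<Rightarrow> 'a set \<Rightarrow> ('a \<Rightarrow> 'k) \<Rightarrow> nat \<Rightarrow> 'a \<Rightarrow> 'a \<Rightarrow> bool"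
  where "r_step d F \<kappa> r x y \<longleftrightarrow> x \<in> F \<and> y \<in> F \<and> \<kappa> x = \<kappa> y \<and> d x y \<le> r"

lemma r_step_rtranclp_in: "(r_step d F \<kappa> r)\<^sup>*\<^sup>* x y \<Longrightarrow> x \<in> F \<Longrightarrow> y \<in> F"
  by (induction rule: rtranclp_induct) (auto simp: r_step_def)

section \<open>Heights and ranks in a family of downsets\<close>

inductive height_ge :: "('h \<Rightarrow> 'h \<Rightarrow> bool) \<Rightarrow> 'h set \<Rightarrow> nat \<Rightarrow> 'h \<Rightarrow> bool" for lt C where
  "e \<in> C \<Longrightarrow> height_ge lt C 0 e"
| "e \<in> C \<Longrightarrow> lt e' e \<Longrightarrow> height_ge lt C n e' \<Longrightarrow> height_ge lt C (Suc n) e"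

text \<open>Heights refer to the whole ground set \<open>C\<close>, so that all members of
  \<open>F\<close> agree on them; on elements of members the maximum exists because members are
  finite downsets.\<close>

definition height :: "('h \<Rightarrow> 'h \<Rightarrow> bool) \<Rightarrow> 'h set \<Rightarrow> 'h \<Rightarrow> nat"
  where "height lt C e = Max {n. height_ge lt C n e}"

locale downset_family =
  fixes lt :: "'h \<Rightarrow> 'h \<Rightarrow> bool" and C :: "'h set" and F :: "'h set set" and D :: nat
  assumes trans: "lt a b \<Longrightarrow> lt b c \<Longrightarrow> lt a c"
    and irrefl: "\<not> lt a a"
    and finite_F: "x \<in> F \<Longrightarrow> finite x"
    and sub_C: "x \<in> F \<Longrightarrow> x \<subseteq> C"
    and down: "x \<in> F \<Longrightarrow> e \<in> x \<Longrightarrow> lt e' e \<Longrightarrow> e' \<in> C \<Longrightarrow> e' \<in> x"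
    and width: "x \<in> F \<Longrightarrow> A \<subseteq> x \<Longrightarrow> (\<And>a b. a \<in> A \<Longrightarrow> b \<in> A \<Longrightarrow> \<not> lt a b) \<Longrightarrow> card A \<le> D"
begin

abbreviation "ht \<equiv> height lt C"
abbreviation "hge \<equiv> height_ge lt C"

text \<open>A chain of \<open>n\<close> steps below \<open>e\<close> stays in the downset
  \<open>x\<close> and consists of \<open>n + 1\<close> different elements.\<close>

lemma hge_card:
  assumes "hge n e" "x \<in> F" "e \<in> x"
  shows "n < card {c \<in> x. c = e \<or> lt c e}"
  using assms
proof (induction rule: height_ge.induct)
  case (1 e)
  have "{c \<in> x. c = e \<or> lt c e} \<noteq> {}" using 1 by blast
  then show ?case using finite_F[OF 1(2)] by (simp add: card_gt_0_iff)
next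
  case (2 e e' n)
  have "e' \<in> x" using down[OF 2(5,6,2)] 2(3) by (auto elim: height_ge.cases)
  then have n: "n < card {c \<in> x. c = e' \<or> lt c e'}" using 2 by blast
  have "insert e {c \<in> x. c = e' \<or> lt c e'} \<subseteq> {c \<in> x. c = e \<or> lt c e}"
    using 2 trans \<open>e' \<in> x\<close> by blast
  then have "card (insert e {c \<in> x. c = e' \<or> lt c e'}) \<le> card {c \<in> x. c = e \<or> lt c e}"
    using finite_F[OF 2(5)] by (intro card_mono) auto
  moreover have "card (insert e {c \<in> x. c = e' \<or> lt c e'}) = Suc (card {c \<in> x. c = e' \<or> lt c e'})"
    using 2(2) irrefl trans finite_F[OF 2(5)] by (intro card_insert_disjoint) auto
  ultimately show ?case using n by linarith
qed

lemma hge_finite: "x \<in> F \<Longrightarrow> e \<in> x \<Longrightarrow> finite {n. hge n e}"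
  by (rule finite_subset[of _ "{..<card {c \<in> x. c = e \<or> lt c e}}"]) (auto dest: hge_card)

lemma hge_ht: "x \<in> F \<Longrightarrow> e \<in> x \<Longrightarrow> hge (ht e) e"
  using Max_in[OF hge_finite, of x e] height_ge.intros(1)[of e C lt] sub_C[of x]
  unfolding height_def by blast

lemma hge_le_ht: "x \<in> F \<Longrightarrow> e \<in> x \<Longrightarrow> hge n e \<Longrightarrow> n \<le> ht e"
  unfolding height_def using hge_finite by (auto intro: Max_ge)

lemma ht_less:
  assumes "x \<in> F" "e \<in> x" "e' \<in> x" "lt e' e"
  shows "ht e' < ht e"
  using hge_le_ht[OF assms(1,2)] height_ge.intros(2)[OF _ assms(4) hge_ht[OF assms(1,3)]]
    assms sub_C by fastforce

lemma ht_pred: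
  assumes "x \<in> F" "e \<in> x" "ht e = Suc n"
  obtains e' where "e' \<in> x" "lt e' e" "ht e' = n"
proof -
  have "hge (Suc n) e" using hge_ht[OF assms(1,2)] assms(3) by simp
  then obtain e' where e': "lt e' e" "hge n e'" by (auto elim: height_ge.cases)
  then have "e' \<in> x" using down[OF assms(1,2)] by (auto elim: height_ge.cases)
  moreover have "n \<le> ht e'" using hge_le_ht[OF assms(1) \<open>e' \<in> x\<close> e'(2)] .
  moreover have "ht e' < ht e" using ht_less assms \<open>e' \<in> x\<close> e' by blast
  ultimately show thesis using that e' assms(3) by simp
qed

text \<open>Descending through predecessors whose height drops by exactly one meets
  \<open>ht e - j + 1\<close> elements of \<open>x\<close> that are \<open>a\<close> or above
  \<open>a\<close>. This count makes \<open>a\<close> robust under small changes of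
  \<open>x\<close>.\<close>

lemma ht_descend:
  assumes "x \<in> F" "e \<in> x" "j \<le> ht e"
  obtains a where "a \<in> x" "ht a = j" "a = e \<or> lt a e"
    "ht e - j < card {c \<in> x. c = a \<or> lt a c}"
proof -
  have "\<exists>a. a \<in> x \<and> ht a = j \<and> (a = e \<or> lt a e) \<and> ht e - j < card {c \<in> x. c = a \<or> lt a c}"
    using assms(3)
  proof (induction "ht e - j" arbitrary: j)
    case 0
    have "{c \<in> x. c = e \<or> lt e c} \<noteq> {}" using assms by blast
    then have "0 < card {c \<in> x. c = e \<or> lt e c}" using finite_F[OF assms(1)]
      by (simp add: card_gt_0_iff)
    then show ?case using 0 assms by (intro exI[of _ e]) auto
  next
    case (Suc k)
    then obtain a where a: "a \<in> x" "ht a = Suc j" "a = e \<or> lt a e"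
      "ht e - Suc j < card {c \<in> x. c = a \<or> lt a c}"
      using Suc(1)[of "Suc j"] Suc(2) by fastforce
    obtain b where b: "b \<in> x" "lt b a" "ht b = j" using ht_pred[OF assms(1) a(1,2)] by blast
    have "insert b {c \<in> x. c = a \<or> lt a c} \<subseteq> {c \<in> x. c = b \<or> lt b c}" using a b trans by blast
    then have "card (insert b {c \<in> x. c = a \<or> lt a c}) \<le> card {c \<in> x. c = b \<or> lt b c}"
      using finite_F[OF assms(1)] by (intro card_mono) auto
    moreover have "card (insert b {c \<in> x. c = a \<or> lt a c}) = Suc (card {c \<in> x. c = a \<or> lt a c})"
      using b irrefl trans finite_F[OF assms(1)] by (intro card_insert_disjoint) auto
    ultimately have "ht e - j < card {c \<in> x. c = b \<or> lt b c}"
      using a(4) by linarith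
    then show ?case using a b trans by blast
  qed
  then show thesis using that by blast
qed

text \<open>A level is an antichain, as heights increase strictly along \<open>lt\<close>.\<close>

lemma card_level:
  assumes "x \<in> F" shows "card {e \<in> x. ht e = j} \<le> D"
  by (rule width[OF assms]) (use ht_less[OF assms] in fastforce)+

lemma card_levels:
  assumes "x \<in> F" "finite J" shows "card {e \<in> x. ht e \<in> J} \<le> D * card J"
proof -
  have "{e \<in> x. ht e \<in> J} = (\<Union>j\<in>J. {e \<in> x. ht e = j})" by auto
  then have "card {e \<in> x. ht e \<in> J} \<le> (\<Sum>j\<in>J. card {e \<in> x. ht e = j})"
    using card_UN_le[OF assms(2)] by metis
  also have "\<dots> \<le> (\<Sum>j\<in>J. D)" using card_level[OF assms(1)] by (intro sum_mono)
  finally show ?thesis by (simp add: mult.commute)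
qed

text \<open>The inserted 0 serves the empty set, and \<open>Suc\<close> separates it from sets
  consisting of minimal elements.\<close>

definition rank :: "'h set \<Rightarrow> nat"
  where "rank x = Max (insert 0 ((\<lambda>e. Suc (ht e)) ` x))"

lemma rank_gt: "x \<in> F \<Longrightarrow> e \<in> x \<Longrightarrow> ht e < rank x"
  using finite_F[of x] unfolding rank_def by (auto simp: Suc_le_eq[symmetric] intro!: Max_ge)

lemma rank_witness:
  assumes "x \<in> F" "0 < rank x"
  obtains e where "e \<in> x" "rank x = Suc (ht e)"
proof -
  have "rank x \<in> insert 0 ((\<lambda>e. Suc (ht e)) ` x)"
    using finite_F[OF assms(1)] unfolding rank_def by (intro Max_in) auto
  then show thesis using that assms(2) by auto
qed

text \<open>Removing \<open>l\<close> elements from a downset lowers a chain from its top, so levels more than \<open>l\<close> below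
  the top survive.\<close>

lemma common_element:
  assumes "x \<in> F" "j < rank x"
  obtains a where "a \<in> x" "ht a = j" "\<And>y. y \<in> F \<Longrightarrow> sdist x y < rank x - j \<Longrightarrow> a \<in> y"
proof -
  obtain e where e: "e \<in> x" "rank x = Suc (ht e)" using rank_witness assms
    by (metis gr_zeroI not_less0)
  obtain a where a: "a \<in> x" "ht a = j" "ht e - j < card {c \<in> x. c = a \<or> lt a c}"
    using ht_descend[OF assms(1) e(1), of j] assms(2) e(2) by force
  have "a \<in> y" if y: "y \<in> F" "sdist x y < rank x - j" for y
  proof (rule ccontr)
    assume "a \<notin> y"
    then have "{c \<in> x. c = a \<or> lt a c} \<subseteq> x - y"
      using down[OF y(1)] a(1) sub_C[OF assms(1)] by blast
    then have "card {c \<in> x. c = a \<or> lt a c} \<le> card (x - y)"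
      using finite_F[OF assms(1)] by (intro card_mono) auto
    also have "\<dots> \<le> sdist x y" using card_diff_le_sdist finite_F assms(1) y(1) by blast
    finally show False using y(2) a(3) e(2) by simp
  qed
  then show thesis using that a by blast
qed

text \<open>If the rank dropped by more than the distance, the robust element of \<open>x\<close> at
  height \<open>rank y\<close> would belong to \<open>y\<close>, whose heights are all
  smaller.\<close>

lemma rank_lipschitz:
  assumes "x \<in> F" "y \<in> F"
  shows "rank x \<le> rank y + sdist x y"
proof (rule ccontr)
  assume "\<not> ?thesis"
  then have *: "rank y < rank x" "sdist x y < rank x - rank y" by linarith+
  obtain a where "ht a = rank y" "a \<in> y"
    using common_element[OF assms(1) *(1)] assms(2) *(2) by metis
  then show False using rank_gt[OF assms(2)] by fastforce
qed


section \<open>Links of an element and the drop of width\<close>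

definition links :: "'h \<Rightarrow> 'h set \<Rightarrow> 'h set"
  where "links a x = {e \<in> x. e \<noteq> a \<and> \<not> lt e a \<and> \<not> lt a e}"

text \<open>Adding \<open>a\<close> to an antichain of elements incomparable to it gives a larger
  antichain, which costs one unit of width. The ground set shrinks to \<open>links a C\<close>,
  because the new sets are closed downwards only there.\<close>

lemma downset_family_links:
  assumes "D = Suc n"
  shows "downset_family lt (links a C) (links a ` {x \<in> F. a \<in> x}) n"
proof
  fix x e e'
  assume "x \<in> links a ` {x \<in> F. a \<in> x}" "e \<in> x" "lt e' e" "e' \<in> links a C"
  then show "e' \<in> x" using down unfolding links_def by blast
next
  fix x A
  assume x: "x \<in> links a ` {x \<in> F. a \<in> x}" "A \<subseteq> x"
    and A: "\<And>a b. a \<in> A \<Longrightarrow> b \<in> A \<Longrightarrow> \<not> lt a b"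
  then obtain y where y: "y \<in> F" "a \<in> y" "A \<subseteq> links a y" by blast
  have "card (insert a A) \<le> D"
    using y A irrefl by (intro width[OF y(1)]) (auto simp: links_def)
  moreover have "finite A" using y finite_F[OF y(1)] unfolding links_def
    by (auto intro: finite_subset)
  moreover have "a \<notin> A" using y unfolding links_def by blast
  ultimately show "card A \<le> n" using assms by simp
next
  fix x assume "x \<in> links a ` {x \<in> F. a \<in> x}"
  then show "finite x" "x \<subseteq> links a C" using finite_F sub_C unfolding links_def by auto
qed (use trans irrefl in blast)+

lemma sdist_links_le:
  assumes "x \<in> F" "y \<in> F" "a \<in> x" "a \<in> y"
  shows "sdist (links a x) (links a y) \<le> sdist x y"
  using finite_F assms unfolding sdist_def links_def by (intro card_mono) auto

text \<open>Elements below \<open>a\<close> lie in both sets, and those above \<open>a\<close>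
  occupy at most \<open>B\<close> levels of at most \<open>D\<close> elements in each set; the rest
  of the difference is incomparable to \<open>a\<close>.\<close>

lemma sdist_le_links:
  assumes "x \<in> F" "y \<in> F" "a \<in> x" "a \<in> y" "rank x \<le> ht a + B" "rank y \<le> ht a + B"
  shows "sdist x y \<le> sdist (links a x) (links a y) + 2 * (D * B)"
proof -
  have up: "card {e \<in> z. lt a e} \<le> D * B" if "z \<in> F" "a \<in> z" "rank z \<le> ht a + B" for z
  proof -
    have "{e \<in> z. lt a e} \<subseteq> {e \<in> z. ht e \<in> {ht a..<ht a + B}}"
      using rank_gt[OF that(1)] ht_less[OF that(1) _ that(2)] that(3) by fastforce
    then have "card {e \<in> z. lt a e} \<le> card {e \<in> z. ht e \<in> {ht a..<ht a + B}}"
      using finite_F[OF that(1)] by (intro card_mono) auto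
    also have "\<dots> \<le> D * card {ht a..<ht a + B}" using that(1) by (intro card_levels) auto
    finally show ?thesis by simp
  qed
  let ?L = "(links a x - links a y) \<union> (links a y - links a x)"
  have "(x - y) \<union> (y - x) \<subseteq> ?L \<union> ({e \<in> x. lt a e} \<union> {e \<in> y. lt a e})"
    using down[OF assms(1,3)] down[OF assms(2,4)] sub_C assms unfolding links_def by blast
  then have "sdist x y \<le> card (?L \<union> ({e \<in> x. lt a e} \<union> {e \<in> y. lt a e}))"
    unfolding sdist_def using finite_F assms by (intro card_mono) (auto simp: links_def)
  also have "\<dots> \<le> card ?L + (card {e \<in> x. lt a e} + card {e \<in> y. lt a e})"
    by (meson card_Un_le add_left_mono order_trans)
  finally show ?thesis using up[OF assms(1,3,5)] up[OF assms(2,4,6)] unfolding sdist_def by linarith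
qed

lemma card_le_rank: "x \<in> F \<Longrightarrow> card x \<le> D * rank x"
proof -
  assume x: "x \<in> F"
  then have "x = {e \<in> x. ht e \<in> {..<rank x}}" using rank_gt by auto
  then show ?thesis using card_levels[OF x, of "{..<rank x}"] by simp
qed

text \<open>This is the distance from \<open>x\<close> to the members of \<open>G\<close> that miss
  \<open>a\<close>, truncated at \<open>L\<close> so that the maximum exists even if no member
  misses \<open>a\<close>.\<close>

definition depth :: "'h set set \<Rightarrow> nat \<Rightarrow> 'h \<Rightarrow> 'h set \<Rightarrow> nat"
  where "depth G L a x = Max {l. l \<le> L \<and> (\<forall>y\<in>G. sdist x y < l \<longrightarrow> a \<in> y)}"

lemma depth_iff:
  "l \<le> depth G L a x \<longleftrightarrow> l \<le> L \<and> (\<forall>y\<in>G. sdist x y < l \<longrightarrow> a \<in> y)" (is "_ \<longleftrightarrow> ?P l")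
proof
  have *: "finite {l. ?P l}" "{l. ?P l} \<noteq> {}" by (auto intro: exI[of _ 0])
  then have "?P (depth G L a x)" unfolding depth_def using Max_in[OF *] by blast
  then show "l \<le> depth G L a x \<Longrightarrow> ?P l" by fastforce
  show "?P l \<Longrightarrow> l \<le> depth G L a x" unfolding depth_def using * by (auto intro: Max_ge)
qed

lemma depth_lipschitz:
  assumes "G \<subseteq> F" "x \<in> G" "y \<in> G"
  shows "depth G L a x \<le> depth G L a y + sdist x y"
proof -
  have "depth G L a x - sdist x y \<le> depth G L a y"
    unfolding depth_iff
  proof (intro conjI ballI impI)
    show "depth G L a x - sdist x y \<le> L" using depth_iff[of "depth G L a x" G L a x] by linarith
    fix z assume z: "z \<in> G" "sdist y z < depth G L a x - sdist x y"
    then have "sdist x z < depth G L a x"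
      using sdist_triangle[of x y z] finite_F assms by fastforce
    then show "a \<in> z" using depth_iff[of "depth G L a x" G L a x] z by blast
  qed
  then show ?thesis by linarith
qed

text \<open>A cover of multiplicity at most \<open>D\<close> with large Lebesgue number: by pigeonhole, one of
  \<open>D\<close> gaps between consecutive depth thresholds contains no depth.\<close>

lemma stable_threshold:
  assumes G: "G \<subseteq> F" and x: "x \<in> G" and L: "L = D * r + 1"
    and rank: "M + L \<le> rank x"
  defines "S \<equiv> \<lambda>j. {a. ht a = M \<and> L - j * r \<le> depth G L a x}"
  shows "\<exists>j<D. S j = S (Suc j)" "S j \<noteq> {}" "j \<le> D \<Longrightarrow> a \<in> S j \<Longrightarrow> a \<in> x \<and> ht a = M"
proof -
  \<comment> \<open>By the choice \<open>L = D * r + 1\<close> all thresholds used are at least 1,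
    and depth at least 1 forces \<open>a \<in> x\<close> because \<open>x\<close> is at distance 0
    from itself.\<close>
  have inx: "a \<in> x \<and> ht a = M" if "j \<le> D" "a \<in> S j" for a j
  proof -
    have "j * r \<le> D * r" using that by simp
    moreover have "L - j * r \<le> depth G L a x" using that(2) unfolding S_def by simp
    ultimately have "1 \<le> depth G L a x" using L by linarith
    then show ?thesis using depth_iff[of 1 G L a x] x that unfolding S_def by (auto simp: sdist_def)
  qed
  show "j \<le> D \<Longrightarrow> a \<in> S j \<Longrightarrow> a \<in> x \<and> ht a = M" using inx .
  have mono: "S i \<subseteq> S j" if "i \<le> j" for i j
  proof -
    have "L - j * r \<le> L - i * r" using that by (intro diff_le_mono2) simp
    then show ?thesis unfolding S_def by auto
  qed
  have "M < rank x" "x \<in> F" using rank L x G by auto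
  then obtain a where a: "ht a = M" "\<And>y. y \<in> F \<Longrightarrow> sdist x y < rank x - M \<Longrightarrow> a \<in> y"
    using common_element by metis
  \<comment> \<open>\<open>common_element\<close> protects \<open>a\<close> below distance
    \<open>rank x - M\<close>, which is at least \<open>L\<close>.\<close>
  then have "L \<le> depth G L a x" unfolding depth_iff using rank G by (auto simp: less_diff_conv)
  then have "a \<in> S 0" using a unfolding S_def by simp
  then show ne: "S j \<noteq> {}" for j using mono[of 0 j] by auto
  have fin: "finite (S j)" if "j \<le> D" for j
    using inx[OF that] finite_F[of x] x G by (meson finite_subset subsetD subsetI)
  show "\<exists>j<D. S j = S (Suc j)"
  proof (rule ccontr)
    assume *: "\<not> ?thesis"
    \<comment> \<open>If consecutive sets always differ, each step adds an element, and
      \<open>S D\<close> outgrows the at most \<open>D\<close> elements of level \<open>M\<close> in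
      \<open>x\<close>.\<close>
    have "j < card (S j)" if "j \<le> D" for j
      using that
    proof (induction j)
      case 0 then show ?case using fin[of 0] \<open>a \<in> S 0\<close> by (auto simp: card_gt_0_iff)
    next
      case (Suc j)
      then have "S j \<subset> S (Suc j)" using * mono[of j "Suc j"] by auto
      then have "card (S j) < card (S (Suc j))" using fin[OF Suc(2)] psubset_card_mono by blast
      then show ?case using Suc by linarith
    qed
    then have "D < card (S D)" by simp
    moreover have "card (S D) \<le> card {e \<in> x. ht e = M}"
      using inx[of D] finite_F[of x] x G by (intro card_mono) auto
    ultimately show False using card_level[of x M] x G by auto
  qed
qed

end

text \<open>A colour records the parity of the annulus, the index of a stable threshold and the
  colour, known by induction, of the link part at a selected element. Along a monochromatic chain
  the annulus, the threshold and the selected element stay fixed, so the chain projects to a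
  monochromatic chain in a single link family.\<close>

lemma downset_family_coloring:
  "\<exists>Col :: nat set. finite Col \<and> (\<forall>r. \<exists>R. \<forall>(lt :: 'h \<Rightarrow> 'h \<Rightarrow> bool) C F. downset_family lt C F D \<longrightarrow>
    (\<exists>\<kappa>. \<kappa> ` F \<subseteq> Col \<and> (\<forall>x y. x \<in> F \<longrightarrow> (r_step sdist F \<kappa> r)\<^sup>*\<^sup>* x y \<longrightarrow> sdist x y \<le> R)))"
proof (induction D)
  case 0
  have "sdist x y = 0" if "downset_family lt C F 0" "x \<in> F" "y \<in> F" 
    for x y :: "'h set" and lt C F
  proof -
    interpret downset_family lt C F 0 by fact
    have "z = {}" if "z \<in> F" for z
      using width[OF that, of "{e}" for e] irrefl by fastforce
    then have "x = {}" "y = {}" using that by auto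
    then show ?thesis by (simp add: sdist_def)
  qed
  then show ?case
    by (intro exI[of _ "{0}"] conjI allI exI[of _ 0] impI exI[of _ "\<lambda>_. 0"])
      (auto dest: r_step_rtranclp_in)
next
  case (Suc n)
  then obtain Col :: "nat set" where Col: "finite Col"
    and IH: "\<And>r. \<exists>R. \<forall>(lt :: 'h \<Rightarrow> 'h \<Rightarrow> bool) C F. downset_family lt C F n \<longrightarrow>
    (\<exists>\<kappa>. \<kappa> ` F \<subseteq> Col \<and> (\<forall>x y. x \<in> F \<longrightarrow> (r_step sdist F \<kappa> r)\<^sup>*\<^sup>* x y \<longrightarrow> sdist x y \<le> R))"
    by metis
  define D where "D = Suc n"
  \<comment> \<open>A parity, followed by 0 for the innermost annulus or by a threshold index with a
    link colour; \<open>prod_encode\<close> keeps colours in one type throughout the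
    induction.\<close>
  define Col' where "Col' = prod_encode ` ({..1} \<times> insert 0 (prod_encode ` ({..<D} \<times> Col)))"
  have fin: "finite Col'" using Col unfolding Col'_def by auto
  have "\<exists>R. \<forall>(lt :: 'h \<Rightarrow> 'h \<Rightarrow> bool) C F. downset_family lt C F D \<longrightarrow>
    (\<exists>\<kappa>. \<kappa> ` F \<subseteq> Col' \<and> (\<forall>x y. x \<in> F \<longrightarrow> (r_step sdist F \<kappa> r)\<^sup>*\<^sup>* x y \<longrightarrow> sdist x y \<le> R))" for r
  proof -
    obtain R where R: "\<And>(lt :: 'h \<Rightarrow> 'h \<Rightarrow> bool) C F. downset_family lt C F n \<Longrightarrow>
      \<exists>\<kappa>. \<kappa> ` F \<subseteq> Col \<and> (\<forall>x y. x \<in> F \<longrightarrow> (r_step sdist F \<kappa> r)\<^sup>*\<^sup>* x y \<longrightarrow> sdist x y \<le> R)"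
      using IH[of r] by metis
    define L where "L = D * r + 1"
    \<comment> \<open>\<open>N\<close> exceeds \<open>r\<close>, so a jump changes the annulus index
      by at most one; it is also at least \<open>L\<close>, so that \<open>i * N - L\<close> is a
      genuine difference for \<open>i > 0\<close>.\<close>
    define N where "N = L + r"
    have "\<exists>\<kappa>. \<kappa> ` F \<subseteq> Col' \<and> (\<forall>x y. x \<in> F \<longrightarrow> (r_step sdist F \<kappa> r)\<^sup>*\<^sup>* x y \<longrightarrow>
      sdist x y \<le> R + 2 * (D * (N + L)))"
      if "downset_family lt C F D" for lt :: "'h \<Rightarrow> 'h \<Rightarrow> bool" and C F
    proof -
      interpret downset_family lt C F D by fact
      have "\<forall>a. \<exists>\<kappa>. \<kappa> ` (links a ` {x \<in> F. a \<in> x}) \<subseteq> Col \<and> (\<forall>x y. x \<in> links a ` {x \<in> F. a \<in> x} \<longrightarrow>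
          (r_step sdist (links a ` {x \<in> F. a \<in> x}) \<kappa> r)\<^sup>*\<^sup>* x y \<longrightarrow> sdist x y \<le> R)"
        using R[OF downset_family_links] D_def by blast
      from choice[OF this] obtain K where K: "\<forall>a. K a ` (links a ` {x \<in> F. a \<in> x}) \<subseteq> Col \<and>
        (\<forall>x y. x \<in> links a ` {x \<in> F. a \<in> x} \<longrightarrow>
          (r_step sdist (links a ` {x \<in> F. a \<in> x}) (K a) r)\<^sup>*\<^sup>* x y \<longrightarrow> sdist x y \<le> R)"
        by (rule exE)
      have K1: "K a (links a x) \<in> Col" if "x \<in> F" "a \<in> x" for a x
        using K[rule_format, of a, THEN conjunct1] that by blast
      have K2: "sdist (links a x) y \<le> R" if "x \<in> F" "a \<in> x"
        "(r_step sdist (links a ` {x \<in> F. a \<in> x}) (K a) r)\<^sup>*\<^sup>* (links a x) y" for a x y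
        using K[rule_format, of a, THEN conjunct2, rule_format, OF _ that(3)] that(1,2) by blast
      define k where "k x = rank x div N" for x
      define G where "G i = {x \<in> F. k x = i}" for i
      \<comment> \<open>Level \<open>M i\<close> lies \<open>L\<close> below the bottom of annulus
        \<open>i\<close>, so every member of the annulus has an element there of full depth.\<close>
      define M where "M i = i * N - L" for i
      define S where "S x j = {a. ht a = M (k x) \<and> L - j * r \<le> depth (G (k x)) L a x}" for x j
      define J where "J x = (SOME j. j < D \<and> S x j = S x (Suc j))" for x
      \<comment> \<open>The choice depends on the set alone: members with equal threshold sets
        select the same element.\<close>
      define s where "s x = (SOME a. a \<in> S x (J x))" for x
      \<comment> \<open>The filler 0 may coincide with the code of a pair. This is harmless, as
        \<open>k\<close> is constant along monochromatic chains by parity alone.\<close>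
      define \<kappa> where "\<kappa> x = prod_encode (k x mod 2, if k x = 0 then 0
        else prod_encode (J x, K (s x) (links (s x) x)))" for x
      have N: "N > 0" "L \<le> N" "r < N" unfolding N_def L_def by auto
      have rank_k: "k x * N \<le> rank x" "rank x < k x * N + N" for x
        using dividend_less_div_times[OF N(1), of "rank x"] unfolding k_def
          by (simp_all add: add.commute)
      have M_add: "M i + L = i * N" if "i \<noteq> 0" for i
        using that N(2) unfolding M_def by (cases i) auto
      have x_G: "x \<in> G (k x)" "G (k x) \<subseteq> F" if "x \<in> F" for x using that unfolding G_def by auto
      have pre: "M (k x) + L \<le> rank x" if "k x \<noteq> 0" for x
        using rank_k(1)[of x] M_add[OF that] by simp
      have th1: "\<exists>j<D. S x j = S x (Suc j)" if "x \<in> F" "k x \<noteq> 0" for x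
        unfolding S_def by (rule stable_threshold(1)[OF x_G(2,1)[OF that(1)] L_def pre[OF that(2)]])
      have th2: "S x j \<noteq> {}" if "x \<in> F" "k x \<noteq> 0" for x j
        unfolding S_def by (rule stable_threshold(2)[OF x_G(2,1)[OF that(1)] L_def pre[OF that(2)]])
      have th3: "a \<in> x \<and> ht a = M (k x)" if "x \<in> F" "k x \<noteq> 0" "j \<le> D" "a \<in> S x j" for x j a
        using that(4) unfolding S_def
        by (rule stable_threshold(3)[OF x_G(2,1)[OF that(1)] L_def pre[OF that(2)] that(3)])
      have J: "J x < D" "S x (J x) = S x (Suc (J x))" if "x \<in> F" "k x \<noteq> 0" for x
        using someI_ex[OF th1[OF that]] unfolding J_def by blast+
      have s: "s x \<in> S x (J x)" if "x \<in> F" "k x \<noteq> 0" for x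
        using th2[OF that] unfolding s_def by (simp add: some_in_eq)
      have s_in: "s x \<in> x" "ht (s x) = M (k x)" if "x \<in> F" "k x \<noteq> 0" for x
        using th3[OF that _ s[OF that]] J(1)[OF that] by auto
      have "\<kappa> x \<in> Col'" if "x \<in> F" for x
        using J(1)[OF that] K1[OF that s_in(1)[OF that]] unfolding \<kappa>_def Col'_def by auto
      moreover have "sdist x y \<le> R + 2 * (D * (N + L))" if x: "x \<in> F"
        and chain: "(r_step sdist F \<kappa> r)\<^sup>*\<^sup>* x y" for x y
      proof -
        \<comment> \<open>Different annuli of equal parity are more than \<open>N\<close> apart in
          rank, against \<open>rank_lipschitz\<close>.\<close>
        have same_k: "k u = k v" if "r_step sdist F \<kappa> r u v" for u v
        proof (rule ccontr)
          assume "k u \<noteq> k v"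
          moreover have "k u mod 2 = k v mod 2" using that unfolding r_step_def \<kappa>_def by auto
          ultimately have "k u + 2 \<le> k v \<or> k v + 2 \<le> k u" by presburger
          then have "rank u + N < rank v \<or> rank v + N < rank u"
            using rank_k[of u] rank_k[of v] mult_le_mono1[of "k u + 2" "k v" N] mult_le_mono1[of "k v + 2" "k u" N]
            by (auto simp: algebra_simps)
          then show False
            using that rank_lipschitz[of u v] rank_lipschitz[of v u] N(3) sdist_commute[of u v]
            unfolding r_step_def by auto
        qed
        have kxy: "k y = k x" using chain
          by (induction rule: rtranclp_induct) (auto dest: same_k)
        have y: "y \<in> F" using r_step_rtranclp_in[OF chain x] .
        show ?thesis
        proof (cases "k x = 0")
          case True
          \<comment> \<open>There is no room for a level \<open>L\<close> below the innermost
            annulus, but its members are small enough to be bounded directly.\<close>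
          have "card z \<le> D * N" if "z \<in> F" "k z = 0" for z
            using card_le_rank[OF that(1)] rank_k(2)[of z, unfolded that(2)] mult_le_mono2[of "rank z" N D] by linarith
          then have "card x \<le> D * N" "card y \<le> D * N" using x y kxy True by simp_all
          then have "card x + card y \<le> 2 * (D * N)" by linarith
          moreover have "sdist x y \<le> card x + card y"
            unfolding sdist_def using finite_F x y
            by (meson Diff_subset add_mono card_Un_le card_mono order_trans)
          ultimately show ?thesis by (auto simp: algebra_simps)
        next
          case False
          define a where "a = s x"
          have inv: "k y = k x \<and> S y (J y) = S x (J x) \<and> J y = J x \<and>
            (r_step sdist (links a ` {x \<in> F. a \<in> x}) (K a) r)\<^sup>*\<^sup>* (links a x) (links a y)" using chain
          proof (induction rule: rtranclp_induct)
            case base then show ?case by simp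
          next
            case (step u v)
            have uv: "u \<in> F" "v \<in> F" "sdist u v \<le> r" "\<kappa> u = \<kappa> v" using step(2) unfolding r_step_def
              by auto
            have kv: "k v = k x" "k u = k x" using same_k[OF step(2)] step(3) by auto
            have J_eq: "J u = J v" using uv(4) kv False unfolding \<kappa>_def by auto
            have half: "S u' (J u') \<subseteq> S v' (J v')" if "u' \<in> F" "v' \<in> F" "sdist u' v' \<le> r"
              "k u' = k x" "k v' = k x"
              "J u' = J v'" for u' v'
            proof -
              \<comment> \<open>A jump costs at most \<open>r\<close> of depth, so it leads into the
                next threshold set, which equals the current one by stability.\<close>
              have "S u' (J u') \<subseteq> S v' (Suc (J v'))"
              proof
                fix b assume "b \<in> S u' (J u')"
                then have b: "ht b = M (k x)" "L - J v' * r \<le> depth (G (k x)) L b u'"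
                  using that unfolding S_def by auto
                have "depth (G (k x)) L b u' \<le> depth (G (k x)) L b v' + sdist u' v'"
                  using that by (intro depth_lipschitz) (auto simp: G_def)
                then have "L - Suc (J v') * r \<le> depth (G (k x)) L b v'"
                  using b(2) that(3) by simp
                then show "b \<in> S v' (Suc (J v'))" using b(1) that unfolding S_def by simp
              qed
              then show ?thesis using J(2)[OF that(2)] that False by simp
            qed
            have S_eq: "S u (J u) = S v (J v)"
              using half[OF uv(1,2,3) kv(2,1) J_eq] half[OF uv(2,1) _ kv(1,2) J_eq[symmetric]] uv(3)
              by (simp add: sdist_commute[of u] subset_antisym)
            then have "s u = a" "s v = a" using step(3) unfolding s_def a_def by auto
            then have "a \<in> u" "a \<in> v" "K a (links a u) = K a (links a v)"
              using s_in(1)[OF uv(1)] s_in(1)[OF uv(2)] uv(4) kv False unfolding \<kappa>_def by auto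
            then have "r_step sdist (links a ` {x \<in> F. a \<in> x}) (K a) r (links a u) (links a v)"
              using uv sdist_links_le[of u v a] unfolding r_step_def by auto
            then show ?case
              using step(3) S_eq J_eq kv rtranclp.rtrancl_into_rtrancl[of _ "links a x" "links a u"]
                by metis
          qed
          have "S y (J y) = S x (J x)" using inv by blast
          then have "s y = a" unfolding s_def a_def by (simp only:)
          then have a: "a \<in> x" "a \<in> y" "ht a = M (k x)" using s_in[OF x False] s_in[OF y] False kxy
            unfolding a_def by auto
          have "sdist (links a x) (links a y) \<le> R" using K2[OF x a(1)] inv by blast
          moreover have "rank x \<le> ht a + (N + L)" "rank y \<le> ht a + (N + L)"
            using rank_k[of x] rank_k[of y] kxy M_add[OF False] a(3) by auto
          ultimately show ?thesis using sdist_le_links[OF x y a(1,2), of "N + L"] by linarith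
        qed
      qed
      ultimately show ?thesis by (intro exI[of _ \<kappa>]) blast
    qed
    then show ?thesis by blast
  qed
  then show ?case using fin unfolding D_def by blast
qed

section \<open>Quadrangle graphs\<close>

locale quadrangle_graph =
  fixes V :: "'v set" and adj :: "'v \<Rightarrow> 'v \<Rightarrow> bool" and d :: "'v \<Rightarrow> 'v \<Rightarrow> nat"
  assumes adj_V: "adj x y \<Longrightarrow> x \<in> V" "adj x y \<Longrightarrow> y \<in> V"
    and adj_sym: "adj x y \<Longrightarrow> adj y x"
    and d_0: "x \<in> V \<Longrightarrow> y \<in> V \<Longrightarrow> d x y = 0 \<longleftrightarrow> x = y"
    and d_sym: "x \<in> V \<Longrightarrow> y \<in> V \<Longrightarrow> d x y = d y x"
    and d_tri: "x \<in> V \<Longrightarrow> y \<in> V \<Longrightarrow> z \<in> V \<Longrightarrow> d x z \<le> d x y + d y z"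
    and d_adj: "adj x y \<Longrightarrow> d x y = 1"
    and d_step: "x \<in> V \<Longrightarrow> y \<in> V \<Longrightarrow> d x y = Suc n \<Longrightarrow> \<exists>z. adj y z \<and> d x z = n"
    and bipartite: "b \<in> V \<Longrightarrow> adj x y \<Longrightarrow> d b x = Suc (d b y) \<or> d b y = Suc (d b x)"
    and quadrangle: "b \<in> V \<Longrightarrow> adj y x \<Longrightarrow> adj y z \<Longrightarrow> x \<noteq> z \<Longrightarrow> d b y = Suc (d b x) \<Longrightarrow>
      d b y = Suc (d b z) \<Longrightarrow> \<exists>u. adj x u \<and> adj z u \<and> d b x = Suc (d b u)"
    and no_K23: "a \<noteq> b \<Longrightarrow> adj a x \<Longrightarrow> adj a y \<Longrightarrow> adj a z \<Longrightarrow> adj b x \<Longrightarrow> adj b y \<Longrightarrow> adj b z \<Longrightarrow>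
      x = y \<or> x = z \<or> y = z"
begin

section \<open>Existence and uniqueness of medians\<close>

definition betw :: "'v \<Rightarrow> 'v \<Rightarrow> 'v \<Rightarrow> bool"
  where "betw a b c \<longleftrightarrow> a \<in> V \<and> b \<in> V \<and> c \<in> V \<and> d a c = d a b + d b c"

lemma betw_sym: "betw a b c \<Longrightarrow> betw c b a"
  unfolding betw_def using d_sym by auto

lemma betw_trans: "betw a b c \<Longrightarrow> betw b e c \<Longrightarrow> betw a e c \<and> betw a b e"
  unfolding betw_def using d_tri[of a b e] d_tri[of a e c] by auto

lemma betw_trans': "betw a e c \<Longrightarrow> betw a b e \<Longrightarrow> betw a b c \<and> betw b e c"
  unfolding betw_def using d_tri[of a b c] d_tri[of b e c] by auto

lemma betw_same: "betw a b c \<Longrightarrow> d a b = d a c \<Longrightarrow> b = c"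
  unfolding betw_def using d_0[of b c] by auto

lemma betw_left: "a \<in> V \<Longrightarrow> b \<in> V \<Longrightarrow> betw a a b"
  unfolding betw_def using d_0[of a a] by auto

lemma betw_right: "a \<in> V \<Longrightarrow> b \<in> V \<Longrightarrow> betw a b b"
  unfolding betw_def using d_0[of b b] by auto

lemma betw_step:
  assumes "betw a v y" "v \<noteq> y"
  obtains z where "adj y z" "d a y = Suc (d a z)" "betw a v z" "d v y = Suc (d v z)"
proof -
  have V: "a \<in> V" "v \<in> V" "y \<in> V" using assms unfolding betw_def by auto
  then obtain n where n: "d v y = Suc n" using d_0[OF V(2,3)] assms(2) by (cases "d v y") auto
  then obtain z where z: "adj y z" "d v z = n" using d_step V by blast
  have "z \<in> V" using adj_V z by blast
  then have "d a z \<le> d a v + d v z" using d_tri V by blast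
  then have "d a y = Suc (d a z)" "d a z = d a v + d v z"
    using bipartite[OF V(1) z(1)] assms(1) n z unfolding betw_def by auto
  then show thesis using that z n V \<open>z \<in> V\<close> unfolding betw_def by auto
qed

text \<open>Induction on the distance from \<open>x\<close> to \<open>y\<close>. A step from
  \<open>y\<close> towards \<open>x\<close> that descends towards \<open>b\<close> reduces the claim
  to a smaller distance. If the step ascends, either \<open>y\<close> itself is the median or the
  quadrangle condition supplies another step towards \<open>x\<close> that descends.\<close>

lemma median_exists:
  assumes "b \<in> V" "x \<in> V" "y \<in> V"
  shows "\<exists>m. betw b m x \<and> betw b m y \<and> betw x m y"
  using assms(3)
proof (induction "d x y" arbitrary: y)
  case 0
  then show ?case using d_0[of x y] assms betw_right betw_left by metis
next
  case (Suc n)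
  have down: "\<exists>m. betw b m x \<and> betw b m y \<and> betw x m y"
    if y': "adj y y'" "d x y' = n" "d b y = Suc (d b y')" for y'
  proof -
    have "y' \<in> V" using adj_V y' by blast
    then obtain m where m: "betw b m x" "betw b m y'" "betw x m y'" using Suc(1)[of y'] y' by auto
    have "m \<in> V" using m unfolding betw_def by blast
    then have "d m y \<le> d m y' + d y' y" "d y' y = 1" "d b y \<le> d b m + d m y"
      using d_tri[of m y' y] d_tri[of b m y] d_adj[OF adj_sym[OF y'(1)]] \<open>y' \<in> V\<close> Suc(3) assms
        by auto
    then have "betw b m y" "betw x m y"
      using m y' Suc(2,3) assms \<open>m \<in> V\<close> unfolding betw_def by auto
    then show ?thesis using m by blast
  qed
  obtain y' where y': "adj y y'" "d x y' = n" using d_step[OF assms(2) Suc(3) Suc(2)[symmetric]]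
    by blast
  have V: "y' \<in> V" using adj_V y' by blast
  show ?case
  proof (cases "d b y = Suc (d b y')")
    case True
    then show ?thesis using down y' by blast
  next
    case False
    then have up: "d b y' = Suc (d b y)" using bipartite[OF assms(1) y'(1)] by auto
    obtain m where m: "betw b m x" "betw b m y'" "betw x m y'" using Suc(1)[of y'] y' V by auto
    show ?thesis
    proof (cases "m = y'")
      case True
      have "betw b y y'" using up d_adj[OF y'(1)] assms V Suc(3) unfolding betw_def by auto
      then have "betw b y x" using betw_trans' m(1) True by blast
      then show ?thesis using Suc(3) assms betw_right by blast
    next
      case False
      obtain z where z: "adj y' z" "d b y' = Suc (d b z)" "betw b m z" "d m y' = Suc (d m z)"
        using betw_step[OF m(2) False] by blast
      have zV: "z \<in> V" using adj_V z by blast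
      have "d x z \<le> d x m + d m z" using d_tri m zV unfolding betw_def by blast
      then have dz: "d x y' \<ge> Suc (d x z)" using m(3) z(4) unfolding betw_def by simp
      have "z \<noteq> y" using dz y'(2) Suc(2) by auto
      \<comment> \<open>Like \<open>y'\<close>, the vertex \<open>u\<close> is a neighbour of
        \<open>y\<close> closer to \<open>x\<close>, but it lies below \<open>y\<close>.\<close>
      then obtain u where u: "adj y u" "adj z u" "d b y = Suc (d b u)"
        using quadrangle[OF assms(1) adj_sym[OF y'(1)] z(1)] up z(2) by auto
      have "u \<in> V" using adj_V u by blast
      then have "d x u \<le> d x z + 1" using d_tri[of x z u] d_adj[OF u(2)] zV assms by simp
      then have "d x u = n" using bipartite[OF assms(2) u(1)] Suc(2) dz y'(2) by auto
      then show ?thesis using down u by blast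
    qed
  qed
qed

text \<open>Uniqueness of medians: two of them are joined by the quadrangles below \<open>x\<close> and towards \<open>y\<close>,
  whose fourth vertices agree.\<close>

lemma median_greatest:
  assumes "betw b m x" "betw b m y" "betw x m y" "betw b v x" "betw b v y"
  shows "betw b v m"
  using assms
proof (induction "d x y" arbitrary: x y m v rule: less_induct)
  case less
  have V: "b \<in> V" "x \<in> V" "y \<in> V" "v \<in> V" "m \<in> V" using less(2-6) unfolding betw_def by auto
  obtain n where n0: "betw v n x" "betw v n y" "betw x n y" using median_exists V by blast
  have n: "betw b n x" "betw b n y" "betw b v n" using betw_trans n0 less(5,6) by blast+
  have nV: "n \<in> V" using n unfolding betw_def by blast
  \<comment> \<open>The level of a median is determined by the three distances among
    \<open>b\<close>, \<open>x\<close> and \<open>y\<close>.\<close>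
  have eq_lvl: "d b n = d b m" using n0(3) n less(2,3,4) unfolding betw_def
    using d_sym[of n x] d_sym[of m x] by auto
  have "m = n"
  proof (cases "m = x \<or> n = x")
    case True
    then show ?thesis using eq_lvl betw_same n less(2) by metis
  next
    case False
    obtain x1 where x1: "adj x x1" "d b x = Suc (d b x1)" "betw b m x1" "d m x = Suc (d m x1)"
      using betw_step less(2) False by metis
    obtain x2 where x2: "adj x x2" "d b x = Suc (d b x2)" "betw b n x2" "d n x = Suc (d n x2)"
      using betw_step n(1) False by metis
    have xV: "x1 \<in> V" "x2 \<in> V" using adj_V x1 x2 by blast+
    have toward: "d x y = Suc (d z y) \<and> betw z k y" if "betw x k y" "adj x z" "d k x = Suc (d k z)"
      for k z
    proof -
      have kV: "k \<in> V" "z \<in> V" using that adj_V unfolding betw_def by auto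
      have "d z y \<le> d z k + d k y" "d x y \<le> d x z + d z y" using d_tri kV V by blast+
      then show ?thesis using that d_adj[OF that(2)] kV V d_sym[of k x] d_sym[of k z]
        unfolding betw_def by auto
    qed
    note t1 = toward[OF less(4) x1(1,4)] and t2 = toward[OF n0(3) x2(1,4)]
    show ?thesis
    proof (cases "x1 = x2")
      case True
      then have "betw b n m" using less(1)[of x1 y m n] t1 x1 x2 n less(3) by auto
      then show ?thesis using eq_lvl betw_same by blast
    next
      case False
      obtain u where u: "adj x1 u" "adj x2 u" "d b x1 = Suc (d b u)"
        using quadrangle[OF V(1) x1(1) x2(1) False x1(2) x2(2)] by blast
      have "d y x = Suc (d y x1)" "d y x = Suc (d y x2)" using t1 t2 d_sym V xV by auto
      then obtain w where w: "adj x1 w" "adj x2 w" "d y x1 = Suc (d y w)"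
        using quadrangle[OF V(3) x1(1) x2(1) False] by blast
      have "x = u \<or> x = w \<or> u = w"
        using no_K23[OF False adj_sym[OF x1(1)] u(1) w(1) adj_sym[OF x2(1)] u(2) w(2)] .
      then have wu: "w = u" using x1(2) u(3) w(3) \<open>d y x = Suc (d y x1)\<close> by auto
      have uV: "u \<in> V" using adj_V u by blast
      \<comment> \<open>Both \<open>d b u\<close> and \<open>d u y\<close> are 2 less than the
        corresponding distances of \<open>x\<close>, so this median has the level of
        \<open>m\<close>. By induction it lies below \<open>m\<close> and below \<open>n\<close>,
        hence equals both.\<close>
      obtain k where k: "betw b k u" "betw b k y" "betw u k y" using median_exists V uV by blast
      have kV: "k \<in> V" using k unfolding betw_def by blast
      have "d u y = d y u" "d x1 y = d y x1" using d_sym uV xV V by auto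
      then have "d x y = Suc (Suc (d u y))" using t1 w(3) wu by simp
      then have "d b k = d b m"
        using k less(2,3,4) x1(2) u(3) d_sym[of u k] d_sym[of x m] V kV uV unfolding betw_def
          by auto
      have "betw b u x1" using u d_adj[OF adj_sym[OF u(1)]] uV xV V unfolding betw_def by auto
      moreover have "betw b u x2" using u x1(2) x2(2) d_adj[OF adj_sym[OF u(2)]] uV xV V
        unfolding betw_def by auto
      ultimately have "betw b k x1" "betw b k x2" using betw_trans' k(1) by blast+
      then have "betw b k m" "betw b k n"
        using less(1)[of x1 y m k] less(1)[of x2 y n k] t1 t2 x1 x2 n less(3) k(2) by auto
      then show ?thesis using eq_lvl \<open>d b k = d b m\<close> betw_same by metis
    qed
  qed
  then show ?case using n(3) by blast
qed

end

locale pointed_quadrangle_graph = quadrangle_graph V adj d for V :: "'v set" and adj d +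
  fixes b :: 'v
  assumes b_V: "b \<in> V"
begin

section \<open>Prime vertices in the role of hyperplanes\<close>

abbreviation le :: "'v \<Rightarrow> 'v \<Rightarrow> bool" where "le x y \<equiv> betw b x y"

definition down :: "'v \<Rightarrow> 'v \<Rightarrow> bool"
  where "down y x \<longleftrightarrow> adj y x \<and> d b y = Suc (d b x)"

text \<open>These are the join irreducibles of \<open>le\<close>; the base point, which has no lower
  neighbour, is excluded.\<close>

definition prime :: "'v \<Rightarrow> bool"
  where "prime p \<longleftrightarrow> p \<in> V \<and> p \<noteq> b \<and> (\<forall>x z. down p x \<longrightarrow> down p z \<longrightarrow> x = z)"

definition primes_below :: "'v \<Rightarrow> 'v set"
  where "primes_below x = {p. prime p \<and> le p x}"

lemma down_V: "down y x \<Longrightarrow> x \<in> V" "down y x \<Longrightarrow> y \<in> V"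
  unfolding down_def using adj_V by blast+

lemma down_le: "down y x \<Longrightarrow> le x y"
  using down_V b_V d_adj[of x y] adj_sym unfolding down_def betw_def by auto

lemma le_refl: "x \<in> V \<Longrightarrow> le x x"
  using betw_right b_V by blast

lemma le_trans: "le x y \<Longrightarrow> le y z \<Longrightarrow> le x z"
  using betw_trans' by blast

lemma le_lvl: "le x y \<Longrightarrow> d b x \<le> d b y"
  unfolding betw_def by simp

lemma le_antisym: "le x y \<Longrightarrow> le y x \<Longrightarrow> x = y"
  using le_lvl betw_same by (simp add: le_antisym)

lemma le_down: "le v y \<Longrightarrow> v \<noteq> y \<Longrightarrow> \<exists>x. down y x \<and> le v x"
  using betw_step unfolding down_def by metis

lemma down_exists: "y \<in> V \<Longrightarrow> y \<noteq> b \<Longrightarrow> \<exists>x. down y x"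
  using le_down[of b y] betw_left b_V by blast

text \<open>Two lower neighbours have distance 2 with \<open>u\<close> between them, so
  \<open>u\<close> is their median with \<open>b\<close> and thereby their meet.\<close>

lemma down_meet:
  assumes "down y x" "down y z" "x \<noteq> z"
  obtains u where "down x u" "down z u" "\<And>v. le v x \<Longrightarrow> le v z \<Longrightarrow> le v u"
proof -
  obtain u where u: "adj x u" "adj z u" "d b x = Suc (d b u)"
    using quadrangle[OF b_V] assms unfolding down_def by metis
  then have "down x u" "down z u" using assms unfolding down_def by auto
  have V: "x \<in> V" "y \<in> V" "z \<in> V" "u \<in> V" using down_V assms \<open>down x u\<close> by blast+
  have "d x z = 2"
    using bipartite[OF V(1), of y z] d_0[OF V(1,3)] d_adj[of x y] adj_sym assms unfolding down_def
      by auto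
  then have "betw x u z"
    using d_adj[OF u(1)] d_adj[OF adj_sym[OF u(2)]] V unfolding betw_def by auto
  then show thesis
    using that \<open>down x u\<close> \<open>down z u\<close> median_greatest[of b u x z] down_le by blast
qed

text \<open>An edge crosses exactly one hyperplane. Unless \<open>y\<close> is prime itself, the new
  prime is inherited from a second lower neighbour through the square below \<open>y\<close>;
  failure of uniqueness would involve three lower neighbours of \<open>y\<close> and is excluded by
  their pairwise meets.\<close>

lemma unique_new_prime:
  assumes "down y x"
  shows "\<exists>!p. prime p \<and> le p y \<and> \<not> le p x"
  using assms
proof (induction "d b y" arbitrary: y x rule: less_induct)
  case less
  note yx = less(2)
  have V: "y \<in> V" "x \<in> V" using down_V yx by blast+
  have nle: "\<not> le y' x'" if "down y' x'" for y' x' using that le_lvl unfolding down_def by fastforce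
  show ?case
  proof (cases "prime y")
    case True
    show ?thesis
    proof (rule ex1I[of _ y])
      show "prime y \<and> le y y \<and> \<not> le y x" using True le_refl V nle yx by blast
      fix q assume q: "prime q \<and> le q y \<and> \<not> le q x"
      \<comment> \<open>Anything strictly below a prime is below its only lower neighbour, which is
        \<open>x\<close> here.\<close>
      then show "q = y" using le_down[of q y] True yx unfolding prime_def by blast
    qed
  next
    case False
    have "y \<noteq> b" using yx d_0[of b b] b_V unfolding down_def by auto
    then obtain z where z: "down y z" "z \<noteq> x" using False V yx unfolding prime_def by blast
    obtain u where u: "down x u" "down z u" "\<And>v. le v x \<Longrightarrow> le v z \<Longrightarrow> le v u"
      using down_meet[OF yx z(1)] z(2) by blast
    have lt: "d b z < d b y" if "down y z" for z using that unfolding down_def by simp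
    obtain p where p: "prime p" "le p z" "\<not> le p u" "\<And>q. prime q \<Longrightarrow> le q z \<Longrightarrow> \<not> le q u \<Longrightarrow> q = p"
      using less(1)[OF lt[OF z(1)] u(2)] by blast
    show ?thesis
    proof (rule ex1I[of _ p])
      show "prime p \<and> le p y \<and> \<not> le p x" using p u(3) le_trans down_le z(1) by blast
      fix q assume q: "prime q \<and> le q y \<and> \<not> le q x"
      have "q \<noteq> y" using q False by blast
      then obtain z' where z': "down y z'" "le q z'" using le_down q by blast
      have "le q z"
      proof (rule ccontr)
        assume nq: "\<not> le q z"
        then have "z' \<noteq> z" "z' \<noteq> x" using z' q by blast+
        obtain s where s: "down z s" "down z' s" "\<And>v. le v z \<Longrightarrow> le v z' \<Longrightarrow> le v s"
          using down_meet[OF z(1) z'(1)] \<open>z' \<noteq> z\<close> by blast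
        obtain u' where u': "down x u'" "down z' u'" "\<And>v. le v x \<Longrightarrow> le v z' \<Longrightarrow> le v u'"
          using down_meet[OF yx z'(1)] \<open>z' \<noteq> x\<close> by blast
        have qs: "\<not> le q s" "\<not> le q u'" using nq q s(1) u'(1) down_le le_trans by blast+
        show False
        proof (cases "s = u'")
          case True
          \<comment> \<open>If the meets of \<open>z'\<close> with \<open>z\<close> and with
            \<open>x\<close> coincide, they equal \<open>u\<close>, and \<open>y\<close>,
            \<open>u\<close> have three common neighbours.\<close>
          then have "le s x" using u' down_le by blast
          then have "le s u" using u(3) s(1) down_le by blast
          then have "s = u" using betw_same[of b s u] s(1) u(2) unfolding down_def by auto
          have "y \<noteq> u" using yx u(1) unfolding down_def by auto
          moreover have "adj y x" "adj y z" "adj y z'" "adj u x" "adj u z" "adj u z'"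
            using yx z(1) z'(1) u(1,2) u'(2) True \<open>s = u\<close> adj_sym unfolding down_def by auto
          ultimately have "x = z \<or> x = z' \<or> z = z'" using no_K23 by blast
          then show False using z(2) \<open>z' \<noteq> z\<close> \<open>z' \<noteq> x\<close> by blast
        next
          case False
          \<comment> \<open>The prime that is new at \<open>s\<close> over the meet \<open>t\<close>
            is also new at \<open>z'\<close> over \<open>u'\<close>. Hence it equals
            \<open>q\<close>, which is not below \<open>s\<close>.\<close>
          obtain t where t: "down s t" "down u' t" "\<And>v. le v s \<Longrightarrow> le v u' \<Longrightarrow> le v t"
            using down_meet[OF s(2) u'(2) False] by blast
          have "d b s < d b y" using lt[OF z'(1)] s(2) unfolding down_def by simp
          then obtain q2 where q2: "prime q2" "le q2 s" "\<not> le q2 t" using less(1)[OF _ t(1)]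
            by blast
          have "\<not> le q2 u'" using q2 t(3) by blast
          moreover have "le q2 z'" using q2 s(2) down_le le_trans by blast
          ultimately have "q2 = q" using less(1)[OF lt[OF z'(1)] u'(2)] q2(1) q z'(2) qs by blast
          then show False using q2(2) qs by blast
        qed
      qed
      then show "q = p" using p(4) q u(1) down_le le_trans by blast
    qed
  qed
qed

lemma primes_below_down:
  assumes "down y x"
  obtains p where "primes_below y = insert p (primes_below x)" "p \<notin> primes_below x"
proof -
  obtain p where p: "prime p \<and> le p y \<and> \<not> le p x" "\<And>q. prime q \<and> le q y \<and> \<not> le q x \<Longrightarrow> q = p"
    using unique_new_prime[OF assms] by blast
  then have "primes_below y = insert p (primes_below x)" "p \<notin> primes_below x"
    using down_le[OF assms] le_trans unfolding primes_below_def by blast+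
  then show thesis using that by blast
qed

text \<open>Each step down to \<open>b\<close> removes exactly one prime.\<close>

lemma primes_below_card: "x \<in> V \<Longrightarrow> finite (primes_below x) \<and> card (primes_below x) = d b x"
proof (induction "d b x" arbitrary: x)
  case 0
  then have "x = b" using d_0 b_V by auto
  have "p = b" if "le p b" for p using that d_0[of b p] d_0[of b b] b_V unfolding betw_def by auto
  then have "primes_below x = {}" using \<open>x = b\<close> unfolding primes_below_def prime_def by blast
  then show ?case using 0 by simp
next
  case (Suc n)
  then have "x \<noteq> b" using d_0[of b b] b_V by auto
  then obtain z where z: "down x z" using down_exists Suc by blast
  then have "z \<in> V" "d b z = n" using down_V Suc unfolding down_def by auto
  then have "finite (primes_below z)" "card (primes_below z) = n" using Suc(1)[of z] by auto
  then show ?case using primes_below_down[OF z] Suc(2) by fastforce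
qed

text \<open>The primes below the median of \<open>b\<close>, \<open>x\<close>, \<open>y\<close> are
  exactly the common ones. Levels count primes, and a geodesic from \<open>x\<close> to
  \<open>y\<close> passes through the median.\<close>

lemma dist_eq_sdist:
  assumes "x \<in> V" "y \<in> V"
  shows "d x y = sdist (primes_below x) (primes_below y)"
proof -
  obtain m where m: "le m x" "le m y" "betw x m y" using median_exists b_V assms by blast
  then have mV: "m \<in> V" unfolding betw_def by blast
  have *: "primes_below m = primes_below x \<inter> primes_below y"
    using median_greatest[OF m] le_trans m unfolding primes_below_def by blast
  have fin: "finite (primes_below x)" "finite (primes_below y)" using primes_below_card assms
    by auto
  have "card (primes_below x - primes_below y) = d b x - d b m"
    using card_Diff_subset_Int[of "primes_below x" "primes_below y"] fin * primes_below_card assms mV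
    by (metis finite_Int)
  moreover have "card (primes_below y - primes_below x) = d b y - d b m"
    using card_Diff_subset_Int[of "primes_below y" "primes_below x"] fin * primes_below_card assms mV
    by (metis finite_Int Int_commute)
  moreover have "sdist (primes_below x) (primes_below y) =
      card (primes_below x - primes_below y) + card (primes_below y - primes_below x)"
    unfolding sdist_def using fin by (intro card_Un_disjoint) auto
  moreover have "d x m = d m x" using d_sym mV assms by blast
  ultimately show ?thesis using m unfolding betw_def by simp
qed

text \<open>If every lower neighbour of \<open>y\<close> kept \<open>a\<close>, two steps down would
  remove some \<open>q\<close> and then \<open>a\<close>, reaching \<open>w\<close>. Counting primes
  shows that \<open>w\<close> and \<open>q\<close> have a common upper bound strictly below
  \<open>y\<close>; a lower neighbour of \<open>y\<close> above it would have all primes of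
  \<open>y\<close>, contradicting its level.\<close>

lemma maximal_prime_removable:
  assumes "y \<in> V" "a \<in> primes_below y" "\<And>c. c \<in> primes_below y \<Longrightarrow> le a c \<Longrightarrow> c = a"
  shows "\<exists>y'. down y y' \<and> \<not> le a y'"
  using assms
proof (induction "d b y" arbitrary: y rule: less_induct)
  case less
  have a: "prime a" "le a y" using less(3) unfolding primes_below_def by auto
  show ?case
  proof (rule ccontr)
    assume "\<not> ?case"
    then have all: "le a y'" if "down y y'" for y' using that by blast
    have "y \<noteq> b" using a betw_same[of b a b] d_0[of b a] d_0[of b b] b_V
      unfolding betw_def prime_def by auto
    then obtain y1 where y1: "down y y1" using down_exists less(2) by blast
    obtain q where q: "primes_below y = insert q (primes_below y1)" "q \<notin> primes_below y1"
      using primes_below_down[OF y1] by blast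
    have y1V: "y1 \<in> V" and lvl1: "d b y = Suc (d b y1)" using y1 down_V unfolding down_def by auto
    have ay1: "a \<in> primes_below y1" using a all[OF y1] unfolding primes_below_def by blast
    have "\<exists>w. down y1 w \<and> \<not> le a w"
    proof (rule less(1)[OF _ y1V ay1])
      show "d b y1 < d b y" using lvl1 by simp
      show "c = a" if "c \<in> primes_below y1" "le a c" for c using less(4)[OF _ that(2)] that(1) q(1)
        by blast
    qed
    then obtain w where w: "down y1 w" "\<not> le a w" by blast
    have wV: "w \<in> V" and lvl2: "d b y1 = Suc (d b w)" using w down_V unfolding down_def by auto
    obtain a' where a': "primes_below y1 = insert a' (primes_below w)" "a' \<notin> primes_below w"
      using primes_below_down[OF w(1)] by blast
    have "a \<notin> primes_below w" using w(2) unfolding primes_below_def by blast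
    then have "a' = a" using a' ay1 by auto
    have qP: "prime q" "le q y" "q \<in> V" using q unfolding primes_below_def betw_def by blast+
    have "\<not> le a q" using less(4)[of q] q ay1 by blast
    then have "a \<notin> primes_below q" unfolding primes_below_def by blast
    have Pq: "primes_below q \<subseteq> primes_below y" "q \<in> primes_below q"
      using qP le_trans le_refl unfolding primes_below_def by blast+
    then have "primes_below q \<subseteq> insert q (primes_below w)"
      using q(1) a'(1) \<open>a' = a\<close> \<open>a \<notin> primes_below q\<close> by auto
    have "q \<notin> primes_below w" using q(2) a'(1) by auto
    then have diff: "primes_below q - primes_below w = {q}"
      using Pq \<open>primes_below q \<subseteq> insert q (primes_below w)\<close> by auto
    have int: "primes_below w \<inter> primes_below q = primes_below q - {q}"
      using \<open>primes_below q \<subseteq> insert q (primes_below w)\<close> \<open>q \<notin> primes_below w\<close> by auto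
    have fin: "finite (primes_below q)" "finite (primes_below w)" "card (primes_below q) = d b q"
      "card (primes_below w) = d b w" using primes_below_card[OF qP(3)] primes_below_card[OF wV]
        by auto
    have "card (primes_below w \<inter> primes_below q) = d b q - 1" "d b q > 0"
      unfolding int using fin(1,3) Pq(2) by (simp, metis card_gt_0_iff empty_iff)
    then have "card (primes_below w - primes_below q) = d b w - (d b q - 1)"
      using card_Diff_subset_Int[of "primes_below w" "primes_below q"] fin by simp
    moreover have "sdist (primes_below w) (primes_below q) =
        card (primes_below w - primes_below q) + card (primes_below q - primes_below w)"
      unfolding sdist_def using fin by (intro card_Un_disjoint) auto
    ultimately have dwq: "d w q = d b w - (d b q - 1) + 1"
      using dist_eq_sdist[OF wV qP(3)] diff by simp
    have le_w: "le w y" using w y1 down_le le_trans by blast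
    obtain t where t: "betw y t w" "betw y t q" "betw w t q" using median_exists less(2) wV qP(3)
      by blast
    have wt: "le w t" "le t y" "le q t"
      using betw_trans[OF le_w betw_sym[OF t(1)]] betw_trans[OF qP(2) betw_sym[OF t(2)]] by blast+
    \<comment> \<open>A geodesic from \<open>w\<close> to \<open>q\<close> through \<open>y\<close>
      would be longer by 2 than the number of primes separating them.\<close>
    have "t \<noteq> y"
    proof
      assume "t = y"
      then have "d w q = d w y + d y q" using t(3) unfolding betw_def by simp
      moreover have "d b y = d b w + d w y" "d b y = d b q + d q y" "d y q = d q y"
        using le_w qP(2) d_sym less(2) qP(3) unfolding betw_def by auto
      ultimately show False using dwq lvl1 lvl2 \<open>d b q > 0\<close> by linarith
    qed
    then obtain y' where y': "down y y'" "le t y'" using le_down wt(2) by blast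
    then have "le w y'" "le q y'" "le a y'" using wt le_trans all by blast+
    then have "primes_below w \<subseteq> primes_below y'" "q \<in> primes_below y'" "a \<in> primes_below y'"
      using a(1) qP(1) le_trans unfolding primes_below_def by blast+
    then have "primes_below y \<subseteq> primes_below y'" using q(1) a'(1) \<open>a' = a\<close> by simp
    then have "d b y \<le> d b y'"
      using primes_below_card[OF less(2)] primes_below_card[OF down_V(1)[OF y'(1)]] card_mono[of "primes_below y'" "primes_below y"] by simp
    then show False using y'(1) unfolding down_def by simp
  qed
qed

text \<open>A lowest vertex \<open>y\<close> above all of \<open>A\<close> works. By minimality each
  lower neighbour loses an element of \<open>A\<close>, so every maximal prime below
  \<open>y\<close> is in \<open>A\<close>; as \<open>A\<close> is an antichain, all its elements are
  maximal, and each can be removed by one step down.\<close>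

lemma antichain_down:
  assumes "x \<in> V" "A \<subseteq> primes_below x" and anti: "\<And>a c. a \<in> A \<Longrightarrow> c \<in> A \<Longrightarrow> le a c \<Longrightarrow> a = c"
  obtains y f where "y \<in> V" "inj_on f A" "\<And>a. a \<in> A \<Longrightarrow> down y (f a)"
proof -
  define y where "y = arg_min (d b) (\<lambda>y. y \<in> V \<and> A \<subseteq> primes_below y)"
  have y: "y \<in> V" "A \<subseteq> primes_below y" and min: "\<And>z. z \<in> V \<Longrightarrow> A \<subseteq> primes_below z \<Longrightarrow> d b y \<le> d b z"
    using arg_min_nat_lemma[of "\<lambda>y. y \<in> V \<and> A \<subseteq> primes_below y" x "d b"] assms unfolding y_def
      by blast+
  have removed: "c \<in> A" if rem: "down y z" "c \<in> primes_below y" "\<not> le c z" for c z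
  proof -
    have "\<not> A \<subseteq> primes_below z" using min[of z] down_V(1)[OF rem(1)] rem(1) unfolding down_def
      by auto
    then obtain a where a: "a \<in> A" "a \<notin> primes_below z" by blast
    obtain p where p: "primes_below y = insert p (primes_below z)"
      using primes_below_down[OF rem(1)] by blast
    have "c \<notin> primes_below z" using rem(3) unfolding primes_below_def by blast
    then have "c = p" "a = p" using p a y(2) rem(2) by auto
    then show ?thesis using a by blast
  qed
  have max: "c = a" if "a \<in> A" "c \<in> primes_below y" "le a c" for a c
  proof -
    let ?C = "{c' \<in> primes_below y. le c c'}"
    have C: "finite ?C" "c \<in> ?C"
      using primes_below_card[OF y(1)] that le_refl[of c]
        by (simp, simp add: primes_below_def betw_def)
    have "Max (d b ` ?C) \<in> d b ` ?C" using C by (intro Max_in) auto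
    then obtain c' where c': "c' \<in> ?C" "d b c' = Max (d b ` ?C)" by fastforce
    have c'_max: "d b e \<le> d b c'" if "e \<in> ?C" for e using C(1) that c'(2) by simp
    have "e = c'" if "e \<in> primes_below y" "le c' e" for e
    proof -
      have "e \<in> ?C" using that c'(1) le_trans by blast
      then have "d b e = d b c'" using c'_max le_lvl[OF that(2)] by (simp add: order.antisym)
      then show ?thesis using betw_same[OF that(2)] by simp
    qed
    then obtain z where "down y z" "\<not> le c' z" using maximal_prime_removable[OF y(1), of c'] c'(1)
      by blast
    then have "c' \<in> A" using removed c'(1) by blast
    then have "a = c'" using anti[of a c'] that c'(1) le_trans by blast
    then show "c = a" using that(3) c'(1) le_antisym by blast
  qed
  have "\<forall>a\<in>A. \<exists>z. down y z \<and> \<not> le a z"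
    using maximal_prime_removable[OF y(1)] max y(2) by blast
  then obtain f where f: "\<And>a. a \<in> A \<Longrightarrow> down y (f a)" "\<And>a. a \<in> A \<Longrightarrow> \<not> le a (f a)" by metis
  have "inj_on f A"
  proof (rule inj_onI)
    fix a c assume ac: "a \<in> A" "c \<in> A" "f a = f c"
    obtain p where p: "primes_below y = insert p (primes_below (f a))"
      using primes_below_down[OF f(1)[OF ac(1)]] by blast
    have "a \<notin> primes_below (f a)" "c \<notin> primes_below (f a)"
      using f(2)[OF ac(1)] f(2)[OF ac(2)] ac(3) unfolding primes_below_def by auto
    moreover have "a \<in> insert p (primes_below (f a))" "c \<in> insert p (primes_below (f a))"
      using ac(1,2) y(2) p by blast+
    ultimately show "a = c" by simp
  qed
  then show thesis using that y(1) f(1) by blast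
qed

text \<open>The bound on lower neighbours becomes a bound on the width, because an antichain of
  primes embeds into the lower neighbours of one vertex.\<close>

lemma coloring:
  assumes D: "\<And>y Z. y \<in> V \<Longrightarrow> finite Z \<Longrightarrow> (\<And>z. z \<in> Z \<Longrightarrow> down y z) \<Longrightarrow> card Z \<le> D"
  shows "\<exists>Col :: nat set. finite Col \<and> (\<forall>r. \<exists>R \<kappa>. \<kappa> ` V \<subseteq> Col \<and>
    (\<forall>x y. x \<in> V \<longrightarrow> (r_step d V \<kappa> r)\<^sup>*\<^sup>* x y \<longrightarrow> d x y \<le> R))"
proof -
  let ?lt = "\<lambda>a c. le a c \<and> a \<noteq> c" and ?F = "primes_below ` V"
  have fam: "downset_family ?lt (Collect prime) ?F D"
  proof
    fix x A assume x: "x \<in> ?F" "A \<subseteq> x" and A: "\<And>a c. a \<in> A \<Longrightarrow> c \<in> A \<Longrightarrow> \<not> (le a c \<and> a \<noteq> c)"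
    then obtain v where v: "v \<in> V" "A \<subseteq> primes_below v" by blast
    obtain y f where f: "y \<in> V" "inj_on f A" "\<And>a. a \<in> A \<Longrightarrow> down y (f a)"
      using antichain_down[OF v] A by metis
    have "finite A" using v primes_below_card finite_subset by blast
    then have "card (f ` A) \<le> D" using f by (intro D[OF f(1)]) auto
    then show "card A \<le> D" using card_image[OF f(2)] by simp
  next
    fix x e e' assume "x \<in> ?F" "e \<in> x" "le e' e \<and> e' \<noteq> e" "e' \<in> Collect prime"
    then show "e' \<in> x" using le_trans unfolding primes_below_def by blast
  next
    fix x y z assume "le x y \<and> x \<noteq> y" "le y z \<and> y \<noteq> z"
    then show "le x z \<and> x \<noteq> z" using le_trans le_antisym by blast
  qed (use primes_below_card in \<open>auto simp: primes_below_def\<close>)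
  obtain Col :: "nat set" where Col: "finite Col" and col: "\<forall>r. \<exists>R. \<forall>(lt :: 'v \<Rightarrow> 'v \<Rightarrow> bool) C F.
    downset_family lt C F D \<longrightarrow>
    (\<exists>\<kappa>. \<kappa> ` F \<subseteq> Col \<and> (\<forall>x y. x \<in> F \<longrightarrow> (r_step sdist F \<kappa> r)\<^sup>*\<^sup>* x y \<longrightarrow> sdist x y \<le> R))"
    using downset_family_coloring[of D] by (elim exE conjE) (rule that)
  have "\<exists>R \<kappa>. \<kappa> ` V \<subseteq> Col \<and> (\<forall>x y. x \<in> V \<longrightarrow> (r_step d V \<kappa> r)\<^sup>*\<^sup>* x y \<longrightarrow> d x y \<le> R)" for r
  proof -
    obtain R where R': "\<forall>(lt :: 'v \<Rightarrow> 'v \<Rightarrow> bool) C F. downset_family lt C F D \<longrightarrow>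
      (\<exists>\<kappa>. \<kappa> ` F \<subseteq> Col \<and> (\<forall>x y. x \<in> F \<longrightarrow> (r_step sdist F \<kappa> r)\<^sup>*\<^sup>* x y \<longrightarrow> sdist x y \<le> R))"
      using spec[OF col, of r] by (rule exE)
    obtain \<kappa> where \<kappa>: "\<kappa> ` ?F \<subseteq> Col \<and>
        (\<forall>x y. x \<in> ?F \<longrightarrow> (r_step sdist ?F \<kappa> r)\<^sup>*\<^sup>* x y \<longrightarrow> sdist x y \<le> R)"
      using R'[rule_format, OF fam] by (rule exE)
    then have R: "\<kappa> ` ?F \<subseteq> Col" "\<And>x y. x \<in> ?F \<Longrightarrow> (r_step sdist ?F \<kappa> r)\<^sup>*\<^sup>* x y \<Longrightarrow> sdist x y \<le> R"
      by (rule conjunct1, simp only: \<kappa>)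
    let ?k = "\<kappa> \<circ> primes_below"
    have "d x y \<le> R" if x: "x \<in> V" "(r_step d V ?k r)\<^sup>*\<^sup>* x y" for x y
    proof -
      have "(r_step sdist ?F \<kappa> r)\<^sup>*\<^sup>* (primes_below x) (primes_below y)"
        using x(2)
      proof (induction rule: rtranclp_induct)
        case (step u v)
        then have "r_step sdist ?F \<kappa> r (primes_below u) (primes_below v)"
          using dist_eq_sdist unfolding r_step_def by auto
        then show ?case using step(3) by (meson rtranclp.rtrancl_into_rtrancl)
      qed simp
      then have "sdist (primes_below x) (primes_below y) \<le> R" using R(2) x(1) by blast
      then show ?thesis using dist_eq_sdist[OF x(1)] r_step_rtranclp_in[OF x(2,1)] by simp
    qed
    moreover have "?k ` V \<subseteq> Col" using R(1) by auto
    ultimately show ?thesis by blast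
  qed
  then show ?thesis using Col by blast
qed

end

section \<open>Words in the edges of a flag complex\<close>

text \<open>For oriented edges out of a common vertex, \<open>perp e f\<close> stands for spanning a
  square, and \<open>res e f\<close> for the side of that square parallel to \<open>f\<close> at the
  end of \<open>e\<close>. The last two axioms express the existence of 3-cubes.\<close>

locale edge_system =
  fixes inv :: "'e \<Rightarrow> 'e" and perp :: "'e \<Rightarrow> 'e \<Rightarrow> bool" and res :: "'e \<Rightarrow> 'e \<Rightarrow> 'e"
  assumes inv_inv [simp]: "inv (inv e) = e"
    and perp_sym: "perp e f \<Longrightarrow> perp f e"
    and perp_irrefl: "\<not> perp e e"
    and perp_inv: "perp e f \<Longrightarrow> perp (inv e) (res e f)"
    and res_inv: "perp e f \<Longrightarrow> res (inv e) (res e f) = f"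
    and res_res_inv: "perp e f \<Longrightarrow> res (res e f) (inv e) = inv (res f e)"
    and perp_res: "perp e f \<Longrightarrow> perp e g \<Longrightarrow> perp f g \<Longrightarrow> perp (res e f) (res e g)"
    and res_cube: "perp e f \<Longrightarrow> perp e g \<Longrightarrow> perp f g \<Longrightarrow> res (res e f) (res e g) =
      res (res f e) (res f g)"
begin

text \<open>The same square, seen from the corner opposite to the common start.\<close>

lemma perp_top: "perp e f \<Longrightarrow> perp (inv (res e f)) (inv (res f e))"
  using perp_inv[OF perp_sym[OF perp_inv]] res_res_inv by metis

lemma res_top: "perp e f \<Longrightarrow> res (inv (res e f)) (inv (res f e)) = inv e"
  using res_inv[OF perp_sym[OF perp_inv]] res_res_inv by metis

lemma res_inject: "perp e f \<Longrightarrow> perp e g \<Longrightarrow> res e f = res e g \<Longrightarrow> f = g"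
  by (metis res_inv)

text \<open>Words list the edges of a path in reverse order, so that the last edge is the head.\<close>

inductive swap :: "'e list \<Rightarrow> 'e list \<Rightarrow> bool" where
  swap_hd: "perp e f \<Longrightarrow> swap (res e f # e # w) (res f e # f # w)"
| swap_tl: "swap w w' \<Longrightarrow> swap (g # w) (g # w')"

abbreviation eqv :: "'e list \<Rightarrow> 'e list \<Rightarrow> bool" (infix "\<asymp>" 50)
  where "eqv \<equiv> swap\<^sup>*\<^sup>*"

lemma swap_sym: "swap w w' \<Longrightarrow> swap w' w"
  by (induction rule: swap.induct) (auto intro: swap.intros perp_sym)

lemma eqv_sym: "w \<asymp> w' \<Longrightarrow> w' \<asymp> w"
  by (induction rule: rtranclp_induct) (auto dest: swap_sym intro: converse_rtranclp_into_rtranclp)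

lemma eqv_trans: "u \<asymp> v \<Longrightarrow> v \<asymp> w \<Longrightarrow> u \<asymp> w"
  by (rule rtranclp_trans)

lemma eqv_Cons: "w \<asymp> w' \<Longrightarrow> g # w \<asymp> g # w'"
  by (induction rule: rtranclp_induct) (auto intro: rtranclp.rtrancl_into_rtrancl swap_tl)

lemma eqv_swap: "perp e f \<Longrightarrow> res e f # e # w \<asymp> res f e # f # w"
  by (simp add: r_into_rtranclp swap_hd)

lemma swap_length: "swap w w' \<Longrightarrow> length w = length w'"
  by (induction rule: swap.induct) auto

lemma eqv_length: "w \<asymp> w' \<Longrightarrow> length w = length w'"
  by (induction rule: rtranclp_induct) (auto dest: swap_length)

section \<open>Flip equivalence seen at the last edge\<close>

definition heads :: "'e \<Rightarrow> 'e list \<Rightarrow> 'e \<Rightarrow> 'e list \<Rightarrow> bool"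
  where "heads x w y w' \<longleftrightarrow> (x = y \<and> w \<asymp> w') \<or>
    (\<exists>e f u. perp e f \<and> x = res e f \<and> y = res f e \<and> w \<asymp> e # u \<and> w' \<asymp> f # u)"

lemma swap_heads: "swap (x # w) (y # w') \<Longrightarrow> heads x w y w'"
  unfolding heads_def by (cases rule: swap.cases) (auto intro: r_into_rtranclp)

text \<open>Two commutations of the last edge close up to a 3-cube.\<close>

lemma heads_trans:
  assumes IH: "\<And>x w y w'. length w < n \<Longrightarrow> x # w \<asymp> y # w' \<Longrightarrow> heads x w y w'"
    and len: "length w1 = n"
    and h: "heads x w1 y w2" "heads y w2 z w3"
  shows "heads x w1 z w3"
proof (cases "(x = y \<and> w1 \<asymp> w2) \<or> (y = z \<and> w2 \<asymp> w3)")
  case True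
  then show ?thesis
  proof
    assume *: "x = y \<and> w1 \<asymp> w2"
    have "w1 \<asymp> v" if "w2 \<asymp> v" for v using * that eqv_trans by blast
    then show ?thesis using h(2) * unfolding heads_def by blast
  next
    assume *: "y = z \<and> w2 \<asymp> w3"
    have "w3 \<asymp> v" if "w2 \<asymp> v" for v using * that eqv_trans eqv_sym by blast
    moreover have "w1 \<asymp> w3" if "w1 \<asymp> w2" using * that eqv_trans by blast
    ultimately show ?thesis using h(1) * unfolding heads_def by blast
  qed
next
  case False
  obtain e f u where 1: "perp e f" "x = res e f" "y = res f e" "w1 \<asymp> e # u" "w2 \<asymp> f # u"
    using h(1) False unfolding heads_def by auto
  obtain e' f' v where 2: "perp e' f'" "y = res e' f'" "z = res f' e'" "w2 \<asymp> e' # v" "w3 \<asymp> f' # v"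
    using h(2) False unfolding heads_def by auto
  have fu: "f # u \<asymp> e' # v" using 1(5) 2(4) eqv_sym eqv_trans by blast
  have "length u < n" using eqv_length[OF 1(4)] len by simp
  from IH[OF this fu] consider "f = e'" "u \<asymp> v"
    | g h t where "perp g h" "f = res g h" "e' = res h g" "u \<asymp> g # t" "v \<asymp> h # t"
    unfolding heads_def by blast
  then show ?thesis
  proof cases
    case 1
    \<comment> \<open>Both flips use the same square, so the second one undoes the first.\<close>
    then have "e = f'" using res_inject[of f e f'] \<open>perp e f\<close> 2 \<open>y = res f e\<close> perp_sym by metis
    then have "x = z" "w1 \<asymp> w3" using 1 2 \<open>x = res e f\<close> \<open>w1 \<asymp> e # u\<close>
      by (metis, meson eqv_Cons eqv_sym eqv_trans)
    then show ?thesis unfolding heads_def by blast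
  next
    case gh: 2
    \<comment> \<open>The edges \<open>g\<close>, \<open>h\<close>, \<open>k\<close> start at the
      end of \<open>t\<close> and span the 3-cube; \<open>k\<close> is \<open>e\<close> carried back
      along \<open>g\<close>, and equally \<open>f'\<close> carried back along
      \<open>h\<close>.\<close>
    define k where "k = res (inv g) e"
    let ?p = "inv f" and ?q = "inv e'"
    have p: "perp ?p y" "res ?p y = e" using 1 perp_inv res_inv perp_sym by metis+
    have q: "perp ?q y" "res ?q y = f'" using 2 perp_inv res_inv by metis+
    have pq: "perp ?p ?q" "res ?p ?q = inv g" "res ?q ?p = inv h"
      using gh perp_top res_top perp_sym by metis+
    have ge: "perp (inv g) e" using perp_res[OF pq(1) p(1) q(1)] p pq by simp
    have hf: "perp (inv h) f'" using perp_res[OF perp_sym[OF pq(1)] q(1) p(1)] q pq by simp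
    have k: "k = res (inv h) f'" using res_cube[OF pq(1) p(1) q(1)] p q pq unfolding k_def by simp
    have gk: "perp g k" "res g k = e" using perp_inv[OF ge] res_inv[OF ge] unfolding k_def
      by simp_all
    have hk: "perp h k" "res h k = f'" using perp_inv[OF hf] res_inv[OF hf] unfolding k by simp_all
    let ?e = "res k g" and ?f = "res k h" and ?u = "k # t"
    have "perp ?e ?f" using perp_res gk hk gh perp_sym by blast
    moreover have "x = res ?e ?f"
      using res_cube[OF gk(1) gh(1) perp_sym[OF hk(1)]] 1 gh gk by simp
    moreover have "z = res ?f ?e"
      using res_cube[OF hk(1) perp_sym[OF gh(1)] perp_sym[OF gk(1)]] 2 gh hk by simp
    moreover have "w1 \<asymp> ?e # ?u"
      using 1(4) eqv_Cons[OF gh(4), of e] eqv_swap[OF gk(1), of t] gk(2) eqv_trans by metis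
    moreover have "w3 \<asymp> ?f # ?u"
      using 2(5) eqv_Cons[OF gh(5), of f'] eqv_swap[OF hk(1), of t] hk(2) eqv_trans by metis
    ultimately show ?thesis unfolding heads_def by blast
  qed
qed

text \<open>However many flips are made, the total change of the last edge amounts to at most one
  flip of the last two edges, up to flips of shorter words. The outer induction on length supplies
  the hypothesis for composing two such changes.\<close>

lemma eqv_heads: "x # w \<asymp> y # w' \<Longrightarrow> heads x w y w'"
proof (induction "length w" arbitrary: x w y w' rule: less_induct)
  case less
  have "\<exists>y w'. v = y # w' \<and> heads x w y w'" if "x # w \<asymp> v" for v
    using that
  proof (induction rule: rtranclp_induct)
    case base then show ?case by (auto simp: heads_def)
  next
    case (step u v)
    then obtain y w' where u: "u = y # w'" "heads x w y w'" by blast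
    obtain z w'' where v: "v = z # w''" using swap_length[OF step(2)] u by (cases v) auto
    have "heads y w' z w''" using swap_heads step(2) u v by blast
    then show ?case using heads_trans[of "length w" w x y w' z w''] less(1) u(2) v by blast
  qed
  then show ?case using less(2) by blast
qed

text \<open>The square alternative would make the inverse of \<open>g\<close> perpendicular to
  itself.\<close>

lemma eqv_Cons_cancel: "g # w \<asymp> g # w' \<Longrightarrow> w \<asymp> w'"
  using eqv_heads[of g w g w'] perp_top perp_irrefl unfolding heads_def by metis

section \<open>Reduced words and the action of edges on their classes\<close>

definition ends :: "'e list \<Rightarrow> 'e \<Rightarrow> bool"
  where "ends w e \<longleftrightarrow> (\<exists>w'. w \<asymp> e # w')"

lemma ends_eqv: "w \<asymp> w' \<Longrightarrow> ends w e \<longleftrightarrow> ends w' e"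
  unfolding ends_def by (meson eqv_sym eqv_trans)

fun reduced :: "'e list \<Rightarrow> bool" where
  "reduced [] \<longleftrightarrow> True"
| "reduced (e # w) \<longleftrightarrow> reduced w \<and> \<not> ends w (inv e)"

text \<open>A backtrack after the flip gives one before it: a final \<open>inv f\<close> of
  \<open>u\<close> moves past \<open>e\<close> across a square and cancels \<open>res e f\<close>,
  while a backtrack at \<open>res f e\<close> forces \<open>u\<close> to end with
  \<open>inv e\<close> by the normal form at the last edge.\<close>

lemma reduced_corner:
  assumes "perp e f" "reduced (res e f # e # u)"
  shows "reduced (res f e # f # u)"
proof -
  have red: "reduced u" "\<not> ends u (inv e)" "\<not> ends (e # u) (inv (res e f))" using assms by auto
  have "\<not> ends u (inv f)"
  proof
    assume "ends u (inv f)"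
    then obtain u' where "u \<asymp> inv f # u'" unfolding ends_def by blast
    then have "e # u \<asymp> e # inv f # u'" by (rule eqv_Cons)
    also have "\<dots> = res (inv f) (res f e) # inv f # u'" using res_inv[OF perp_sym[OF assms(1)]]
      by simp
    also have "\<dots> \<asymp> res (res f e) (inv f) # res f e # u'"
      by (rule eqv_swap[OF perp_inv[OF perp_sym[OF assms(1)]]])
    also have "res (res f e) (inv f) = inv (res e f)" using res_res_inv[OF perp_sym[OF assms(1)]] .
    finally have "e # u \<asymp> inv (res e f) # res f e # u'" .
    then show False using red(3) unfolding ends_def by blast
  qed
  moreover have "\<not> ends (f # u) (inv (res f e))"
  proof
    assume "ends (f # u) (inv (res f e))"
    then obtain y where "f # u \<asymp> inv (res f e) # y" unfolding ends_def by blast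
    then have "heads f u (inv (res f e)) y" by (rule eqv_heads)
    moreover have pf: "perp (inv f) (res f e)" using perp_inv[OF perp_sym[OF assms(1)]] .
    then have "f \<noteq> inv (res f e)" using perp_irrefl inv_inv by metis
    ultimately obtain a b t where ab: "perp a b" "f = res a b" "inv (res f e) = res b a" "u \<asymp> a # t"
      unfolding heads_def by blast
    have "inv a = res (inv f) (res f e)" using res_top[OF ab(1)] ab(2,3) by (metis inv_inv)
    then have "inv a = e" using res_inv[OF perp_sym[OF assms(1)]] by simp
    then have "ends u (inv e)" using ab(4) unfolding ends_def by auto
    then show False using red(2) by blast
  qed
  ultimately show ?thesis using red(1) by simp
qed

lemma reduced_swap: "swap w w' \<Longrightarrow> reduced w \<Longrightarrow> reduced w'"
proof (induction rule: swap.induct)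
  case (swap_hd e f w)
  then show ?case using reduced_corner by blast
next
  case (swap_tl w w' g)
  then show ?case using ends_eqv[of w w'] by auto
qed

lemma reduced_eqv: "w \<asymp> w' \<Longrightarrow> reduced w \<longleftrightarrow> reduced w'"
proof -
  have "reduced v" if "u \<asymp> v" "reduced u" for u v
    using that by (induction rule: rtranclp_induct) (auto intro: reduced_swap)
  then show "w \<asymp> w' \<Longrightarrow> reduced w \<longleftrightarrow> reduced w'" using eqv_sym by blast
qed

definition cls :: "'e list \<Rightarrow> 'e list set"
  where "cls w = {w'. w \<asymp> w'}"

lemma cls_eq: "cls w = cls w' \<longleftrightarrow> w \<asymp> w'"
  unfolding cls_def using eqv_sym eqv_trans by blast

text \<open>As in a free group: cancel if the class can end with the inverse edge, append otherwise.
  \<open>act_push\<close> and \<open>act_pop\<close> show independence of the choices made by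
  \<open>SOME\<close>.\<close>

definition act :: "'e \<Rightarrow> 'e list set \<Rightarrow> 'e list set"
  where "act e C = (let w = SOME w. w \<in> C in if ends w (inv e) then cls (SOME w'. w \<asymp> inv e # w') else cls (e # w))"

lemma act_cls_aux:
  obtains w' where "w \<asymp> w'"
    "act e (cls w) = (if ends w' (inv e) then cls (SOME v. w' \<asymp> inv e # v) else cls (e # w'))"
proof -
  have "(SOME v. v \<in> cls w) \<in> cls w" by (rule someI[of _ w]) (simp add: cls_def)
  then show thesis using that[of "SOME v. v \<in> cls w"] unfolding act_def Let_def cls_def by simp
qed

lemma act_push: "\<not> ends w (inv e) \<Longrightarrow> act e (cls w) = cls (e # w)"
  using act_cls_aux[of w e] ends_eqv cls_eq eqv_Cons eqv_sym by metis

lemma act_pop: "w \<asymp> inv e # v \<Longrightarrow> act e (cls w) = cls v"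
proof -
  assume v: "w \<asymp> inv e # v"
  obtain w' where w': "w \<asymp> w'"
    "act e (cls w) = (if ends w' (inv e) then cls (SOME v. w' \<asymp> inv e # v) else cls (e # w'))"
    by (rule act_cls_aux)
  have *: "w' \<asymp> inv e # v" using v w' eqv_sym eqv_trans by blast
  then have "w' \<asymp> inv e # (SOME v. w' \<asymp> inv e # v)" by (rule someI)
  then have "(SOME v. w' \<asymp> inv e # v) \<asymp> v" using * eqv_Cons_cancel eqv_sym eqv_trans by blast
  then show ?thesis using w'(2) * cls_eq unfolding ends_def by auto
qed

text \<open>Reducedness guarantees that undoing a cancellation appends the edge instead of
  cancelling once more.\<close>

lemma act_inv:
  assumes "reduced w" shows "act (inv e) (act e (cls w)) = cls w"
proof (cases "ends w (inv e)")
  case True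
  then obtain v where v: "w \<asymp> inv e # v" unfolding ends_def by blast
  then have "reduced (inv e # v)" using assms reduced_eqv by blast
  then show ?thesis using act_pop[OF v] act_push[of v "inv e"] cls_eq v eqv_sym by auto
next
  case False
  then show ?thesis using act_push[OF False] act_pop[of "e # w" "inv e" w] by simp
qed

lemma act_reduced:
  assumes "reduced w"
  obtains w' where "reduced w'" "act e (cls w) = cls w'"
    "(w' = e # w) \<or> (w \<asymp> inv e # w')"
proof (cases "ends w (inv e)")
  case True
  then obtain v where v: "w \<asymp> inv e # v" unfolding ends_def by blast
  then have "reduced (inv e # v)" using assms reduced_eqv by blast
  then have "reduced v" by simp
  then show ?thesis by (rule that[OF _ act_pop[OF v]]) (use v in blast)
next
  case False
  then have "reduced (e # w)" using assms by simp
  then show ?thesis by (rule that[OF _ act_push[OF False]]) blast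
qed

text \<open>Nothing cancels against \<open>f\<close> here. If \<open>e\<close> cancels, a flip
  carries the cancellation past \<open>f\<close>; otherwise neither route cancels at all and the
  results differ by one flip.\<close>

lemma act_square_push:
  assumes ef: "perp e f" and w: "reduced w" "\<not> ends w (inv f)"
  shows "act (res e f) (act e (cls w)) = act (res f e) (act f (cls w))"
proof (cases "ends w (inv e)")
  case True
  then obtain v where v: "w \<asymp> inv e # v" unfolding ends_def by blast
  have fe: "f = res (inv e) (res e f)" "inv (res f e) = res (res e f) (inv e)"
    using res_inv[OF ef] res_res_inv[OF ef] by auto
  have "f # w \<asymp> f # inv e # v" using v by (rule eqv_Cons)
  also have "\<dots> \<asymp> inv (res f e) # res e f # v"
    using eqv_swap[OF perp_inv[OF ef], of v] fe by simp
  finally have fw: "f # w \<asymp> inv (res f e) # res e f # v" .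
  have "reduced (f # w)" using w by simp
  then have "reduced (res e f # v)" using reduced_eqv[OF fw] by simp
  then have "act (res e f) (cls v) = cls (res e f # v)" using act_push by auto
  then show ?thesis using act_pop[OF v] act_push[OF w(2)] act_pop[OF fw] by simp
next
  case False
  have "\<not> ends (a # w) (inv (res a b))" if ab: "perp a b" "\<not> ends w (inv b)" for a b
  proof
    assume "ends (a # w) (inv (res a b))"
    then obtain y where "a # w \<asymp> inv (res a b) # y" unfolding ends_def by blast
    then have "heads a w (inv (res a b)) y" by (rule eqv_heads)
    moreover have "a \<noteq> inv (res a b)" using perp_inv[OF ab(1)] perp_irrefl inv_inv by metis
    ultimately obtain c d t where cd: "perp c d" "a = res c d" "inv (res a b) = res d c" "w \<asymp> c # t"
      unfolding heads_def by blast
    have "inv c = res (inv a) (res a b)" using res_top[OF cd(1)] cd(2,3) by (metis inv_inv)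
    then have "inv c = b" using res_inv[OF ab(1)] by simp
    then show False using cd(4) ab(2) unfolding ends_def by auto
  qed
  from this[OF ef w(2)] this[OF perp_sym[OF ef] False]
  show ?thesis using act_push False w(2) eqv_swap[OF ef] cls_eq by simp
qed

text \<open>In the remaining case both edges cancel. The two possible endings of \<open>w\<close>
  are then the last sides of a square, and both routes retrace that square to the same word
  \<open>u\<close>.\<close>

lemma act_square:
  assumes ef: "perp e f" and w: "reduced w"
  shows "act (res e f) (act e (cls w)) = act (res f e) (act f (cls w))"
proof (cases "ends w (inv e) \<and> ends w (inv f)")
  case True
  then obtain v v' where v: "w \<asymp> inv e # v" "w \<asymp> inv f # v'" unfolding ends_def by blast
  then have "heads (inv e) v (inv f) v'" using eqv_heads eqv_sym eqv_trans by blast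
  moreover have "inv e \<noteq> inv f" using ef perp_irrefl inv_inv by metis
  ultimately obtain a b u where ab: "perp a b" "inv e = res a b" "inv f = res b a" "v \<asymp> a # u"
    "v' \<asymp> b # u"
    unfolding heads_def by blast
  have "inv a = res e f" using res_top[OF ab(1)] ab(2,3) by (metis inv_inv)
  moreover have "inv b = res f e" using res_top[OF perp_sym[OF ab(1)]] ab(2,3) by (metis inv_inv)
  ultimately have "act (res e f) (cls v) = cls u" "act (res f e) (cls v') = cls u"
    using act_pop ab(4,5) by (metis inv_inv)+
  then show ?thesis using act_pop v by simp
next
  case False
  then show ?thesis using act_square_push[OF ef w] act_square_push[OF perp_sym[OF ef] w] by auto
qed

end

section \<open>Monodromy\<close>

definition concat_path :: "(real \<Rightarrow> 'p) \<Rightarrow> (real \<Rightarrow> 'p) \<Rightarrow> real \<Rightarrow> 'p"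
  where "concat_path p q t = (if t \<le> 1/2 then p (2 * t) else q (2 * t - 1))"

lemma pathin_concat:
  assumes "pathin X p" "pathin X q" "p 1 = q 0"
  shows "pathin X (concat_path p q)"
proof -
  have "continuous_map (top_of_set {0..1}) X (\<lambda>t. if t \<le> 1/2 then p (2 * t) else q (2 * t - 1))"
  proof (rule continuous_map_cases_le)
    let ?A = "{0..1} \<inter> {x \<in> topspace (top_of_set {0..1}). x \<le> (1/2::real)}"
      and ?B = "{0..1} \<inter> {x \<in> topspace (top_of_set {0..1}). (1/2::real) \<le> x}"
    have 1: "continuous_map (top_of_set ?A) (top_of_set {0..1}) (\<lambda>t::real. 2 * t)"
      by (auto intro!: continuous_intros)
    show "continuous_map (subtopology (top_of_set {0..1}) {x \<in> topspace (top_of_set {0..1}). x \<le> 1/2}) X (\<lambda>t. p (2 * t))"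
      using continuous_map_compose[OF 1 assms(1)[unfolded pathin_def]]
      by (simp only: subtopology_subtopology o_def)
    have 2: "continuous_map (top_of_set ?B) (top_of_set {0..1}) (\<lambda>t::real. 2 * t - 1)"
      by (auto intro!: continuous_intros)
    show "continuous_map (subtopology (top_of_set {0..1}) {x \<in> topspace (top_of_set {0..1}). 1/2 \<le> x}) X (\<lambda>t. q (2 * t - 1))"
      using continuous_map_compose[OF 2 assms(2)[unfolded pathin_def]]
      by (simp only: subtopology_subtopology o_def)
    show "p (2 * x) = q (2 * x - 1)" if "x \<in> topspace (top_of_set {0..1})" "x = 1/2" for x :: real
      unfolding that(2) using assms(3) by simp
  qed auto
  then show ?thesis unfolding pathin_def concat_path_def .
qed

text \<open>A covering map \<open>pr\<close> with total space \<open>T\<close> modulo \<open>eq\<close>: instead of a topology on the total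
  space, \<open>nb t s\<close> says that \<open>s\<close> lies in the sheet through \<open>t\<close> over an evenly covered neighbourhood of
  \<open>pr t\<close>.\<close>

locale covering =
  fixes X :: "'p topology" and T :: "'t set" and pr :: "'t \<Rightarrow> 'p"
    and eq :: "'t \<Rightarrow> 't \<Rightarrow> bool" and nb :: "'t \<Rightarrow> 't \<Rightarrow> bool"
  assumes eq_refl: "t \<in> T \<Longrightarrow> eq t t"
    and eq_sym: "eq s t \<Longrightarrow> eq t s"
    and eq_trans: "eq s t \<Longrightarrow> eq t u \<Longrightarrow> eq s u"
    and eq_T: "eq s t \<Longrightarrow> s \<in> T \<and> t \<in> T \<and> pr s = pr t"
    and nb_T: "nb s t \<Longrightarrow> s \<in> T \<and> t \<in> T"
    and nb_eq: "nb s t \<Longrightarrow> eq s s' \<Longrightarrow> eq t t' \<Longrightarrow> nb s' t'"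
    and nb_refl: "t \<in> T \<Longrightarrow> nb t t"
    and nb_det: "nb t s \<Longrightarrow> nb t s' \<Longrightarrow> pr s = pr s' \<Longrightarrow> eq s s'"
    and nb_inj: "nb t s \<Longrightarrow> nb t' s \<Longrightarrow> pr t = pr t' \<Longrightarrow> eq t t'"
    and nb_open: "q \<in> topspace X \<Longrightarrow> \<exists>W. openin X W \<and> q \<in> W \<and>
      (\<forall>t\<in>T. pr t = q \<longrightarrow> (\<forall>p\<in>W. \<exists>s. pr s = p \<and> nb t s)) \<and>
      (\<forall>s\<in>T. pr s \<in> W \<longrightarrow> (\<exists>t. pr t = q \<and> nb t s))"
    and nb_trans: "nb t s \<Longrightarrow> \<exists>W. openin X W \<and> pr s \<in> W \<and> (\<forall>u. nb s u \<and> pr u \<in> W \<longrightarrow> nb t u)"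
    and pr_X: "t \<in> T \<Longrightarrow> pr t \<in> topspace X"
begin

text \<open>Continuity of the lift is expressed through \<open>nb\<close>: nearby parameters stay in
  one sheet.\<close>

definition lift :: "'k::metric_space set \<Rightarrow> ('k \<Rightarrow> 'p) \<Rightarrow> ('k \<Rightarrow> 't) \<Rightarrow> bool"
  where "lift K H l \<longleftrightarrow> (\<forall>s\<in>K. l s \<in> T \<and> pr (l s) = H s) \<and>
    (\<forall>s\<in>K. \<exists>\<delta>>0. \<forall>t\<in>K. dist s t < \<delta> \<longrightarrow> nb (l s) (l t))"

lemma lift_compose:
  assumes "lift K H l" "continuous_on K' f" "f ` K' \<subseteq> K"
  shows "lift K' (H \<circ> f) (l \<circ> f)"
  unfolding lift_def
proof (intro conjI ballI)
  fix s assume s: "s \<in> K'"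
  then have fs: "f s \<in> K" using assms(3) by blast
  then show "(l \<circ> f) s \<in> T" "pr ((l \<circ> f) s) = (H \<circ> f) s" using assms(1) unfolding lift_def by auto
  obtain \<delta> where \<delta>: "\<delta> > 0" "\<And>t. t \<in> K \<Longrightarrow> dist (f s) t < \<delta> \<Longrightarrow> nb (l (f s)) (l t)"
    using assms(1) fs unfolding lift_def by blast
  obtain e where e: "e > 0" "\<And>t. t \<in> K' \<Longrightarrow> dist t s < e \<Longrightarrow> dist (f t) (f s) < \<delta>"
    using assms(2) s \<delta>(1) unfolding continuous_on_iff by metis
  have "nb ((l \<circ> f) s) ((l \<circ> f) t)" if "t \<in> K'" "dist s t < e" for t
    using \<delta>(2)[of "f t"] e(2)[OF that(1)] that assms(3) by (auto simp: dist_commute)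
  then show "\<exists>\<delta>>0. \<forall>t\<in>K'. dist s t < \<delta> \<longrightarrow> nb ((l \<circ> f) s) ((l \<circ> f) t)" using e(1) by blast
qed

lemma lift_subset: "lift K H l \<Longrightarrow> K' \<subseteq> K \<Longrightarrow> lift K' H l"
  unfolding lift_def by (meson subsetD)

lemma lift_cong: "lift K H l \<Longrightarrow> (\<And>s. s \<in> K \<Longrightarrow> H s = H' s) \<Longrightarrow> lift K H' l"
  unfolding lift_def by simp

lemma lift_const: "t \<in> T \<Longrightarrow> lift K (\<lambda>_. pr t) (\<lambda>_. t)"
  unfolding lift_def using nb_refl by (auto intro: exI[of _ 1])

text \<open>Agreement spreads outwards because a sheet meets each fibre at most once, and back to
  the centre because sheets through inequivalent points of one fibre are disjoint.\<close>

lemma lift_unique: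
  assumes "connected K" "lift K H l" "lift K H m" "a \<in> K" "c \<in> K" "eq (l a) (m a)"
  shows "eq (l c) (m c)"
proof (rule connected_induction_simple[OF assms(1,4,5), where P = "\<lambda>s. eq (l s) (m s)"])
  fix s assume s: "s \<in> K"
  obtain d where d: "d > 0" "\<And>t. t \<in> K \<Longrightarrow> dist s t < d \<Longrightarrow> nb (l s) (l t)"
    using assms(2) s unfolding lift_def by blast
  obtain e where e: "e > 0" "\<And>t. t \<in> K \<Longrightarrow> dist s t < e \<Longrightarrow> nb (m s) (m t)"
    using assms(3) s unfolding lift_def by blast
  let ?B = "K \<inter> ball s (min d e)"
  have pr: "pr (l t) = pr (m t)" "l t \<in> T" "m t \<in> T" if "t \<in> K" for t
    using assms(2,3) that unfolding lift_def by auto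
  have fwd: "eq (l t) (m t)" if st: "eq (l s) (m s)" "t \<in> ?B" for t
  proof -
    have t: "t \<in> K" "nb (l s) (l t)" "nb (m s) (m t)" using st(2) d(2) e(2) by auto
    show ?thesis
      using nb_det[OF nb_eq[OF t(2) st(1) eq_refl[OF pr(2)[OF t(1)]]] t(3) pr(1)[OF t(1)]] .
  qed
  have bwd: "eq (l s) (m s)" if st: "eq (l t) (m t)" "t \<in> ?B" for t
  proof -
    have t: "t \<in> K" "nb (l s) (l t)" "nb (m s) (m t)" using st(2) d(2) e(2) by auto
    show ?thesis
      using nb_inj[OF nb_eq[OF t(2) eq_refl[OF pr(2)[OF s]] st(1)] t(3) pr(1)[OF s]] .
  qed
  show "\<exists>B. openin (top_of_set K) B \<and> s \<in> B \<and> (\<forall>x\<in>B. \<forall>y\<in>B. eq (l x) (m x) \<longrightarrow> eq (l y) (m y))"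
  proof (intro exI[of _ ?B] conjI ballI impI)
    show "openin (top_of_set K) ?B" by (simp add: openin_open_Int)
    show "s \<in> ?B" using s d(1) e(1) by simp
    show "eq (l y) (m y)" if "x \<in> ?B" "y \<in> ?B" "eq (l x) (m x)" for x y
      using fwd[OF bwd[OF that(3,1)] that(2)] .
  qed
qed (use assms in auto)

lemma lift_glue:
  assumes A: "closed A" "lift A H l" and B: "closed B" "lift B H m"
    and eq: "\<And>s. s \<in> A \<inter> B \<Longrightarrow> eq (l s) (m s)"
  shows "lift (A \<union> B) H (\<lambda>s. if s \<in> A then l s else m s)" (is "lift _ _ ?n")
  unfolding lift_def
proof (intro conjI ballI)
  fix s assume s: "s \<in> A \<union> B"
  then show "?n s \<in> T" "pr (?n s) = H s" using A(2) B(2) unfolding lift_def by auto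
  have half: "\<exists>d>0. \<forall>t. t \<in> C \<and> dist s t < d \<longrightarrow> (s \<in> C \<and> nb (k s) (k t))"
    if "closed C" "lift C H k" for C k
  proof (cases "s \<in> C")
    case True then show ?thesis using that(2) unfolding lift_def by blast
  next
    case False
    then have "open (- C)" "s \<in> - C" using that(1) by auto
    then obtain d where "d > 0" "ball s d \<subseteq> - C" using open_contains_ball by blast
    then show ?thesis by (intro exI[of _ d]) auto
  qed
  obtain d where d: "d > 0" "\<And>t. t \<in> A \<Longrightarrow> dist s t < d \<Longrightarrow> s \<in> A \<and> nb (l s) (l t)"
    using half[OF A] by blast
  obtain e where e: "e > 0" "\<And>t. t \<in> B \<Longrightarrow> dist s t < e \<Longrightarrow> s \<in> B \<and> nb (m s) (m t)"
    using half[OF B] by blast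
  have "nb (?n s) (?n t)" if "t \<in> A \<union> B" "dist s t < min d e" for t
  proof (cases "t \<in> A")
    case True then show ?thesis using d(2) that by auto
  next
    case False
    then have "t \<in> B" "s \<in> B" "nb (m s) (m t)" using that e(2)[of t] by auto
    moreover have "nb (l s) (m t)" if "s \<in> A"
      using nb_eq[OF \<open>nb (m s) (m t)\<close> eq_sym[OF eq] eq_refl] nb_T[OF \<open>nb (m s) (m t)\<close>] that \<open>s \<in> B\<close>
      by blast
    ultimately show ?thesis using False by auto
  qed
  then show "\<exists>d>0. \<forall>t\<in>A \<union> B. dist s t < d \<longrightarrow> nb (?n s) (?n t)"
    using d(1) e(1) by (intro exI[of _ "min d e"]) auto
qed

definition liftable :: "('k::metric_space \<Rightarrow> 'p) \<Rightarrow> 'k set \<Rightarrow> bool"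
  where "liftable H K \<longleftrightarrow> (\<forall>s\<in>K. \<forall>t\<in>T. pr t = H s \<longrightarrow> (\<exists>l. lift K H l \<and> l s = t))"

lemma liftable_subset: "liftable H K \<Longrightarrow> K' \<subseteq> K \<Longrightarrow> liftable H K'"
  unfolding liftable_def by (meson lift_subset subsetD)

text \<open>On a connected overlap, lifts that agree at one point agree everywhere up to
  \<open>eq\<close>, so they can be glued.\<close>

lemma liftable_Un:
  fixes A B :: "'k::metric_space set"
  assumes A: "closed A" "liftable H A" and B: "closed B" "liftable H B"
    and AB: "connected (A \<inter> B)" "c \<in> A" "c \<in> B"
  shows "liftable H (A \<union> B)"
  unfolding liftable_def
proof (intro ballI impI)
  have main: "\<exists>l. lift (A \<union> B) H l \<and> l s = t"
    if A: "closed A" "liftable H A" and B: "closed B" "liftable H B"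
    and AB: "connected (A \<inter> B)" "c \<in> A" "c \<in> B" and s: "s \<in> A" "t \<in> T" "pr t = H s"
      for A B :: "'k set" and s t
  proof -
    obtain l where l: "lift A H l" "l s = t" using A(2) s unfolding liftable_def by blast
    have "l c \<in> T" "pr (l c) = H c" using l(1) AB(2) unfolding lift_def by auto
    then obtain m where m: "lift B H m" "m c = l c"
      using B(2) AB(3) unfolding liftable_def by blast
    have "eq (l x) (m x)" if "x \<in> A \<inter> B" for x
    proof (rule lift_unique[OF AB(1) lift_subset[OF l(1) Int_lower1] lift_subset[OF m(1) Int_lower2] _ that])
      show "c \<in> A \<inter> B" using AB(2,3) by blast
      have "m c \<in> T" using m(1) AB(3) unfolding lift_def by blast
      then show "eq (l c) (m c)" using eq_refl m(2) by metis
    qed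
    then have "lift (A \<union> B) H (\<lambda>s. if s \<in> A then l s else m s)"
      by (intro lift_glue A(1) B(1) l(1) m(1))
    then show ?thesis using l(2) s(1) by (intro exI[of _ "\<lambda>s. if s \<in> A then l s else m s"]) simp
  qed
  fix s t assume "s \<in> A \<union> B" "t \<in> T" "pr t = H s"
  then show "\<exists>l. lift (A \<union> B) H l \<and> l s = t"
    using main[OF A B AB] main[OF B A] AB by (auto simp: Int_commute Un_commute)
qed

text \<open>Over an evenly covered set the lift runs inside the sheet of one point over
  \<open>H a\<close>; \<open>nb_trans\<close> makes it continuous.\<close>

lemma liftable_local:
  assumes H: "continuous_map euclidean X H"
  shows "\<exists>\<delta>>0. liftable H (ball (a :: 'k::metric_space) \<delta>)"
proof -
  have open_pre: "\<exists>\<delta>>0. \<forall>t. dist s t < \<delta> \<longrightarrow> H t \<in> W" if "openin X W" "H s \<in> W" for s W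
  proof -
    have "open {x. H x \<in> W}" using openin_continuous_map_preimage[OF H that(1)] by simp
    moreover have "s \<in> {x. H x \<in> W}" using that(2) by simp
    ultimately obtain \<delta> where "\<delta> > 0" "ball s \<delta> \<subseteq> {x. H x \<in> W}" using open_contains_ball by blast
    then show ?thesis by (intro exI[of _ \<delta>]) auto
  qed
  have HX: "H s \<in> topspace X" for s using H by (auto simp: continuous_map_def)
  obtain W where W: "openin X W" "H a \<in> W" "\<And>t p. t \<in> T \<Longrightarrow> pr t = H a \<Longrightarrow> p \<in> W \<Longrightarrow> \<exists>s. pr s = p \<and>
    nb t s"
    "\<And>s. s \<in> T \<Longrightarrow> pr s \<in> W \<Longrightarrow> \<exists>t. pr t = H a \<and> nb t s"
    using nb_open[OF HX[of a]] by blast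
  obtain \<delta> where \<delta>: "\<delta> > 0" "\<And>t. dist a t < \<delta> \<Longrightarrow> H t \<in> W" using open_pre[OF W(1,2)] by blast
  have "liftable H (ball a \<delta>)"
    unfolding liftable_def
  proof (intro ballI impI)
    fix s0 t0 assume s0: "s0 \<in> ball a \<delta>" "t0 \<in> T" "pr t0 = H s0"
    then obtain t where t: "pr t = H a" "nb t t0" using W(4)[of t0] \<delta>(2)[of s0] by auto
    \<comment> \<open>The value at \<open>s0\<close> is prescribed separately, since the choice need
      not return \<open>t0\<close>.\<close>
    define l where "l u = (if u = s0 then t0 else SOME s. pr s = H u \<and> nb t s)" for u
    have l: "pr (l u) = H u \<and> nb t (l u)" if u: "u \<in> ball a \<delta>" for u
    proof (cases "u = s0")
      case True then show ?thesis using s0 t unfolding l_def by simp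
    next
      case False
      have "\<exists>s. pr s = H u \<and> nb t s" using W(3)[of t "H u"] t nb_T[OF t(2)] \<delta>(2)[of u] u by auto
      from someI_ex[OF this] show ?thesis using False unfolding l_def by simp
    qed
    have "lift (ball a \<delta>) H l"
      unfolding lift_def
    proof (intro conjI ballI)
      fix u assume u: "u \<in> ball a \<delta>"
      show "l u \<in> T" "pr (l u) = H u" using l[OF u] nb_T by auto
      obtain W1 where W1: "openin X W1" "H u \<in> W1" "\<And>v. nb (l u) v \<Longrightarrow> pr v \<in> W1 \<Longrightarrow> nb t v"
        using nb_trans[of t "l u"] l[OF u] by auto
      obtain W2 where W2: "openin X W2" "H u \<in> W2" "\<And>p. p \<in> W2 \<Longrightarrow> \<exists>s. pr s = p \<and> nb (l u) s"
        using nb_open[OF HX[of u]] l[OF u] nb_T by metis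
      obtain e where e: "e > 0" "\<And>v. dist u v < e \<Longrightarrow> H v \<in> W1 \<inter> W2"
        using open_pre[of "W1 \<inter> W2" u] W1 W2 by blast
      have "nb (l u) (l v)" if v: "v \<in> ball a \<delta>" "dist u v < e" for v
      proof -
        obtain s where s: "pr s = H v" "nb (l u) s" using W2(3)[of "H v"] e(2)[OF v(2)] by blast
        then have "nb t s" using W1(3)[of s] e(2)[OF v(2)] by auto
        then have "eq s (l v)" using nb_det l[OF v(1)] s(1) by metis
        then show ?thesis using nb_eq[OF s(2)] eq_refl nb_T[OF s(2)] by blast
      qed
      then show "\<exists>d>0. \<forall>v\<in>ball a \<delta>. dist u v < d \<longrightarrow> nb (l u) (l v)" using e(1) by blast
    qed
    moreover have "l s0 = t0" unfolding l_def by simp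
    ultimately show "\<exists>l. lift (ball a \<delta>) H l \<and> l s0 = t0" by blast
  qed
  then show ?thesis using \<delta>(1) by blast
qed

text \<open>Subdivision by two applications of \<open>Bolzano\<close>: vertically, to lift over a
  strip whose width may shrink at each merge, and then horizontally, to join strips along vertical
  segments.\<close>

lemma liftable_square:
  fixes H :: "real \<times> real \<Rightarrow> 'p"
  assumes H: "continuous_map euclidean X H"
  shows "liftable H ({0..1} \<times> {0..1})"
proof -
  have strip: "\<exists>\<delta>>0. liftable H ({x - \<delta>..x + \<delta>} \<times> {0..1})" for x :: real
  proof -
    show ?thesis
    proof (rule Bolzano[where P = "\<lambda>u v. \<exists>\<delta>>0. liftable H ({x - \<delta>..x + \<delta>} \<times> {u..v})"])
      fix u v w :: real
      assume trans: "\<exists>\<delta>>0. liftable H ({x - \<delta>..x + \<delta>} \<times> {u..v})"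
        "\<exists>\<delta>>0. liftable H ({x - \<delta>..x + \<delta>} \<times> {v..w})" "u \<le> v" "v \<le> w"
      then obtain d e where d: "d > 0" "liftable H ({x - d..x + d} \<times> {u..v})"
        and e: "e > 0" "liftable H ({x - e..x + e} \<times> {v..w})" by blast
      define g where "g = min d e"
      have g: "g > 0" "liftable H ({x - g..x + g} \<times> {u..v})" "liftable H ({x - g..x + g} \<times> {v..w})"
        using d(1) e(1)
          by (simp add: g_def, intro liftable_subset[OF d(2)] Sigma_mono, auto simp: g_def)
          (rule liftable_subset[OF e(2)], auto)
      have "({x - g..x + g} \<times> {u..v}) \<inter> ({x - g..x + g} \<times> {v..w}) = {x - g..x + g} \<times> {v}"
        using trans by auto
      moreover have "connected ({x - g..x + g} \<times> {v})" by (intro connected_Times) auto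
      ultimately have "liftable H (({x - g..x + g} \<times> {u..v}) \<union> ({x - g..x + g} \<times> {v..w}))"
        using g trans by (intro liftable_Un[where c = "(x, v)"] closed_Times) auto
      moreover have "({x - g..x + g} \<times> {u..v}) \<union> ({x - g..x + g} \<times> {v..w}) =
        {x - g..x + g} \<times> {u..w}"
        using trans by auto
      ultimately show "\<exists>\<delta>>0. liftable H ({x - \<delta>..x + \<delta>} \<times> {u..w})" using g(1) by auto
    next
      fix y :: real
      obtain \<delta> where \<delta>: "\<delta> > 0" "liftable H (ball (x, y) \<delta>)" using liftable_local[OF H] by blast
      \<comment> \<open>Two coordinate differences of at most \<open>\<delta> / 3\<close> keep the
        rectangle inside the ball.\<close>
      have "liftable H ({x - \<delta> / 3..x + \<delta> / 3} \<times> {u..v})" if "u \<le> y" "y \<le> v" "v - u < \<delta> / 3" for u v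
      proof (rule liftable_subset[OF \<delta>(2)], rule subsetI)
        fix z assume z: "z \<in> {x - \<delta> / 3..x + \<delta> / 3} \<times> {u..v}"
        then have "\<bar>x - fst z\<bar> \<le> \<delta> / 3" "\<bar>y - snd z\<bar> \<le> \<delta> / 3"
          using that unfolding abs_le_iff by (auto simp: field_simps)
        moreover have "dist (x, y) z \<le> \<bar>x - fst z\<bar> + \<bar>y - snd z\<bar>"
          unfolding dist_prod_def
            using sqrt_sum_squares_le_sum_abs[of "dist x (fst z)" "dist y (snd z)"]
          by (simp add: dist_real_def)
        ultimately show "z \<in> ball (x, y) \<delta>" using \<delta>(1) by auto
      qed
      then show "\<exists>d>0. \<forall>u v. u \<le> y \<and> y \<le> v \<and> v - u < d \<longrightarrow>
        (\<exists>\<delta>>0. liftable H ({x - \<delta>..x + \<delta>} \<times> {u..v}))"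
        using \<delta>(1) by (intro exI[of _ "\<delta> / 3"]) (auto intro!: exI[of _ "\<delta> / 3"])
    qed simp
  qed
  show ?thesis
  proof (rule Bolzano[where P = "\<lambda>u v. liftable H ({u..v} \<times> {0..1})"])
    fix u v w :: real
    assume trans: "liftable H ({u..v} \<times> {0..1})" "liftable H ({v..w} \<times> {0..1})" "u \<le> v" "v \<le> w"
    have "({u..v} \<times> {0..1::real}) \<inter> ({v..w} \<times> {0..1}) = {v} \<times> {0..1}" using trans by auto
    moreover have "connected ({v} \<times> {0..1::real})" by (intro connected_Times) auto
    ultimately have "liftable H (({u..v} \<times> {0..1}) \<union> ({v..w} \<times> {0..1}))"
      using trans by (intro liftable_Un[where c = "(v, 0)"] closed_Times) auto
    moreover have "({u..v} \<times> {0..1::real}) \<union> ({v..w} \<times> {0..1}) = {u..w} \<times> {0..1}" using trans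
      by auto
    ultimately show "liftable H ({u..w} \<times> {0..1})" by auto
  next
    fix x :: real
    obtain \<delta> where \<delta>: "\<delta> > 0" "liftable H ({x - \<delta>..x + \<delta>} \<times> {0..1})" using strip by blast
    then show "\<exists>d>0. \<forall>u v. u \<le> x \<and> x \<le> v \<and> v - u < d \<longrightarrow> liftable H ({u..v} \<times> {0..1})"
      by (intro exI[of _ \<delta>]) (auto intro!: liftable_subset[OF \<delta>(2)])
  qed simp
qed

section \<open>Transport along lifted paths\<close>

definition reach :: "'t \<Rightarrow> 't \<Rightarrow> bool"
  where "reach t s \<longleftrightarrow> (\<exists>p l. pathin X p \<and> lift {0..1} p l \<and> eq (l 0) t \<and> eq (l 1) s)"

lemma reach_refl: "t \<in> T \<Longrightarrow> reach t t"
  unfolding reach_def using lift_const eq_refl pr_X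
  by (intro exI[of _ "\<lambda>_. pr t"] exI[of _ "\<lambda>_. t"]) (auto simp: pathin_def)

lemma reach_trans:
  assumes "reach t s" "reach s u"
  shows "reach t u"
proof -
  obtain p l where l: "pathin X p" "lift {0..1} p l" "eq (l 0) t" "eq (l 1) s" using assms(1)
    unfolding reach_def by blast
  obtain q m where m: "pathin X q" "lift {0..1} q m" "eq (m 0) s" "eq (m 1) u" using assms(2)
    unfolding reach_def by blast
  have lm: "eq (l 1) (m 0)" using l m eq_sym eq_trans by blast
  have "pr (l 1) = p 1" "pr (m 0) = q 0" using l(2) m(2) unfolding lift_def by auto
  then have pq: "p 1 = q 0" using eq_T[OF lm] by auto
  let ?c = "concat_path p q"
  have "lift {0..1/2} (p \<circ> (\<lambda>t. 2 * t)) (l \<circ> (\<lambda>t. 2 * t))"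
    by (rule lift_compose[OF l(2)]) (auto intro!: continuous_intros)
  then have A: "lift {0..1/2} ?c (l \<circ> (\<lambda>t. 2 * t))"
    unfolding lift_def concat_path_def by auto
  have "lift {1/2..1} (q \<circ> (\<lambda>t. 2 * t - 1)) (m \<circ> (\<lambda>t. 2 * t - 1))"
    by (rule lift_compose[OF m(2)]) (auto intro!: continuous_intros)
  moreover have "?c t = (q \<circ> (\<lambda>t. 2 * t - 1)) t" if "t \<in> {1/2..1}" for t
  proof (cases "2 * t = 1")
    case True then show ?thesis using pq unfolding concat_path_def by simp
  next
    case False then show ?thesis using that unfolding concat_path_def by simp
  qed
  ultimately have B: "lift {1/2..1} ?c (m \<circ> (\<lambda>t. 2 * t - 1))"
    unfolding lift_def by simp
  have "{0..1/2} \<inter> {1/2..1} = {1/2::real}" by auto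
  then have "lift ({0..1/2} \<union> {1/2..1}) ?c (\<lambda>t. if t \<in> {0..1/2} then (l \<circ> (\<lambda>t. 2 * t)) t else (m \<circ> (\<lambda>t. 2 * t - 1)) t)"
  proof (intro lift_glue A B)
    fix t :: real assume "t \<in> {0..1/2} \<inter> {1/2..1}"
    then have t: "t = 1/2" by simp
    show "eq ((l \<circ> (\<lambda>t. 2 * t)) t) ((m \<circ> (\<lambda>t. 2 * t - 1)) t)" unfolding t using lm by simp
  qed auto
  moreover have "{0..1/2} \<union> {1/2..1} = {0..1::real}" by auto
  ultimately have "lift {0..1} ?c (\<lambda>t. if t \<in> {0..1/2} then (l \<circ> (\<lambda>t. 2 * t)) t else (m \<circ> (\<lambda>t. 2 * t - 1)) t)"
    by simp
  then show ?thesis unfolding reach_def using pathin_concat[OF l(1) m(1) pq] l(3) m(4)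
    by (intro exI[of _ ?c] exI[of _ "\<lambda>t. if t \<in> {0..1/2} then (l \<circ> (\<lambda>t. 2 * t)) t else (m \<circ> (\<lambda>t. 2 * t - 1)) t"]) auto
qed

lemma reach_sym:
  assumes "reach t s" shows "reach s t"
proof -
  obtain p l where l: "pathin X p" "lift {0..1} p l" "eq (l 0) t" "eq (l 1) s" using assms
    unfolding reach_def by blast
  have "continuous_map (top_of_set {0..1}) (top_of_set {0..1}) (\<lambda>t::real. 1 - t)"
    by (auto intro!: continuous_intros)
  from continuous_map_compose[OF this l(1)[unfolded pathin_def]]
  have "pathin X (p \<circ> (\<lambda>t. 1 - t))" unfolding pathin_def .
  moreover have "lift {0..1} (p \<circ> (\<lambda>t. 1 - t)) (l \<circ> (\<lambda>t. 1 - t))"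
    by (rule lift_compose[OF l(2)]) (auto intro!: continuous_intros)
  ultimately show ?thesis unfolding reach_def using l(3,4)
    by (metis (no_types, lifting) comp_apply diff_self diff_zero)
qed

text \<open>Triviality of the monodromy: the contraction of the projected loop is lifted over the
  square. Three sides of the square are mapped to a point, so their lifts stay in one
  \<open>eq\<close> class, and the ends of the fourth side are equivalent.\<close>

lemma reach_closed:
  assumes "simply_connected_space X" "reach t s" "pr t = pr s"
  shows "eq t s"
proof -
  obtain p l where l: "pathin X p" "lift {0..1} p l" "eq (l 0) t" "eq (l 1) s" using assms(2)
    unfolding reach_def by blast
  have "pr (l 0) = p 0" "pr (l 1) = p 1" using l(2) unfolding lift_def by auto
  then have "p 0 = p 1" using eq_T l(3,4) assms(3) by metis
  then have "homotopic_with (\<lambda>q. q 0 = p 0 \<and> q 1 = p 1) (top_of_set {0..1}) X p (\<lambda>_. p 0)"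
    using assms(1) l(1) unfolding simply_connected_space_def by blast
  then obtain h
    where h: "continuous_map (prod_topology (top_of_set {0..1}) (top_of_set {0..1})) X h"
    "\<And>x. h (0::real, x::real) = p x" "\<And>x. h (1, x) = p 0"
      "\<And>t. t \<in> {0..1} \<Longrightarrow> h (t, 0) = p 0 \<and> h (t, 1) = p 1"
    unfolding homotopic_with_def by auto
  \<comment> \<open>Clamping extends the homotopy to the whole plane, where
    \<open>liftable_square\<close> asks for continuity.\<close>
  define c :: "real \<Rightarrow> real" where "c x = max 0 (min 1 x)" for x
  define H where "H = h \<circ> (\<lambda>z. (c (fst z), c (snd z)))"
  have c01: "c x \<in> {0..1}" "x \<in> {0..1} \<Longrightarrow> c x = x" for x unfolding c_def by auto
  have "continuous_map euclidean (prod_topology (top_of_set {0..1}) (top_of_set {0..1})) (\<lambda>z. (c (fst z), c (snd z)))"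
    unfolding c_def by (auto simp: continuous_map_in_subtopology intro!: continuous_intros)
  then have "continuous_map euclidean X H" unfolding H_def using h(1) continuous_map_compose
    by blast
  then have "liftable H ({0..1} \<times> {0..1})" by (rule liftable_square)
  moreover have "l 0 \<in> T" "pr (l 0) = H (0, 0)"
    using l(2) h(2)[of 0] c01(2)[of 0] unfolding lift_def H_def by auto
  ultimately obtain m where m: "lift ({0..1} \<times> {0..1}) H m" "m (0, 0) = l 0"
    unfolding liftable_def by (metis SigmaI atLeastAtMost_iff order_refl zero_le_one)
  have side: "lift {0..1} (H \<circ> f) (m \<circ> f)" if "f = (\<lambda>t. (a, t)) \<or> f = (\<lambda>t. (t, a))" "a \<in> {0..1}"
    for f a
    using that by (intro lift_compose[OF m(1)]) (auto intro!: continuous_intros)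
  have const: "eq (m (f 0)) (m (f 1))" if "f = (\<lambda>t. (a, t)) \<or> f = (\<lambda>t. (t, a))" "a \<in> {0..1}"
    "\<And>t. t \<in> {0..1} \<Longrightarrow> H (f t) = H (f 0)" for f a
  proof -
    have mf: "m (f 0) \<in> T" "pr (m (f 0)) = H (f 0)" using side[OF that(1,2)] unfolding lift_def
      by auto
    have 1: "lift {0..1} (H \<circ> f) (\<lambda>_. m (f 0))"
      by (rule lift_cong[OF lift_const[OF mf(1)]]) (unfold o_def, rule trans[OF mf(2) that(3)[symmetric]])
    show ?thesis
      using lift_unique[OF connected_Icc 1 side[OF that(1,2)], of 0 1] eq_refl[OF mf(1)] by simp
  qed
  have Hval: "H (u, v) = h (u, v)" if "u \<in> {0..1}" "v \<in> {0..1}" for u v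
    using that c01(2) unfolding H_def by simp
  have "lift {0..1} p (m \<circ> (\<lambda>t. (0, t)))"
    by (rule lift_cong[OF side[of "\<lambda>t. (0, t)" 0]]) (simp_all add: Hval h(2))
  then have "eq (l 1) ((m \<circ> (\<lambda>t. (0, t))) 1)"
    by (rule lift_unique[OF connected_Icc l(2), of _ 0]) (simp_all add: m(2) eq_refl \<open>l 0 \<in> T\<close>)
  then have e1: "eq (m (0, 1)) s" using l(4) eq_sym eq_trans unfolding o_def by blast
  have e2: "eq (m (0, 0)) (m (1, 0))"
    by (rule const[of "\<lambda>t. (t, 0)" 0, simplified]) (simp_all add: Hval h(4))
  have e3: "eq (m (1, 0)) (m (1, 1))"
    by (rule const[of "\<lambda>t. (1, t)" 1, simplified]) (simp_all add: Hval h(3))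
  have e4: "eq (m (0, 1)) (m (1, 1))"
    by (rule const[of "\<lambda>t. (t, 1)" 1, simplified]) (simp_all add: Hval h(4))
  have "eq (m (0, 0)) s" by (rule eq_trans[OF eq_trans[OF e2 e3] eq_trans[OF eq_sym[OF e4] e1]])
  then show ?thesis using eq_trans[OF eq_sym[OF l(3)]] m(2) by simp
qed

end

section \<open>Isometries of cubes\<close>

lemma cube_dist_eq_iff:
  "cube_dist n z w = cube_dist m z' w' \<longleftrightarrow> (\<Sum>i<n. (z i - w i)\<^sup>2) = (\<Sum>i<m. (z' i - w' i)\<^sup>2)"
  unfolding cube_dist_def L2_set_def by simp

lemma cube_isometry_sym:
  assumes "cube_isometry n A m B h" shows "cube_isometry m B n A (inv_into A h)"
  unfolding cube_isometry_def
proof (intro conjI ballI)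
  have h: "bij_betw h A B" "\<And>z w. z \<in> A \<Longrightarrow> w \<in> A \<Longrightarrow> cube_dist m (h z) (h w) = cube_dist n z w"
    using assms unfolding cube_isometry_def by auto
  show "bij_betw (inv_into A h) B A" using h(1) by (rule bij_betw_inv_into)
  fix z w assume "z \<in> B" "w \<in> B"
  then show "cube_dist n (inv_into A h z) (inv_into A h w) = cube_dist m z w"
    using h(2)[of "inv_into A h z" "inv_into A h w"] h(1)
    by (metis bij_betw_imp_surj_on f_inv_into_f inv_into_into)
qed

lemma cube_isometry_comp:
  assumes "cube_isometry n A m B h" "cube_isometry m B k C g"
  shows "cube_isometry n A k C (g \<circ> h)"
  using assms bij_betw_trans[of h A B g C] unfolding cube_isometry_def
  by (auto simp: bij_betw_apply)

lemma cube_isometry_id: "cube_isometry n A n A id"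
  unfolding cube_isometry_def by simp

lemma face_cube: "z \<in> face n x F \<Longrightarrow> z \<in> cube n"
  unfolding face_def by simp

lemma cube_iff: "z \<in> cube n \<longleftrightarrow> (\<forall>i<n. 0 \<le> z i \<and> z i \<le> 1) \<and> (\<forall>i. \<not> i < n \<longrightarrow> z i = undefined)"
  unfolding cube_def by (auto simp: PiE_iff extensional_def)

lemma cube_bounds: "z \<in> cube n \<Longrightarrow> i < n \<Longrightarrow> 0 \<le> z i \<and> z i \<le> 1"
  unfolding cube_def by (auto simp: PiE_iff)

lemma cube_eqI: "z \<in> cube n \<Longrightarrow> w \<in> cube n \<Longrightarrow> (\<And>i. i < n \<Longrightarrow> z i = w i) \<Longrightarrow> z = w"
  unfolding cube_def by (rule PiE_ext) auto

lemma cube_upd: "z \<in> cube n \<Longrightarrow> i < n \<Longrightarrow> 0 \<le> r \<Longrightarrow> r \<le> 1 \<Longrightarrow> z(i := r) \<in> cube n"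
  unfolding cube_def by (auto simp: PiE_iff extensional_def)

lemma corners_cube: "x \<in> corners n \<Longrightarrow> x \<in> cube n"
  unfolding corners_def cube_def using PiE_mono[of "{..<n}" "\<lambda>_. {0, 1}" "\<lambda>_. {0..1::real}"] by auto

lemma corners_iff: "x \<in> corners n \<longleftrightarrow> x \<in> cube n \<and> (\<forall>i<n. x i = 0 \<or> x i = 1)"
proof
  assume "x \<in> corners n"
  then show "x \<in> cube n \<and> (\<forall>i<n. x i = 0 \<or> x i = 1)"
    using corners_cube[of x n] unfolding corners_def by (auto simp: PiE_iff)
next
  assume "x \<in> cube n \<and> (\<forall>i<n. x i = 0 \<or> x i = 1)"
  then show "x \<in> corners n" unfolding corners_def cube_def by (simp add: PiE_iff)
qed

lemma sum_face:
  assumes "z \<in> face n x F" "w \<in> face n x F" "F \<subseteq> {..<n}"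
  shows "(\<Sum>i<n. (z i - w i)\<^sup>2) = (\<Sum>i\<in>F. (z i - w i)\<^sup>2)"
  using assms by (intro sum.mono_neutral_right) (auto simp: face_def)

definition flip :: "nat \<Rightarrow> (nat \<Rightarrow> real) \<Rightarrow> nat \<Rightarrow> real"
  where "flip i x = x(i := 1 - x i)"

lemma flip_flip [simp]: "flip i (flip i x) = x"
  unfolding flip_def by auto

lemma flip_commute: "flip i (flip j x) = flip j (flip i x)"
  unfolding flip_def by (cases "i = j") (auto simp: fun_upd_twist)

lemma flip_apply: "flip i x j = (if j = i then 1 - x j else x j)"
  unfolding flip_def by simp

lemma flip_corners: "x \<in> corners n \<Longrightarrow> i < n \<Longrightarrow> flip i x \<in> corners n"
  unfolding flip_def corners_iff using cube_upd by auto

definition rel_corners :: "nat \<Rightarrow> (nat \<Rightarrow> real) \<Rightarrow> nat set \<Rightarrow> (nat \<Rightarrow> real) set"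
  where "rel_corners n x F = {a \<in> face n x F. \<forall>i\<in>F. a i = 0 \<or> a i = 1}"

definition antipode :: "nat set \<Rightarrow> (nat \<Rightarrow> real) \<Rightarrow> nat \<Rightarrow> real"
  where "antipode F a i = (if i \<in> F then 1 - a i else a i)"

lemma antipode_rel_corners:
  assumes "a \<in> rel_corners n x F" "F \<subseteq> {..<n}"
  shows "antipode F a \<in> rel_corners n x F"
proof -
  have "i < n" if "i \<in> F" for i using assms that by auto
  then show ?thesis using assms unfolding rel_corners_def face_def cube_iff antipode_def by auto
qed

lemma rel_corners_nonempty:
  assumes "x \<in> cube n" "F \<subseteq> {..<n}"
  shows "(\<lambda>i. if i \<in> F then 0 else x i) \<in> rel_corners n x F"
proof -
  have "i < n" if "i \<in> F" for i using assms that by auto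
  then show ?thesis using assms unfolding rel_corners_def face_def cube_iff  by auto
qed

lemma flip_rel_corners:
  assumes "a \<in> rel_corners n x F" "F \<subseteq> {..<n}" "i \<in> F"
  shows "flip i a \<in> rel_corners n x F"
proof -
  have "i < n" if "i \<in> F" for i using assms that by auto
  then show ?thesis using assms unfolding rel_corners_def face_def cube_iff flip_apply by auto
qed

lemma abs_diff_le_1: "z \<in> cube n \<Longrightarrow> w \<in> cube n \<Longrightarrow> i < n \<Longrightarrow> \<bar>z i - w i\<bar> \<le> 1"
  using cube_bounds[of z n i] cube_bounds[of w n i] by auto

lemma sq_le_1: "z \<in> cube n \<Longrightarrow> w \<in> cube n \<Longrightarrow> i < n \<Longrightarrow> (z i - w i)\<^sup>2 \<le> 1"
  using abs_diff_le_1[of z n w i] by (simp add: abs_square_le_1)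

lemma sum_face_le:
  fixes z w :: "nat \<Rightarrow> real"
  assumes "z \<in> face n x F" "w \<in> face n x F" "F \<subseteq> {..<n}"
  shows "(\<Sum>i\<in>F. (z i - w i)\<^sup>2) \<le> card F"
proof -
  have "(z i - w i)\<^sup>2 \<le> 1" if "i \<in> F" for i
    using sq_le_1[OF face_cube[OF assms(1)] face_cube[OF assms(2)], of i] assms(3) that by auto
  then show ?thesis using sum_bounded_above[of F "\<lambda>i. (z i - w i)\<^sup>2" "1::real"] by simp
qed

text \<open>Each coordinate contributes at most 1 to the sum, so the maximum forces every difference
  to be 1 in absolute value.\<close>

lemma max_dist_rel_corner:
  fixes z w :: "nat \<Rightarrow> real"
  assumes zw: "z \<in> face n x F" "w \<in> face n x F" and F: "F \<subseteq> {..<n}"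
    and max: "real (card F) \<le> (\<Sum>i\<in>F. (z i - w i)\<^sup>2)"
  shows "z \<in> rel_corners n x F" "w = antipode F z"
proof -
  have finF: "finite F" using F finite_subset by blast
  have le1: "(z i - w i)\<^sup>2 \<le> 1" if "i \<in> F" for i
    using sq_le_1[OF face_cube[OF zw(1)] face_cube[OF zw(2)], of i] that F by auto
  have one: "(z i - w i)\<^sup>2 = 1" if i: "i \<in> F" for i
  proof (rule ccontr)
    assume "(z i - w i)\<^sup>2 \<noteq> 1"
    then have "(z i - w i)\<^sup>2 < 1" using le1[OF i] by simp
    then have "(\<Sum>i\<in>F. (z i - w i)\<^sup>2) < (\<Sum>i\<in>F. 1)"
      using i finF le1 by (intro sum_strict_mono_ex1) auto
    then show False using max by simp
  qed
  have zi: "(z i = 0 \<and> w i = 1) \<or> (z i = 1 \<and> w i = 0)" if i: "i \<in> F" for i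
  proof -
    have "z i - w i = 1 \<or> z i - w i = -1" using one[OF i] by (simp add: power2_eq_1_iff)
    moreover have "0 \<le> z i" "z i \<le> 1" "0 \<le> w i" "w i \<le> 1"
      using cube_bounds[OF face_cube[OF zw(1)], of i] cube_bounds[OF face_cube[OF zw(2)], of i] F i
        by auto
    ultimately show ?thesis by linarith
  qed
  then show "z \<in> rel_corners n x F" using zw unfolding rel_corners_def by auto
  show "w = antipode F z"
  proof
    fix i show "w i = antipode F z i"
    proof (cases "i \<in> F")
      case True then show ?thesis using zi unfolding antipode_def by fastforce
    next
      case False
      then have "w i = z i" using zw unfolding face_def cube_iff by (cases "i < n") auto
      then show ?thesis using False unfolding antipode_def by simp
    qed
  qed
qed

lemma dist_antipode:
  assumes "a \<in> rel_corners n x F" "F \<subseteq> {..<n}"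
  shows "(\<Sum>i\<in>F. (a i - antipode F a i)\<^sup>2) = card F"
proof -
  have "(a i - antipode F a i)\<^sup>2 = 1" if "i \<in> F" for i
    using assms that unfolding antipode_def rel_corners_def by auto
  then show ?thesis by simp
qed

locale face_isometry =
  fixes n x F m y G h
  assumes F: "F \<subseteq> {..<n}" and G: "G \<subseteq> {..<m}" and x: "x \<in> cube n" and y: "y \<in> cube m"
    and iso: "cube_isometry n (face n x F) m (face m y G) h"
begin

lemma finite_FG: "finite F" "finite G"
  using F G finite_subset by blast+

lemma h_face: "z \<in> face n x F \<Longrightarrow> h z \<in> face m y G"
  using iso unfolding cube_isometry_def by (auto simp: bij_betw_apply)

lemma h_sum:
  assumes "z \<in> face n x F" "w \<in> face n x F"
  shows "(\<Sum>j\<in>G. (h z j - h w j)\<^sup>2) = (\<Sum>i\<in>F. (z i - w i)\<^sup>2)"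
  using iso assms sum_face[OF assms F] sum_face[OF h_face[OF assms(1)] h_face[OF assms(2)] G]
  unfolding cube_isometry_def cube_dist_eq_iff by simp

text \<open>The squared diameter of a face is its dimension, attained at antipodal corners.\<close>

lemma card_le: "card F \<le> card G"
proof -
  define a where "a = (\<lambda>i. if i \<in> F then 0 else x i)"
  have a: "a \<in> rel_corners n x F" using rel_corners_nonempty[OF x F] unfolding a_def .
  then have "a \<in> face n x F" "antipode F a \<in> face n x F"
    using antipode_rel_corners[OF a F] unfolding rel_corners_def by auto
  then have "real (card F) \<le> real (card G)"
    using h_sum[of a "antipode F a"] dist_antipode[OF a F] sum_face_le[OF h_face h_face G] by metis
  then show ?thesis by simp
qed

end

lemma (in face_isometry) card_eq: "card F = card G"
proof -
  interpret inv: face_isometry m y G n x F "inv_into (face n x F) h"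
    by unfold_locales (use F G x y cube_isometry_sym[OF iso] in auto)
  show ?thesis using card_le inv.card_le by simp
qed

context face_isometry
begin

text \<open>Corners are recognised metrically: they are the points at which the diameter of the face
  is attained.\<close>

lemma h_antipode:
  assumes a: "a \<in> rel_corners n x F"
  shows "h a \<in> rel_corners m y G" "h (antipode F a) = antipode G (h a)"
proof -
  have "a \<in> face n x F" "antipode F a \<in> face n x F"
    using a antipode_rel_corners[OF a F] unfolding rel_corners_def by auto
  then have "h a \<in> face m y G" "h (antipode F a) \<in> face m y G"
    "real (card G) \<le> (\<Sum>j\<in>G. (h a j - h (antipode F a) j)\<^sup>2)"
    using h_face h_sum[of a "antipode F a"] dist_antipode[OF a F] card_eq by auto
  from max_dist_rel_corner[OF this(1,2) G this(3)]
  show "h a \<in> rel_corners m y G" "h (antipode F a) = antipode G (h a)" by auto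
qed

text \<open>A neighbour of the corner \<open>a\<close> has squared distance 1 from \<open>a\<close>
  and \<open>card F - 1\<close> from the antipode of \<open>a\<close>. For the absolute coordinate
  differences \<open>s\<close> of the images this says that the sums of \<open>s\<close> and of
  \<open>s\<^sup>2\<close> are both 1; as \<open>s\<close> takes values between 0 and 1, one
  difference is 1 and all others vanish.\<close>

lemma h_flip:
  assumes a: "a \<in> rel_corners n x F" and i: "i \<in> F"
  shows "\<exists>j\<in>G. h (flip i a) = flip j (h a)"
proof -
  define u where "u = flip i a"
  define s where "s j = \<bar>h u j - h a j\<bar>" for j
  have face: "a \<in> face n x F" "u \<in> face n x F" "antipode F a \<in> face n x F"
    using a flip_rel_corners[OF a F i] antipode_rel_corners[OF a F] unfolding rel_corners_def u_def
      by auto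
  have b: "h a \<in> rel_corners m y G" "h (antipode F a) = antipode G (h a)" using h_antipode[OF a]
    by auto
  have s01: "0 \<le> s j" "s j \<le> 1" if "j \<in> G" for j
    using abs_diff_le_1[of "h u" m "h a" j] face_cube[OF h_face] face G that unfolding s_def by auto
  have "(\<Sum>k\<in>F. (u k - a k)\<^sup>2) = (\<Sum>k\<in>F. if k = i then 1 else 0)"
    using a i unfolding u_def flip_apply rel_corners_def by (intro sum.cong) auto
  then have "(\<Sum>j\<in>G. (h u j - h a j)\<^sup>2) = 1"
    using h_sum[OF face(2,1)] finite_FG(1) i by simp
  then have S2: "(\<Sum>j\<in>G. (s j)\<^sup>2) = 1" unfolding s_def by simp
  have "(\<Sum>k\<in>F. (u k - antipode F a k)\<^sup>2) = (\<Sum>k\<in>F. 1 - (if k = i then 1 else 0))"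
    using a i unfolding u_def flip_apply rel_corners_def antipode_def by (intro sum.cong) auto
  also have "\<dots> = real (card F) - 1" using finite_FG(1) i by (simp add: sum_subtractf)
  finally have A: "(\<Sum>j\<in>G. (h u j - antipode G (h a) j)\<^sup>2) = real (card G) - 1"
    using h_sum[OF face(2,3)] b(2) card_eq by simp
  have "(h u j - antipode G (h a) j)\<^sup>2 = 1 - 2 * s j + (s j)\<^sup>2" if j: "j \<in> G" for j
  proof -
    have "h a j = 0 \<or> h a j = 1" using b(1) j unfolding rel_corners_def by auto
    moreover have "0 \<le> h u j" "h u j \<le> 1"
      using cube_bounds[OF face_cube[OF h_face[OF face(2)]], of j] G j by auto
    ultimately show ?thesis using j unfolding antipode_def s_def
      by (auto simp: power2_eq_square algebra_simps)
  qed
  then have "(\<Sum>j\<in>G. 1 - 2 * s j + (s j)\<^sup>2) = real (card G) - 1" using A by simp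
  then have S1: "(\<Sum>j\<in>G. s j) = 1" using S2
    by (simp add: sum.distrib sum_subtractf sum_distrib_left[symmetric])
  have "(\<Sum>j\<in>G. s j * (1 - s j)) = 0" using S1 S2
    by (simp add: algebra_simps sum_subtractf power2_eq_square)
  then have "\<forall>j\<in>G. s j * (1 - s j) = 0"
    using sum_nonneg_eq_0_iff[OF finite_FG(2), of "\<lambda>j. s j * (1 - s j)"] s01 by auto
  then have sd: "s j = 0 \<or> s j = 1" if "j \<in> G" for j using that by fastforce
  obtain j where j: "j \<in> G" "s j = 1" using S1 sd by (metis sum.neutral zero_neq_one)
  have "(\<Sum>k\<in>G - {j}. s k) = 0" using S1 j finite_FG(2) by (simp add: sum.remove)
  then have "\<forall>k\<in>G - {j}. s k = 0" using sum_nonneg_eq_0_iff[of "G - {j}" s] finite_FG(2) s01 by auto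
  then have other: "h u k = h a k" if "k \<in> G" "k \<noteq> j" for k using that unfolding s_def by auto
  have "h u k = flip j (h a) k" for k
  proof (cases "k \<in> G")
    case True
    have "h a j = 0 \<or> h a j = 1" "0 \<le> h u j" "h u j \<le> 1"
      using b(1) j(1) cube_bounds[OF face_cube[OF h_face[OF face(2)]], of j] G
        unfolding rel_corners_def by auto
    then have "h u j = 1 - h a j" using j(2) unfolding s_def by auto
    then show ?thesis using other[OF True] unfolding flip_apply by auto
  next
    case False
    then have "h u k = h a k" using h_face[OF face(1)] h_face[OF face(2)]
      unfolding face_def cube_iff
      by (cases "k < m") auto
    then show ?thesis using False j(1) unfolding flip_apply by auto
  qed
  then show ?thesis using j(1) unfolding u_def by blast
qed

text \<open>The coordinate of a point along an edge at the corner \<open>a\<close> can be read off from its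
  distances to the two ends of that edge, so isometries of cubes act by signed permutations.\<close>

lemma coordinates:
  assumes a: "a \<in> rel_corners n x F"
  obtains p where "bij_betw p F G" "\<And>i. i \<in> F \<Longrightarrow> h (flip i a) = flip (p i) (h a)"
    "\<And>z i. z \<in> face n x F \<Longrightarrow> i \<in> F \<Longrightarrow> \<bar>h z (p i) - h a (p i)\<bar> = \<bar>z i - a i\<bar>"
proof -
  obtain p where p: "\<And>i. i \<in> F \<Longrightarrow> p i \<in> G" "\<And>i. i \<in> F \<Longrightarrow> h (flip i a) = flip (p i) (h a)"
    using h_flip[OF a] by metis
  have fl: "flip i a \<in> face n x F" if "i \<in> F" for i
    using flip_rel_corners[OF a F that] unfolding rel_corners_def by auto
  have h_inj: "inj_on h (face n x F)" using iso unfolding cube_isometry_def bij_betw_def by blast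
  have "inj_on p F"
  proof (rule inj_onI)
    fix i j assume ij: "i \<in> F" "j \<in> F" "p i = p j"
    then have "flip i a = flip j a" using p(2) inj_onD[OF h_inj _ fl fl] by metis
    then have "flip i a i = flip j a i" by simp
    then show "i = j" using a ij(1) unfolding flip_apply rel_corners_def by (auto split: if_splits)
  qed
  then have bij: "bij_betw p F G"
    using p(1) card_eq finite_FG card_subset_eq[of G "p ` F"]
      by (auto simp: bij_betw_def card_image)
  have aface: "a \<in> face n x F" using a unfolding rel_corners_def by auto
  have "\<bar>h z (p i) - h a (p i)\<bar> = \<bar>z i - a i\<bar>" if z: "z \<in> face n x F" and i: "i \<in> F" for z i
  proof -
    \<comment> \<open>Squared distances to the two ends of an edge differ by an affine function of
      the coordinate along that edge.\<close>
    have diff: "(\<Sum>k\<in>K. (w k - c k)\<^sup>2) - (\<Sum>k\<in>K. (w k - flip l c k)\<^sup>2) = 2 * \<bar>w l - c l\<bar> - 1"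
      if "finite K" "l \<in> K" "c l = 0 \<or> c l = 1" "0 \<le> w l" "w l \<le> 1" for w c K and l :: nat
    proof -
      have "(\<Sum>k\<in>K. (w k - c k)\<^sup>2) - (\<Sum>k\<in>K. (w k - flip l c k)\<^sup>2) =
        (w l - c l)\<^sup>2 - (w l - flip l c l)\<^sup>2"
        using that(1,2) by (simp add: sum.remove[of K l] flip_apply)
      also have "\<dots> = 2 * \<bar>w l - c l\<bar> - 1" using that(3-5) unfolding flip_apply
        by (auto simp: power2_eq_square algebra_simps)
      finally show ?thesis .
    qed
    have "2 * \<bar>z i - a i\<bar> - 1 = (\<Sum>k\<in>F. (z k - a k)\<^sup>2) - (\<Sum>k\<in>F. (z k - flip i a k)\<^sup>2)"
      using a z i F finite_FG cube_bounds[OF face_cube[OF z], of i] unfolding rel_corners_def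
      by (intro diff[symmetric]) auto
    also have "\<dots> = (\<Sum>k\<in>G. (h z k - h a k)\<^sup>2) - (\<Sum>k\<in>G. (h z k - flip (p i) (h a) k)\<^sup>2)"
      using h_sum[OF z aface] h_sum[OF z fl[OF i]] p(2)[OF i] by simp
    also have "\<dots> = 2 * \<bar>h z (p i) - h a (p i)\<bar> - 1"
      using h_antipode(1)[OF a] p(1)[OF i] G finite_FG cube_bounds[OF face_cube[OF h_face[OF z]], of "p i"]
      unfolding rel_corners_def by (intro diff) auto
    finally show ?thesis by simp
  qed
  then show thesis using that bij p(2) by blast
qed

end

definition seg :: "(nat \<Rightarrow> real) \<Rightarrow> nat \<Rightarrow> real \<Rightarrow> nat \<Rightarrow> real"
  where "seg x i t = x(i := (1 - t) * x i + t * (1 - x i))"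

lemma seg_0 [simp]: "seg x i 0 = x" and seg_1 [simp]: "seg x i 1 = flip i x"
  unfolding seg_def flip_def by auto

lemma seg_flip: "seg (flip i x) i t = seg x i (1 - t)"
  unfolding seg_def flip_def by (auto simp: algebra_simps)

lemma seg_apply: "seg x i t j = (if j = i then (1 - t) * x i + t * (1 - x i) else x j)"
  unfolding seg_def by simp

lemma seg_cube: "x \<in> cube n \<Longrightarrow> i < n \<Longrightarrow> t \<in> {0..1} \<Longrightarrow> seg x i t \<in> cube n"
  unfolding seg_def using cube_bounds[of x n i] by (intro cube_upd) (auto simp: convex_bound_le)

text \<open>\<open>coordinates\<close> gives each image coordinate up to reflection at 0 or 1, and
  the bounds of the cube decide between the two values.\<close>

lemma (in face_isometry) h_seg:
  assumes a: "a \<in> rel_corners n x F" and i: "i \<in> F" and ji: "h (flip i a) = flip j (h a)" "j \<in> G"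
    and t: "t \<in> {0..1}"
  shows "h (seg a i t) = seg (h a) j t"
proof (rule cube_eqI)
  have af: "a \<in> face n x F" using a unfolding rel_corners_def by auto
  have sf: "seg a i t \<in> face n x F"
    using af seg_cube[of a n i t] i t F unfolding face_def by (auto simp: seg_apply)
  show "h (seg a i t) \<in> cube m" using face_cube[OF h_face[OF sf]] .
  show "seg (h a) j t \<in> cube m" using seg_cube face_cube[OF h_face[OF af]] ji G t by auto
  obtain p where p: "bij_betw p F G" "\<And>i. i \<in> F \<Longrightarrow> h (flip i a) = flip (p i) (h a)"
    "\<And>z i. z \<in> face n x F \<Longrightarrow> i \<in> F \<Longrightarrow> \<bar>h z (p i) - h a (p i)\<bar> = \<bar>z i - a i\<bar>"
    using coordinates[OF a] by blast
  have hc: "h a k = 0 \<or> h a k = 1" if "k \<in> G" for k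
    using h_antipode(1)[OF a] that unfolding rel_corners_def by auto
  have "flip (p i) (h a) j = flip j (h a) j" using p(2)[OF i] ji by simp
  then have "p i = j" using hc[OF ji(2)] unfolding flip_apply by (auto split: if_splits)
  fix k assume k: "k < m"
  show "h (seg a i t) k = seg (h a) j t k"
  proof (cases "k \<in> G")
    case True
    then obtain l where l: "l \<in> F" "p l = k" using p(1) unfolding bij_betw_def by auto
    have 1: "\<bar>h (seg a i t) k - h a k\<bar> = \<bar>seg a i t l - a l\<bar>" using p(3)[OF sf l(1)] l(2) by simp
    have al: "a l = 0 \<or> a l = 1" using a l(1) unfolding rel_corners_def by auto
    have bd: "0 \<le> h (seg a i t) k" "h (seg a i t) k \<le> 1"
      using cube_bounds[OF face_cube[OF h_face[OF sf]] k] by auto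
    show ?thesis
    proof (cases "l = i")
      case True
      then show ?thesis using 1 al hc[OF \<open>k \<in> G\<close>] bd t l \<open>p i = j\<close> unfolding seg_apply by auto
    next
      case False
      then have "k \<noteq> j" using \<open>p i = j\<close> l i p(1) unfolding bij_betw_def inj_on_def by auto
      then show ?thesis using 1 False unfolding seg_apply by auto
    qed
  next
    case False
    then show ?thesis using k ji(2) h_face[OF sf] h_face[OF af] unfolding face_def seg_apply by auto
  qed
qed

section \<open>Links of vertices\<close>

definition clamp01 :: "real \<Rightarrow> real"
  where "clamp01 t = max 0 (min 1 t)"

lemma clamp01_bounds [simp]: "0 \<le> clamp01 t" "clamp01 t \<le> 1"
  and clamp01_id [simp]: "t \<in> {0..1} \<Longrightarrow> clamp01 t = t"
  and clamp01_minus: "clamp01 (1 - t) = 1 - clamp01 t" and clamp01_0 [simp]: "clamp01 0 = 0"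
    and clamp01_1 [simp]: "clamp01 1 = 1"
  unfolding clamp01_def by auto

text \<open>Clamping makes the function determined by its values on the unit interval, so that
  equality of functions is equality of oriented edges, and \<open>reverse\<close> of an edge is
  again of this form.\<close>

definition edge_path :: "('c, 'p) cube_data \<Rightarrow> 'c \<Rightarrow> (nat \<Rightarrow> real) \<Rightarrow> nat \<Rightarrow> real \<Rightarrow> 'p"
  where "edge_path X c x i t = chart X c (seg x i (clamp01 t))"

definition reverse :: "(real \<Rightarrow> 'p) \<Rightarrow> real \<Rightarrow> 'p"
  where "reverse e t = e (1 - t)"

definition spans :: "('c, 'p) cube_data \<Rightarrow> (real \<Rightarrow> 'p) \<Rightarrow> (real \<Rightarrow> 'p) \<Rightarrow> 'c \<Rightarrow> (nat \<Rightarrow> real) \<Rightarrow> nat \<Rightarrow> nat \<Rightarrow> bool"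
  where "spans X e f c x i j \<longleftrightarrow> c \<in> cells X \<and> x \<in> corners (cdim X c) \<and> i < cdim X c \<and> j < cdim X c \<and>
    i \<noteq> j \<and>
    e = edge_path X c x i \<and> f = edge_path X c x j"

definition perp :: "('c, 'p) cube_data \<Rightarrow> (real \<Rightarrow> 'p) \<Rightarrow> (real \<Rightarrow> 'p) \<Rightarrow> bool"
  where "perp X e f \<longleftrightarrow> (\<exists>c x i j. spans X e f c x i j)"

text \<open>The choice is unambiguous by \<open>square_unique\<close>, which rests on simpliciality
  of the links.\<close>

definition transport :: "('c, 'p) cube_data \<Rightarrow> (real \<Rightarrow> 'p) \<Rightarrow> (real \<Rightarrow> 'p) \<Rightarrow> real \<Rightarrow> 'p"
  where "transport X e f = (SOME g. \<exists>c x i j. spans X e f c x i j \<and> g = edge_path X c (flip i x) j)"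

lemma edge_path_0: "edge_path X c x i 0 = chart X c x"
  and edge_path_1: "edge_path X c x i 1 = chart X c (flip i x)"
  unfolding edge_path_def by simp_all

lemma reverse_reverse [simp]: "reverse (reverse e) = e"
  unfolding reverse_def by simp

lemma reverse_edge_path: "reverse (edge_path X c x i) = edge_path X c (flip i x) i"
  by (auto simp: reverse_def edge_path_def clamp01_minus seg_flip)

lemma seg_sum:
  assumes "x \<in> corners n" "i < n"
  shows "(\<Sum>k<n. (seg x i s k - seg x i t k)\<^sup>2) = (s - t)\<^sup>2"
proof -
  have "(\<Sum>k<n. (seg x i s k - seg x i t k)\<^sup>2) = (\<Sum>k<n. if k = i then (s - t)\<^sup>2 else 0)"
    using assms unfolding corners_iff
      by (intro sum.cong) (auto simp: seg_apply power2_eq_square algebra_simps)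
  then show ?thesis using assms(2) by simp
qed

lemma seg_param:
  assumes "x \<in> corners n" "i < n" "t \<in> {0..1}"
  shows "\<bar>seg x i t i - x i\<bar> = t"
proof -
  have "x i = 0 \<or> x i = 1" using assms unfolding corners_iff by auto
  then show ?thesis using assms(3) by (auto simp: seg_apply)
qed

lemma face_edge:
  assumes "x \<in> corners n" "i < n"
  shows "face n x {i} = seg x i ` {0..1}"
proof
  have xi: "x i = 0 \<or> x i = 1" and xc: "x \<in> cube n" using assms unfolding corners_iff by auto
  show "seg x i ` {0..1} \<subseteq> face n x {i}"
    using seg_cube[OF xc assms(2)] unfolding face_def by (auto simp: seg_apply split: if_splits)
  show "face n x {i} \<subseteq> seg x i ` {0..1}"
  proof
    fix z assume z: "z \<in> face n x {i}"
    then have zc: "z \<in> cube n" and off: "\<And>k. k < n \<Longrightarrow> k \<noteq> i \<Longrightarrow> z k = x k" unfolding face_def by auto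
    have t: "\<bar>z i - x i\<bar> \<in> {0..1}" using abs_diff_le_1[OF zc xc assms(2)] by simp
    have "z = seg x i \<bar>z i - x i\<bar>"
      by (rule cube_eqI[OF zc seg_cube[OF xc assms(2) t]])
        (use off xi cube_bounds[OF zc assms(2)] in \<open>auto simp: seg_apply\<close>)
    then show "z \<in> seg x i ` {0..1}" using t by blast
  qed
qed

lemma corner_rel: "x \<in> corners n \<Longrightarrow> F \<subseteq> {..<n} \<Longrightarrow> x \<in> rel_corners n x F"
  unfolding rel_corners_def face_def corners_iff by auto

lemma seg_in_face: "x \<in> face n y F \<Longrightarrow> i \<in> F \<Longrightarrow> F \<subseteq> {..<n} \<Longrightarrow> t \<in> {0..1} \<Longrightarrow> seg x i t \<in> face n y F"
  using seg_cube[of x n i t] unfolding face_def by (auto simp: seg_apply)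

text \<open>The vertex of the link at \<open>v\<close> that belongs to the oriented edge
  \<open>e\<close>.\<close>

definition edge_class :: "('c, 'p) cube_data \<Rightarrow> 'p \<Rightarrow> (real \<Rightarrow> 'p) \<Rightarrow> 'c cube_corner set"
  where "edge_class X v e = {(d, y, {j}) | d y j. (d, y, {j}) \<in> link_corners X v \<and> edge_path X d y j =
    e}"

lemma link_corner_iff:
  "(c, x, F) \<in> link_corners X v \<longleftrightarrow> c \<in> cells X \<and> x \<in> corners (cdim X c) \<and> F \<subseteq> {..<cdim X c} \<and> F \<noteq> {} \<and>
    chart X c x = v"
  unfolding link_corners_def by auto

lemma link_rel_isometry:
  assumes "((c, x, F), (d, y, G)) \<in> link_rel X v"
  obtains h where "face_isometry (cdim X c) x F (cdim X d) y G h" "h x = y"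
    "\<And>z. z \<in> face (cdim X c) x F \<Longrightarrow> chart X c z = chart X d (h z)"
proof -
  obtain h where h: "cube_isometry (cdim X c) (face (cdim X c) x F) (cdim X d) (face (cdim X d) y G) h"
    "h x = y" "\<And>z. z \<in> face (cdim X c) x F \<Longrightarrow> chart X c z = chart X d (h z)"
    "(c, x, F) \<in> link_corners X v" "(d, y, G) \<in> link_corners X v"
    using assms unfolding link_rel_def by auto
  then have "face_isometry (cdim X c) x F (cdim X d) y G h"
    unfolding link_corner_iff by unfold_locales (auto simp: corners_cube)
  then show thesis using that h by blast
qed

text \<open>An isometry between two edges that matches their starts preserves the parameter. A
  vertex of the link is therefore the same as an oriented edge out of \<open>v\<close>.\<close>

lemma link_rel_edge:
  assumes "(c, x, {i}) \<in> link_corners X v"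
  shows "link_rel X v `` {(c, x, {i})} = edge_class X v (edge_path X c x i)"
proof (intro set_eqI iffI)
  have cx: "c \<in> cells X" "x \<in> corners (cdim X c)" "i < cdim X c" "chart X c x = v"
    using assms unfolding link_corner_iff by auto
  fix \<tau>
  {
    assume "\<tau> \<in> link_rel X v `` {(c, x, {i})}"
    then obtain d y G where \<tau>: "\<tau> = (d, y, G)" "((c, x, {i}), (d, y, G)) \<in> link_rel X v"
      by (cases \<tau>) auto
    obtain h where h: "face_isometry (cdim X c) x {i} (cdim X d) y G h" "h x = y"
      "\<And>z. z \<in> face (cdim X c) x {i} \<Longrightarrow> chart X c z = chart X d (h z)"
      using link_rel_isometry[OF \<tau>(2)] by blast
    interpret face_isometry "cdim X c" x "{i}" "cdim X d" y G h by (rule h(1))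
    have x0: "x \<in> rel_corners (cdim X c) x {i}" using corner_rel cx by auto
    obtain j where j: "G = {j}" using card_eq
      by (metis card_1_singletonE card.empty card.insert empty_iff finite.emptyI One_nat_def)
    have fl: "h (flip i x) = flip j (h x)" using h_flip[OF x0, of i] j by auto
    have "edge_path X d y j t = edge_path X c x i t" for t
      using h_seg[OF x0 _ fl, of "clamp01 t"] h(3)[of "seg x i (clamp01 t)"] h(2) j face_edge[OF cx(2,3)]
      unfolding edge_path_def by auto
    then have "edge_path X d y j = edge_path X c x i" by blast
    moreover have "(d, y, G) \<in> link_corners X v" using \<tau>(2) unfolding link_rel_def by auto
    ultimately show "\<tau> \<in> edge_class X v (edge_path X c x i)" unfolding edge_class_def using \<tau>(1) j
      by blast
  }
  assume "\<tau> \<in> edge_class X v (edge_path X c x i)"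
  then obtain d y j where \<tau>: "\<tau> = (d, y, {j})" "(d, y, {j}) \<in> link_corners X v"
    "edge_path X d y j = edge_path X c x i"
    unfolding edge_class_def by blast
  then have dy: "d \<in> cells X" "y \<in> corners (cdim X d)" "j < cdim X d" "chart X d y = v"
    unfolding link_corner_iff by auto
  \<comment> \<open>The parameter of a point of the first edge is its distance from \<open>x\<close>
    in coordinate \<open>i\<close>.\<close>
  define h where "h z = seg y j \<bar>z i - x i\<bar>" for z
  have hs: "h (seg x i t) = seg y j t" if "t \<in> {0..1}" for t
    using seg_param[OF cx(2,3) that] unfolding h_def by simp
  have inj: "s = t" if "seg y j s = seg y j t" "s \<in> {0..1}" "t \<in> {0..1}" for s t
    using seg_param[OF dy(2,3)] that by metis
  have "bij_betw h (seg x i ` {0..1}) (seg y j ` {0..1})"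
    unfolding bij_betw_def
  proof
    show "inj_on h (seg x i ` {0..1})"
      by (intro inj_onI) (use hs inj in \<open>auto, metis atLeastAtMost_iff\<close>)
    show "h ` seg x i ` {0..1} = seg y j ` {0..1}" 
      unfolding image_image using hs by (intro image_cong) auto
  qed
  moreover have "cube_dist (cdim X d) (h z) (h w) = cube_dist (cdim X c) z w"
    if "z \<in> seg x i ` {0..1}" "w \<in> seg x i ` {0..1}" for z w
    using that hs seg_sum[OF cx(2,3)] seg_sum[OF dy(2,3)] unfolding cube_dist_eq_iff by auto
  ultimately have "cube_isometry (cdim X c) (face (cdim X c) x {i}) (cdim X d) (face (cdim X d) y {j}) h"
    unfolding cube_isometry_def face_edge[OF cx(2,3)] face_edge[OF dy(2,3)] by blast
  moreover have "h x = y" unfolding h_def by simp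
  moreover have "chart X c z = chart X d (h z)" if z: "z \<in> face (cdim X c) x {i}" for z
  proof -
    obtain t where t: "t \<in> {0..1}" "z = seg x i t" using z unfolding face_edge[OF cx(2,3)] by blast
    have "edge_path X d y j t = edge_path X c x i t" using \<tau>(3) by simp
    then show ?thesis using hs t unfolding edge_path_def by simp
  qed
  ultimately show "\<tau> \<in> link_rel X v `` {(c, x, {i})}"
    using assms \<tau>(1,2) unfolding link_rel_def by auto
qed

lemma simplex_vertices_eq:
  assumes "(c, x, F) \<in> link_corners X v"
  shows "simplex_vertices X v (c, x, F) = edge_class X v ` edge_path X c x ` F"
proof -
  have "link_rel X v `` {(c, x, {i})} = edge_class X v (edge_path X c x i)" if "i \<in> F" for i
    using assms that by (intro link_rel_edge) (auto simp: link_corner_iff)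
  then show ?thesis by (auto simp: image_image)
qed

lemma edge_class_inject:
  assumes "(c, x, {i}) \<in> link_corners X v" "edge_class X v (edge_path X c x i) = edge_class X v e"
  shows "edge_path X c x i = e"
proof -
  have "(c, x, {i}) \<in> edge_class X v (edge_path X c x i)" using assms(1) unfolding edge_class_def
    by blast
  then show ?thesis unfolding assms(2) unfolding edge_class_def by auto
qed

section \<open>Squares and cubes obtained from flag links\<close>

locale flag_links =
  fixes X :: "('c, 'p) cube_data"
  assumes flag: "v \<in> vertices X \<Longrightarrow> link_flag X v"
begin

lemma vertexI: "c \<in> cells X \<Longrightarrow> x \<in> corners (cdim X c) \<Longrightarrow> chart X c x \<in> vertices X"
  unfolding vertices_def by blast

lemma simplicial: "c \<in> cells X \<Longrightarrow> x \<in> corners (cdim X c) \<Longrightarrow> link_simplicial X (chart X c x)"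
  using flag[OF vertexI] unfolding link_flag_def by blast

text \<open>The vertices of a simplex in a simplicial link are distinct, so two sides of a cube at
  one corner are never glued to each other starting from that corner.\<close>

lemma edge_path_inject:
  assumes "c \<in> cells X" "x \<in> corners (cdim X c)" "i < cdim X c" "j < cdim X c"
    "edge_path X c x i = edge_path X c x j"
  shows "i = j"
proof -
  let ?v = "chart X c x"
  have "(c, x, {i, j}) \<in> link_corners X ?v" and ij: "(c, x, {i}) \<in> link_corners X ?v"
    "(c, x, {j}) \<in> link_corners X ?v"
    using assms by (auto simp: link_corner_iff)
  then have "inj_on (\<lambda>i. link_rel X ?v `` {(c, x, {i})}) {i, j}"
    using simplicial[OF assms(1,2)] unfolding link_simplicial_def by blast
  then show ?thesis
    by (rule inj_onD) (simp_all only: link_rel_edge[OF ij(1)] link_rel_edge[OF ij(2)] assms(5) insert_iff simp_thms)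
qed

text \<open>Two squares on the same pair of edges give simplices of the link with the same vertices.
  Simpliciality supplies an isometry between the squares, and \<open>edge_path_inject\<close> forces
  it to match the sides in order.\<close>

lemma square_unique:
  assumes "spans X e f c x i j" "spans X e f d y k l"
  shows "edge_path X c (flip i x) j = edge_path X d (flip k y) l"
proof -
  note 1 = assms(1)[unfolded spans_def] and 2 = assms(2)[unfolded spans_def]
  let ?n = "cdim X c" and ?m = "cdim X d"
  define v where "v = chart X c x"
  have "edge_path X c x i 0 = edge_path X d y k 0" using 1 2 by simp
  then have v: "chart X c x = v" "chart X d y = v" unfolding v_def edge_path_0 by auto
  have lc: "(c, x, {i, j}) \<in> link_corners X v" "(d, y, {k, l}) \<in> link_corners X v"
    using 1 2 v by (auto simp: link_corner_iff)
  have "simplex_vertices X v (c, x, {i, j}) = simplex_vertices X v (d, y, {k, l})"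
    unfolding simplex_vertices_eq[OF lc(1)] simplex_vertices_eq[OF lc(2)] using 1 2 by auto
  then have "((c, x, {i, j}), (d, y, {k, l})) \<in> link_rel X v"
    using simplicial[of c x] lc 1 unfolding link_simplicial_def v_def by blast
  then obtain h where h: "face_isometry ?n x {i, j} ?m y {k, l} h" "h x = y"
    "\<And>z. z \<in> face ?n x {i, j} \<Longrightarrow> chart X c z = chart X d (h z)"
    by (rule link_rel_isometry) (rule that; simp)
  interpret face_isometry ?n x "{i, j}" ?m y "{k, l}" h by (rule h(1))
  have x0: "x \<in> rel_corners ?n x {i, j}" using corner_rel 1 by auto
  have ep: "edge_path X c a i' = edge_path X d (h a) k'"
    if "a \<in> rel_corners ?n x {i, j}" "i' \<in> {i, j}" "h (flip i' a) = flip k' (h a)" "k' \<in> {k, l}"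
      for a i' k'
  proof
    fix t
    have "seg a i' (clamp01 t) \<in> face ?n x {i, j}"
      using that F unfolding rel_corners_def by (intro seg_in_face) auto
    then show "edge_path X c a i' t = edge_path X d (h a) k' t"
      unfolding edge_path_def using h_seg[OF that, of "clamp01 t"] h(3) by simp
  qed
  obtain k' where k': "k' \<in> {k, l}" "h (flip i x) = flip k' (h x)" using h_flip[OF x0, of i] by auto
  have "edge_path X d y k = edge_path X d y k'" using ep[OF x0 _ k'(2,1)] h(2) 1 2 by auto
  then have "k = k'" using edge_path_inject 2 k'(1) by blast
  have x1: "flip i x \<in> rel_corners ?n x {i, j}" using flip_rel_corners[OF x0 F] by simp
  have hx1: "h (flip i x) = flip k y" using k'(2) \<open>k = k'\<close> h(2) by simp
  obtain l' where l': "l' \<in> {k, l}" "h (flip j (flip i x)) = flip l' (h (flip i x))"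
    using h_flip[OF x1, of j] by auto
  \<comment> \<open>Otherwise \<open>h\<close> would send the opposite corner of the square to the
    image of \<open>x\<close>.\<close>
  have "l' \<noteq> k"
  proof
    assume "l' = k"
    then have "h (flip j (flip i x)) = h x" using l'(2) hx1 h(2) by simp
    moreover have "flip j (flip i x) \<in> face ?n x {i, j}" "x \<in> face ?n x {i, j}"
      using flip_rel_corners[OF x1 F, of j] x0 unfolding rel_corners_def by auto
    ultimately have "flip j (flip i x) = x" using iso
      unfolding cube_isometry_def bij_betw_def inj_on_def by blast
    then have "flip j (flip i x) i = x i" by simp
    moreover have "x i = 0 \<or> x i = 1" using 1 unfolding corners_iff by auto
    ultimately show False using 1 by (auto simp: flip_apply)
  qed
  then have "l' = l" using l'(1) by simp
  then show ?thesis using ep[OF x1 _ l'(2,1)] hx1 by simp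
qed

lemma transport_eq:
  assumes "spans X e f c x i j"
  shows "transport X e f = edge_path X c (flip i x) j"
proof -
  have "\<exists>c x i j. spans X e f c x i j \<and> transport X e f = edge_path X c (flip i x) j"
    unfolding transport_def
    by (rule someI[of "\<lambda>g. \<exists>c x i j. spans X e f c x i j \<and> g =
      edge_path X c (flip i x) j"]) (use assms in blast)
  then show ?thesis using square_unique assms by metis
qed

lemma spans_commute: "spans X e f c x i j \<Longrightarrow> spans X f e c x j i"
  unfolding spans_def by auto

lemma spans_reverse: "spans X e f c x i j \<Longrightarrow> spans X (reverse e) (transport X e f) c (flip i x) i j"
  using transport_eq[of e f c x i j] flip_corners[of x "cdim X c" i]
    unfolding spans_def reverse_edge_path
  by (auto simp: reverse_edge_path)

text \<open>Here the flag condition on the links enters.\<close>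

lemma cube_of_perp:
  assumes Z: "finite Z" "e0 \<in> Z" and e0: "\<And>e. e \<in> Z \<Longrightarrow> e 0 = e0 0"
    and edge: "\<And>e. e \<in> Z \<Longrightarrow> \<exists>c x i. c \<in> cells X \<and> x \<in> corners (cdim X c) \<and> i < cdim X c \<and> e =
      edge_path X c x i"
    and perp: "\<And>e f. e \<in> Z \<Longrightarrow> f \<in> Z \<Longrightarrow> e \<noteq> f \<Longrightarrow> perp X e f"
  obtains c x F where "c \<in> cells X" "x \<in> corners (cdim X c)" "F \<subseteq> {..<cdim X c}"
    "Z = edge_path X c x ` F"
proof -
  define v where "v = e0 0"
  have rep: "\<exists>c x i. (c, x, {i}) \<in> link_corners X v \<and> e = edge_path X c x i" if "e \<in> Z" for e
    using edge[OF that] e0[OF that] edge_path_0 unfolding v_def link_corner_iff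
      by (metis empty_not_insert empty_subsetI insert_subset lessThan_iff)
  have vV: "v \<in> vertices X" using rep[OF Z(2)] vertexI unfolding link_corner_iff by blast
  let ?S = "edge_class X v ` Z"
  have pair: "{edge_class X v e, edge_class X v f} \<in> link_complex X v" if ef: "e \<in> Z" "f \<in> Z"
    for e f
  proof -
    have "\<exists>c x F. (c, x, F) \<in> link_corners X v \<and> edge_path X c x ` F = {e, f}"
    proof (cases "e = f")
      case True
      then show ?thesis using rep[OF ef(1)] by (metis image_empty image_insert insert_absorb2)
    next
      case False
      then obtain c x i j where s: "spans X e f c x i j" using perp[OF ef] unfolding perp_def
        by blast
      then have "chart X c x = v" using e0[OF ef(1)] edge_path_0 unfolding spans_def v_def by metis
      then have "(c, x, {i, j}) \<in> link_corners X v \<and> edge_path X c x ` {i, j} = {e, f}"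
        using s unfolding spans_def link_corner_iff by auto
      then show ?thesis by blast
    qed
    then obtain c x F where F: "(c, x, F) \<in> link_corners X v" "edge_path X c x ` F = {e, f}"
      by blast
    then have "simplex_vertices X v (c, x, F) = {edge_class X v e, edge_class X v f}"
      unfolding simplex_vertices_eq[OF F(1)] by simp
    then show ?thesis unfolding link_complex_def using F(1) by (metis imageI)
  qed
  have "Defs.flag (link_complex X v)" using flag[OF vV] unfolding link_flag_def by blast
  moreover have "finite ?S" "?S \<noteq> {}" "\<forall>s\<in>?S. \<forall>t\<in>?S. {s, t} \<in> link_complex X v" using Z pair by auto
  ultimately have "?S \<in> link_complex X v" unfolding Defs.flag_def by blast
  then obtain \<sigma> where \<sigma>: "\<sigma> \<in> link_corners X v" "?S = simplex_vertices X v \<sigma>"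
    unfolding link_complex_def by blast
  obtain c x F where cxF: "\<sigma> = (c, x, F)" by (cases \<sigma>)
  have lc: "(c, x, F) \<in> link_corners X v" "?S = edge_class X v ` edge_path X c x ` F"
    using \<sigma>(1) trans[OF \<sigma>(2)[unfolded cxF] simplex_vertices_eq[OF \<sigma>(1)[unfolded cxF]]] unfolding cxF
      by blast+
  \<comment> \<open>Different edges give different vertices of the link, so equality of vertex sets
    descends to sets of edges.\<close>
  have inj: "e = f" if "e \<in> Z \<union> edge_path X c x ` F" "edge_class X v e = edge_class X v f" for e f
  proof -
    have "(c, x, {i}) \<in> link_corners X v" if "i \<in> F" for i
      using lc(1) that unfolding link_corner_iff by auto
    then have "\<exists>c x i. (c, x, {i}) \<in> link_corners X v \<and> e = edge_path X c x i"
      using that(1) rep by (metis UnE image_iff)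
    then show ?thesis using edge_class_inject that(2) by metis
  qed
  have "Z \<subseteq> edge_path X c x ` F"
  proof
    fix e assume "e \<in> Z"
    then have "edge_class X v e \<in> edge_class X v ` edge_path X c x ` F" using lc(2) by blast
    then show "e \<in> edge_path X c x ` F" using inj \<open>e \<in> Z\<close> by blast
  qed
  moreover have "edge_path X c x ` F \<subseteq> Z"
  proof
    fix e assume e: "e \<in> edge_path X c x ` F"
    then have "edge_class X v e \<in> edge_class X v ` Z" using lc(2) by blast
    then show "e \<in> Z" using inj e by blast
  qed
  ultimately have "Z = edge_path X c x ` F" by (rule subset_antisym)
  then show thesis using that lc(1) unfolding link_corner_iff by blast
qed

lemma perp_0: "perp X e f \<Longrightarrow> e 0 = f 0"
  unfolding perp_def spans_def by (auto simp: edge_path_0)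

lemma not_perp_self: "\<not> perp X e e"
  using edge_path_inject unfolding perp_def spans_def by metis

lemma perp_edge: "perp X e f \<Longrightarrow> \<exists>c x i. c \<in> cells X \<and> x \<in> corners (cdim X c) \<and> i < cdim X c \<and> e =
  edge_path X c x i"
  unfolding perp_def spans_def by blast

lemma perp_commute: "perp X e f \<Longrightarrow> perp X f e"
  unfolding perp_def using spans_commute by blast

text \<open>Three pairwise adjacent vertices of a flag link span a triangle.\<close>

lemma perp_cube:
  assumes "perp X e f" "perp X e g" "perp X f g"
  obtains c x i j k where "spans X e f c x i j" "spans X e g c x i k" "spans X f g c x j k"
proof -
  have "\<exists>c x F. c \<in> cells X \<and> x \<in> corners (cdim X c) \<and> F \<subseteq> {..<cdim X c} \<and> {e, f, g} =
    edge_path X c x ` F"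
  proof (rule cube_of_perp[of "{e, f, g}" e])
    show "\<And>a. a \<in> {e, f, g} \<Longrightarrow> a 0 = e 0" using perp_0[OF assms(1)] perp_0[OF assms(2)] by auto
    show "\<And>a. a \<in> {e, f, g} \<Longrightarrow> \<exists>c x i. c \<in> cells X \<and> x \<in> corners (cdim X c) \<and> i < cdim X c \<and> a =
      edge_path X c x i"
      using perp_edge[OF assms(1)] perp_edge[OF assms(3)] perp_edge[OF perp_commute[OF assms(2)]]
        by blast
    show "\<And>a b. a \<in> {e, f, g} \<Longrightarrow> b \<in> {e, f, g} \<Longrightarrow> a \<noteq> b \<Longrightarrow> perp X a b"
      using assms perp_commute by blast
  qed auto
  then obtain c x F where cx: "c \<in> cells X" "x \<in> corners (cdim X c)" "F \<subseteq> {..<cdim X c}"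
    "{e, f, g} = edge_path X c x ` F"
    by blast
  then have "e \<in> edge_path X c x ` F" "f \<in> edge_path X c x ` F" "g \<in> edge_path X c x ` F" by auto
  then obtain i j k where ijk: "i \<in> F" "e = edge_path X c x i" "j \<in> F" "f = edge_path X c x j"
    "k \<in> F" "g = edge_path X c x k"
    by blast
  have "e \<noteq> f" "e \<noteq> g" "f \<noteq> g" using assms not_perp_self by auto
  then have "spans X e f c x i j" "spans X e g c x i k" "spans X f g c x j k" using ijk cx
    unfolding spans_def by auto
  then show thesis using that by blast
qed

text \<open>The axioms are read off inside one square or one 3-cube by flipping coordinates. Those
  on two edges rest on simpliciality of the links, those on three edges also on flagness.\<close>

sublocale edge_system reverse "perp X" "transport X"
proof
  fix e f g :: "real \<Rightarrow> 'p"
  show "reverse (reverse e) = e" by simp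
  show "perp X f e" if "perp X e f" using perp_commute that .
  show "\<not> perp X e e" by (rule not_perp_self)
  show "perp X (reverse e) (transport X e f)" if "perp X e f"
    using that spans_reverse unfolding perp_def by blast
  show "transport X (reverse e) (transport X e f) = f" if "perp X e f"
  proof -
    obtain c x i j where s: "spans X e f c x i j" using \<open>perp X e f\<close> unfolding perp_def by blast
    show ?thesis using transport_eq[OF spans_reverse[OF s]] s unfolding spans_def by simp
  qed
  show "transport X (transport X e f) (reverse e) = reverse (transport X f e)" if "perp X e f"
  proof -
    obtain c x i j where s: "spans X e f c x i j" using \<open>perp X e f\<close> unfolding perp_def by blast
    show ?thesis
      using transport_eq[OF spans_commute[OF spans_reverse[OF s]]] transport_eq[OF spans_commute[OF s]]
      by (simp add: reverse_edge_path flip_commute)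
  qed
  assume efg: "perp X e f" "perp X e g" "perp X f g"
  then obtain c x i j k where s: "spans X e f c x i j" "spans X e g c x i k" "spans X f g c x j k"
    using perp_cube by metis
  have 1: "spans X (transport X e f) (transport X e g) c (flip i x) j k"
    using s flip_corners[of x "cdim X c" i] transport_eq[OF s(1)] transport_eq[OF s(2)]
      unfolding spans_def by auto
  then show "perp X (transport X e f) (transport X e g)" unfolding perp_def by blast
  have "spans X (transport X f e) (transport X f g) c (flip j x) i k"
    using s flip_corners[of x "cdim X c" j] transport_eq[OF spans_commute[OF s(1)]] transport_eq[OF s(3)] unfolding spans_def by auto
  then show "transport X (transport X e f) (transport X e g) =
    transport X (transport X f e) (transport X f g)"
    using transport_eq[OF 1] transport_eq by (simp add: flip_commute)
qed

end

section \<open>Gluing isometries\<close>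

lemma cube_dist_refl [simp]: "cube_dist n z z = 0"
  unfolding cube_dist_def L2_set_def by simp

lemma cube_dist_sym: "cube_dist n z w = cube_dist n w z"
  unfolding cube_dist_def L2_set_def by (simp add: power2_commute)

lemma cube_dist_tri: "cube_dist n x z \<le> cube_dist n x y + cube_dist n y z"
  using L2_set_triangle_ineq[of "\<lambda>i. x i - y i" "\<lambda>i. y i - z i" "{..<n}"] unfolding cube_dist_def
    by simp

lemma cube_dist_coord: "i < n \<Longrightarrow> \<bar>z i - w i\<bar> \<le> cube_dist n z w"
  using member_le_L2_set[of "{..<n}" i "\<lambda>i. \<bar>z i - w i\<bar>"] unfolding cube_dist_def L2_set_def by simp

section \<open>Carrier faces of points and their stability\<close>

definition interior_dirs :: "nat \<Rightarrow> (nat \<Rightarrow> real) \<Rightarrow> nat set"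
  where "interior_dirs n z = {i. i < n \<and> 0 < z i \<and> z i < 1}"

abbreviation verts :: "nat \<Rightarrow> (nat \<Rightarrow> real) \<Rightarrow> (nat \<Rightarrow> real) set"
  where "verts n z \<equiv> rel_corners n z (interior_dirs n z)"

lemma support_face: "support n z = face n z (interior_dirs n z)"
  unfolding support_def interior_dirs_def ..

lemma interior_sub: "interior_dirs n z \<subseteq> {..<n}"
  unfolding interior_dirs_def by auto

lemma boundary_coord: "z \<in> cube n \<Longrightarrow> i < n \<Longrightarrow> i \<notin> interior_dirs n z \<Longrightarrow> z i = 0 \<or> z i = 1"
  using cube_bounds[of z n i] unfolding interior_dirs_def by auto

lemma support_self: "z \<in> cube n \<Longrightarrow> z \<in> support n z"
  unfolding support_face face_def by auto

lemma support_cube: "y \<in> support n z \<Longrightarrow> y \<in> cube n"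
  unfolding support_face face_def by auto

lemma support_interior: "z \<in> cube n \<Longrightarrow> y \<in> support n z \<Longrightarrow> interior_dirs n y \<subseteq> interior_dirs n z"
  using boundary_coord[of z n] unfolding support_face face_def interior_dirs_def by fastforce

lemma verts_corners: "z \<in> cube n \<Longrightarrow> u \<in> verts n z \<Longrightarrow> u \<in> corners n"
  using boundary_coord[of z n] unfolding rel_corners_def face_def corners_iff by force

lemma verts_sub:
  assumes z: "z \<in> cube n" and y: "y \<in> support n z"
  shows "verts n y \<subseteq> verts n z" "support n y \<subseteq> support n z"
proof -
  have yc: "y \<in> cube n" using support_cube[OF y] .
  have "u i = z i" if "u \<in> support n y" "i < n" "i \<notin> interior_dirs n z" for u i
  proof -
    have "i \<notin> interior_dirs n y" using that(3) support_interior[OF z y] by blast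
    then show ?thesis using that y unfolding support_face face_def by simp
  qed
  then show s: "support n y \<subseteq> support n z" using support_cube
    unfolding support_face[of n z] face_def by blast
  show "verts n y \<subseteq> verts n z"
  proof
    fix u assume u: "u \<in> verts n y"
    then have "u \<in> support n y" unfolding support_face rel_corners_def by auto
    then have "u \<in> face n z (interior_dirs n z)" using s unfolding support_face by auto
    then show "u \<in> verts n z"
      using verts_corners[OF yc u] interior_sub[of n z] unfolding rel_corners_def corners_iff
        by auto
  qed
qed

lemma verts_nonempty: "z \<in> cube n \<Longrightarrow> \<exists>u. u \<in> verts n z"
  using rel_corners_nonempty[OF _ interior_sub] by blast

lemma verts_corner: "x \<in> corners n \<Longrightarrow> verts n x = {x}"
proof -
  assume x: "x \<in> corners n"
  then have "interior_dirs n x = {}" unfolding interior_dirs_def corners_iff by auto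
  then show ?thesis using x unfolding rel_corners_def face_def corners_iff by (auto intro: cube_eqI)
qed

text \<open>The corners of a face are connected by flips; the induction is on the number of
  coordinates in which two of them differ.\<close>

lemma rel_corners_induct:
  assumes "F \<subseteq> {..<n}" and v: "v \<in> rel_corners n x F" and u: "u \<in> rel_corners n x F" "P u"
    and step: "\<And>a i. a \<in> rel_corners n x F \<Longrightarrow> i \<in> F \<Longrightarrow> P a \<Longrightarrow> P (flip i a)"
  shows "P v"
  using u
proof (induction "card {i \<in> F. u i \<noteq> v i}" arbitrary: u)
  case 0
  have "finite F" using assms(1) finite_subset by blast
  then have "u i = v i" if "i \<in> F" for i using 0(1) that by auto
  moreover have "u i = v i" if "i < n" "i \<notin> F" for i using 0(2) v that
    unfolding rel_corners_def face_def by simp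
  moreover have "u \<in> cube n" "v \<in> cube n" using 0(2) v unfolding rel_corners_def face_def by auto
  ultimately have "u = v" using cube_eqI by blast
  then show ?case using 0 by simp
next
  case (Suc k)
  then obtain i where i: "i \<in> F" "u i \<noteq> v i"
    by (metis (mono_tags, lifting) card.empty empty_Collect_eq nat.distinct(1))
  have "finite F" using assms(1) finite_subset by blast
  have "u i = 0 \<or> u i = 1" "v i = 0 \<or> v i = 1" using i(1) Suc(3) v unfolding rel_corners_def
    by blast+
  then have "flip i u i = v i" using i(2) unfolding flip_apply by auto
  then have "{j \<in> F. flip i u j \<noteq> v j} = {j \<in> F. u j \<noteq> v j} - {i}" by (auto simp: flip_apply)
  then have "k = card {j \<in> F. flip i u j \<noteq> v j}" using Suc(2) i \<open>finite F\<close> by simp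
  then show ?case
    using Suc(1)[of "flip i u"] flip_rel_corners[OF Suc(3) assms(1) i(1)] step[OF Suc(3) i(1) Suc(4)] by blast
qed

text \<open>This margin keeps the interior directions of \<open>z\<close> interior at all nearby
  points.\<close>

definition clear :: "nat \<Rightarrow> real \<Rightarrow> (nat \<Rightarrow> real) \<Rightarrow> bool"
  where "clear n \<delta> z \<longleftrightarrow> (\<forall>i\<in>interior_dirs n z. \<delta> \<le> z i \<and> z i \<le> 1 - \<delta>)"

lemma near_interior:
  assumes "z \<in> cube n" "w \<in> cube n" "clear n (4 * e) z" "cube_dist n z w < 2 * e" "e > 0"
  shows "interior_dirs n z \<subseteq> interior_dirs n w"
proof
  fix i assume i: "i \<in> interior_dirs n z"
  then have "\<bar>z i - w i\<bar> < 2 * e" using cube_dist_coord[of i n z w] assms(4)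
    unfolding interior_dirs_def by simp
  moreover have "4 * e \<le> z i" "z i \<le> 1 - 4 * e" using i assms(3) unfolding clear_def by auto
  ultimately show "i \<in> interior_dirs n w" using i assms(5) unfolding interior_dirs_def by auto
qed

lemma near_boundary:
  assumes "z \<in> cube n" "w \<in> cube n" "cube_dist n z w < 1" "i < n" "i \<notin> interior_dirs n z"
    "i \<notin> interior_dirs n w"
  shows "z i = w i"
  using boundary_coord[of z n i] boundary_coord[of w n i] cube_dist_coord[of i n z w] assms by auto

text \<open>A nearby \<open>w\<close> can only gain interior directions, and a coordinate that is 0
  or 1 at both points cannot jump.\<close>

lemma near_support:
  assumes "z \<in> cube n" "w \<in> cube n" "clear n (4 * e) z" "cube_dist n z w < e" "e > 0" "e < 1/4"
  shows "z \<in> support n w"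
proof -
  have "interior_dirs n z \<subseteq> interior_dirs n w" using near_interior[OF assms(1-3)] assms by simp
  then show ?thesis using near_boundary[OF assms(1,2)] assms unfolding support_face face_def by auto
qed

lemma near_same_support:
  assumes "z \<in> cube n" "w \<in> cube n" "clear n (4 * e) z" "clear n (4 * e) w"
    "cube_dist n z w < 2 * e" "e > 0" "e < 1/4"
  shows "support n z = support n w"
proof -
  have eq: "interior_dirs n z = interior_dirs n w"
    using near_interior[OF assms(1-3,5,6)] near_interior[OF assms(2,1,4)] assms cube_dist_sym
      by auto
  then have "z i = w i" if "i \<in> {..<n} - interior_dirs n z" for i
    using near_boundary[OF assms(1,2)] assms that by auto
  then show ?thesis unfolding support_face face_def eq by auto
qed

locale cube_cx =
  fixes X :: "('c, 'p) cube_data"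
  assumes cx: "cube_complex X"
begin

abbreviation "dm \<equiv> cdim X"
abbreviation "ch \<equiv> chart X"

text \<open>The condition \<open>h z = w\<close> is not part of the definition of a cube complex;
  \<open>glue_exists\<close> derives it.\<close>

definition glue :: "'c \<Rightarrow> (nat \<Rightarrow> real) \<Rightarrow> 'c \<Rightarrow> (nat \<Rightarrow> real) \<Rightarrow> ((nat \<Rightarrow> real) \<Rightarrow> nat \<Rightarrow> real) \<Rightarrow> bool"
  where "glue c z d w h \<longleftrightarrow> c \<in> cells X \<and> d \<in> cells X \<and> z \<in> cube (dm c) \<and> w \<in> cube (dm d) \<and>
    cube_isometry (dm c) (support (dm c) z) (dm d) (support (dm d) w) h \<and> h z = w \<and>
    (\<forall>y\<in>support (dm c) z. ch c y = ch d (h y))"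

lemma chart_inj:
  "c \<in> cells X \<Longrightarrow> z \<in> cube (dm c) \<Longrightarrow> w \<in> cube (dm c) \<Longrightarrow> support (dm c) z = support (dm c) w \<Longrightarrow>
    ch c z = ch c w \<Longrightarrow> z = w"
  using cx unfolding cube_complex_def by blast

lemma glue_isometry: "glue c z d w h \<Longrightarrow> face_isometry (dm c) z (interior_dirs (dm c) z) (dm d) w (interior_dirs (dm d) w) h"
  unfolding glue_def support_face by unfold_locales (auto simp: interior_dirs_def)

text \<open>A signed permutation of coordinates preserves which coordinates lie strictly between 0
  and 1.\<close>

lemma isometry_interior:
  assumes "face_isometry n z (interior_dirs n z) m w (interior_dirs m w) h" "y \<in> support n z"
    and a: "a \<in> verts n z"
    and p: "bij_betw p (interior_dirs n z) (interior_dirs m w)"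
      "\<And>z' i. z' \<in> face n z (interior_dirs n z) \<Longrightarrow> i \<in> interior_dirs n z \<Longrightarrow> \<bar>h z' (p i) - h a (p i)\<bar> =
        \<bar>z' i - a i\<bar>"
  shows "interior_dirs m (h y) = p ` interior_dirs n y"
proof -
  interpret face_isometry n z "interior_dirs n z" m w "interior_dirs m w" h by (rule assms(1))
  have hy: "h y \<in> support m w" using h_face assms(2) unfolding support_face by blast
  have sub: "interior_dirs n y \<subseteq> interior_dirs n z" "interior_dirs m (h y) \<subseteq> interior_dirs m w"
    using support_interior[OF x assms(2)] support_interior[OF y hy] by auto
  have "i \<in> interior_dirs n y \<longleftrightarrow> p i \<in> interior_dirs m (h y)" if i: "i \<in> interior_dirs n z" for i
  proof -
    have pi: "p i \<in> interior_dirs m w" using p(1) i unfolding bij_betw_def by blast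
    have "\<bar>h y (p i) - h a (p i)\<bar> = \<bar>y i - a i\<bar>" using p(2) assms(2) i unfolding support_face
      by blast
    moreover have "a i = 0 \<or> a i = 1" "h a (p i) = 0 \<or> h a (p i) = 1"
      using a h_antipode(1)[OF a] i pi unfolding rel_corners_def by auto
    moreover have "i < n" "p i < m" using i pi unfolding interior_dirs_def by auto
    moreover have "0 \<le> y i \<and> y i \<le> 1" "0 \<le> h y (p i) \<and> h y (p i) \<le> 1"
      using cube_bounds support_cube assms(2) hy \<open>i < n\<close> \<open>p i < m\<close> by blast+
    ultimately show ?thesis unfolding interior_dirs_def by auto
  qed
  note iff = this
  have im: "interior_dirs m w = p ` interior_dirs n z" using p(1) unfolding bij_betw_def by simp
  show ?thesis
  proof (intro subset_antisym subsetI)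
    fix j assume j: "j \<in> interior_dirs m (h y)"
    then obtain i where i: "i \<in> interior_dirs n z" "j = p i" using sub(2) im by blast
    then show "j \<in> p ` interior_dirs n y" using iff[OF i(1)] j by simp
  next
    fix j assume "j \<in> p ` interior_dirs n y"
    then obtain i where i: "i \<in> interior_dirs n y" "j = p i" by blast
    then show "j \<in> interior_dirs m (h y)" using iff[of i] sub(1) by blast
  qed
qed

text \<open>The points \<open>h z\<close> and \<open>w\<close> lie in the interior of the same face
  and have the same image, and charts are injective on such interiors.\<close>

lemma glue_exists:
  assumes "c \<in> cells X" "d \<in> cells X" "z \<in> cube (dm c)" "w \<in> cube (dm d)" "ch c z = ch d w"
  obtains h where "glue c z d w h"
proof -
  obtain h where h: "cube_isometry (dm c) (support (dm c) z) (dm d) (support (dm d) w) h"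
    "\<And>y. y \<in> support (dm c) z \<Longrightarrow> ch c y = ch d (h y)"
    using cx assms unfolding cube_complex_def by blast
  let ?I = "interior_dirs (dm c) z" and ?J = "interior_dirs (dm d) w"
  have fi: "face_isometry (dm c) z ?I (dm d) w ?J h"
    using h(1) assms unfolding support_face by unfold_locales (auto simp: interior_dirs_def)
  interpret face_isometry "dm c" z ?I "dm d" w ?J h by (rule fi)
  obtain a where a: "a \<in> verts (dm c) z" using verts_nonempty[OF assms(3)] by blast
  obtain p where p: "bij_betw p ?I ?J"
    "\<And>z' i. z' \<in> face (dm c) z ?I \<Longrightarrow> i \<in> ?I \<Longrightarrow> \<bar>h z' (p i) - h a (p i)\<bar> = \<bar>z' i - a i\<bar>"
    using coordinates[OF a] by metis
  have "interior_dirs (dm d) (h z) = ?J"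
    using isometry_interior[OF fi support_self[OF assms(3)] a p] p(1) unfolding bij_betw_def
      by blast
  moreover have hz: "h z \<in> face (dm d) w ?J" using h_face support_self[OF assms(3)]
    unfolding support_face by blast
  ultimately have "support (dm d) (h z) = support (dm d) w" unfolding support_face
    by (auto simp: face_def)
  moreover have "ch d (h z) = ch d w" using h(2) support_self assms by metis
  ultimately have "h z = w" using chart_inj[OF assms(2) face_cube[OF hz] assms(4)] by blast
  then show thesis using that h assms unfolding glue_def by blast
qed

text \<open>The carrier of \<open>y\<close> is cut out by fixing coordinates of \<open>y\<close>
  equal to 0 or 1, and \<open>h\<close> permutes these up to reflection, so carriers go to
  carriers.\<close>

lemma glue_restrict:
  assumes g: "glue c z d w h" and ys: "y \<in> support (dm c) z"
  shows "glue c y d (h y) h"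
proof -
  let ?I = "interior_dirs (dm c) z" and ?J = "interior_dirs (dm d) w"
  note fi = glue_isometry[OF g]
  interpret face_isometry "dm c" z ?I "dm d" w ?J h by (rule fi)
  have zw: "c \<in> cells X" "d \<in> cells X" "z \<in> cube (dm c)" "w \<in> cube (dm d)" using g
    unfolding glue_def by auto
  have hy: "h y \<in> support (dm d) w" using h_face ys unfolding support_face by blast
  obtain a where a: "a \<in> verts (dm c) z" using verts_nonempty[OF zw(3)] by blast
  obtain p where p: "bij_betw p ?I ?J"
    "\<And>z' i. z' \<in> face (dm c) z ?I \<Longrightarrow> i \<in> ?I \<Longrightarrow> \<bar>h z' (p i) - h a (p i)\<bar> = \<bar>z' i - a i\<bar>"
    using coordinates[OF a] by metis
  have int: "interior_dirs (dm d) (h y) = p ` interior_dirs (dm c) y"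
    using isometry_interior[OF fi ys a p] .
  have sub: "interior_dirs (dm c) y \<subseteq> ?I" using support_interior[OF zw(3) ys] .
  have char: "u \<in> support n v \<longleftrightarrow> (\<forall>i\<in>interior_dirs n v' - interior_dirs n v. u i = v i)"
    if "v' \<in> cube n" "v \<in> support n v'" "u \<in> support n v'" for n u v v'
  proof
    show "\<forall>i\<in>interior_dirs n v' - interior_dirs n v. u i = v i" if "u \<in> support n v"
      using that interior_sub[of n v'] unfolding support_face face_def by blast
    assume *: "\<forall>i\<in>interior_dirs n v' - interior_dirs n v. u i = v i"
    have "u i = v i" if i: "i \<in> {..<n} - interior_dirs n v" for i
    proof (cases "i \<in> interior_dirs n v'")
      case False
      then show ?thesis using \<open>v \<in> support n v'\<close> \<open>u \<in> support n v'\<close> i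
        unfolding support_face face_def by simp
    qed (use * i in blast)
    then show "u \<in> support n v" using support_cube[OF that(3)] unfolding support_face face_def
      by blast
  qed
  have iff: "u \<in> support (dm c) y \<longleftrightarrow> h u \<in> support (dm d) (h y)" if u: "u \<in> support (dm c) z" for u
  proof -
    have hu: "h u \<in> support (dm d) w" using h_face u unfolding support_face by blast
    have eq: "u i = y i \<longleftrightarrow> h u (p i) = h y (p i)" if i: "i \<in> ?I - interior_dirs (dm c) y" for i
    proof -
      have pi: "p i \<in> ?J" using p(1) i unfolding bij_betw_def by blast
      have "p i \<notin> interior_dirs (dm d) (h y)"
        using int i sub p(1) unfolding bij_betw_def inj_on_def by blast
      then have "h y (p i) = 0 \<or> h y (p i) = 1" "y i = 0 \<or> y i = 1"
        using boundary_coord[OF support_cube[OF hy]] boundary_coord[OF support_cube[OF ys]] pi i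
        unfolding interior_dirs_def by auto
      moreover have "\<bar>h u (p i) - h a (p i)\<bar> = \<bar>u i - a i\<bar>" "\<bar>h y (p i) - h a (p i)\<bar> = \<bar>y i - a i\<bar>"
        using p(2) u ys i unfolding support_face by auto
      moreover have "a i = 0 \<or> a i = 1" "h a (p i) = 0 \<or> h a (p i) = 1"
        using a h_antipode(1)[OF a] i pi unfolding rel_corners_def by auto
      moreover have "0 \<le> u i \<and> u i \<le> 1" "0 \<le> h u (p i) \<and> h u (p i) \<le> 1"
        using cube_bounds[OF support_cube[OF u]] cube_bounds[OF support_cube[OF hu]] i pi
        unfolding interior_dirs_def by auto
      ultimately show ?thesis by auto
    qed
    have "?J - interior_dirs (dm d) (h y) = p ` (?I - interior_dirs (dm c) y)"
      using int p(1) sub unfolding bij_betw_def by (simp add: inj_on_image_set_diff[of p ?I])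
    then show ?thesis
      using char[OF zw(3) ys u] char[OF zw(4) hy hu] eq by auto
  qed
  have bij: "bij_betw h (support (dm c) z) (support (dm d) w)" using g
    unfolding glue_def cube_isometry_def by blast
  have "h ` support (dm c) y = support (dm d) (h y)"
  proof
    show "h ` support (dm c) y \<subseteq> support (dm d) (h y)" using iff verts_sub(2)[OF zw(3) ys] by blast
    show "support (dm d) (h y) \<subseteq> h ` support (dm c) y"
    proof
      fix v assume v: "v \<in> support (dm d) (h y)"
      then have "v \<in> support (dm d) w" using verts_sub(2)[OF zw(4) hy] by blast
      then obtain u where "u \<in> support (dm c) z" "v = h u" using bij unfolding bij_betw_def by blast
      then show "v \<in> h ` support (dm c) y" using iff v by blast
    qed
  qed
  then have "bij_betw h (support (dm c) y) (support (dm d) (h y))"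
    using bij verts_sub(2)[OF zw(3) ys] unfolding bij_betw_def by (meson inj_on_subset)
  then show ?thesis
    using g verts_sub(2)[OF zw(3) ys] support_cube[OF ys] support_cube[OF hy]
      unfolding glue_def cube_isometry_def by (meson subsetD)
qed

lemma glue_id: "c \<in> cells X \<Longrightarrow> z \<in> cube (dm c) \<Longrightarrow> glue c z c z id"
  unfolding glue_def using cube_isometry_id by auto

lemma glue_sym:
  assumes "glue c z d w h"
  shows "glue d w c z (inv_into (support (dm c) z) h)"
proof -
  have h: "cube_isometry (dm c) (support (dm c) z) (dm d) (support (dm d) w) h" "h z = w"
    "\<And>y. y \<in> support (dm c) z \<Longrightarrow> ch c y = ch d (h y)" and
    zw: "c \<in> cells X" "d \<in> cells X" "z \<in> cube (dm c)" "w \<in> cube (dm d)"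
    using assms unfolding glue_def by auto
  have bij: "bij_betw h (support (dm c) z) (support (dm d) w)" using h(1)
    unfolding cube_isometry_def by blast
  let ?k = "inv_into (support (dm c) z) h"
  have "?k w = z" using bij h(2) support_self[OF zw(3)] by (metis bij_betw_inv_into_left)
  moreover have "ch d v = ch c (?k v)" if "v \<in> support (dm d) w" for v
    using h(3)[OF bij_betw_apply[OF bij_betw_inv_into[OF bij] that]] bij_betw_inv_into_right[OF bij that] by simp
  ultimately show ?thesis using zw cube_isometry_sym[OF h(1)] unfolding glue_def by blast
qed

lemma glue_comp: "glue c z d w h \<Longrightarrow> glue d w e v k \<Longrightarrow> glue c z e v (k \<circ> h)"
  unfolding glue_def using cube_isometry_comp[of "dm c" _ "dm d" _ h "dm e" _ k]
  by (auto simp: cube_isometry_def bij_betw_apply)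

lemma glue_verts: "glue c z d w h \<Longrightarrow> u \<in> verts (dm c) z \<Longrightarrow> h u \<in> verts (dm d) w"
  using face_isometry.h_antipode(1)[OF glue_isometry] .

lemma glue_dist:
  "glue c z d w h \<Longrightarrow> y \<in> support (dm c) z \<Longrightarrow> y' \<in> support (dm c) z \<Longrightarrow>
    cube_dist (dm d) (h y) (h y') = cube_dist (dm c) y y'"
  unfolding glue_def cube_isometry_def by blast

lemma glue_chart: "glue c z d w h \<Longrightarrow> y \<in> support (dm c) z \<Longrightarrow> ch c y = ch d (h y)"
  unfolding glue_def by blast

text \<open>Charts are injective on open faces, so two gluing isometries agree on interior points close to
  a vertex, hence at that vertex.\<close>

lemma glue_unique:
  assumes g: "glue c z d w h" and g': "glue c z d w h'" and u: "u \<in> verts (dm c) z"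
  shows "h u = h' u"
proof -
  let ?n = "dm c" and ?m = "dm d"
  let ?I = "interior_dirs ?n z" and ?J = "interior_dirs ?m w"
  have zw: "c \<in> cells X" "d \<in> cells X" "z \<in> cube ?n" "w \<in> cube ?m" using g unfolding glue_def
    by auto
  interpret h: face_isometry ?n z ?I ?m w ?J h using glue_isometry[OF g] .
  interpret h': face_isometry ?n z ?I ?m w ?J h' using glue_isometry[OF g'] .
  \<comment> \<open>The new coordinates are 1/6 or 5/6: interior, but nearer to the value at
    \<open>u\<close> than to the opposite one, so the image of \<open>u\<close> can be recovered
    from the image of \<open>y\<close>.\<close>
  define y where "y i = (if i \<in> ?I then (1 + 4 * u i) / 6 else u i)" for i
  have u01: "u i = 0 \<or> u i = 1" if "i < ?n" for i using verts_corners[OF zw(3) u] that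
    unfolding corners_iff by auto
  have uc: "u \<in> cube ?n" "u \<in> face ?n z ?I" using verts_corners[OF zw(3) u] u
    unfolding corners_iff rel_corners_def by auto
  have ys: "y \<in> face ?n z ?I"
    using uc u01 interior_sub[of ?n z] unfolding face_def cube_iff y_def by (auto simp: subset_iff)
  have Iy: "interior_dirs ?n y = ?I"
  proof
    show "interior_dirs ?n y \<subseteq> ?I" using support_interior[OF zw(3)] ys unfolding support_face
      by blast
    show "?I \<subseteq> interior_dirs ?n y"
    proof
      fix i assume i: "i \<in> ?I"
      then have "i < ?n" unfolding interior_dirs_def by auto
      then show "i \<in> interior_dirs ?n y" using u01[OF \<open>i < ?n\<close>] i
        unfolding interior_dirs_def[of _ y] y_def by auto
    qed
  qed
  have val: "\<forall>j\<in>?J. \<bar>k y j - k u j\<bar> = 1/6" "ch d (k y) = ch c y" "k y \<in> face ?m w ?J"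
    "interior_dirs ?m (k y) = ?J"
    "k u \<in> rel_corners ?m w ?J" if gk: "glue c z d w k" for k
  proof -
    interpret k: face_isometry ?n z ?I ?m w ?J k using glue_isometry[OF gk] .
    obtain p where p: "bij_betw p ?I ?J"
      "\<And>z' i. z' \<in> face ?n z ?I \<Longrightarrow> i \<in> ?I \<Longrightarrow> \<bar>k z' (p i) - k u (p i)\<bar> = \<bar>z' i - u i\<bar>"
      using k.coordinates[OF u] by metis
    have "\<bar>y i - u i\<bar> = 1/6" if "i \<in> ?I" for i
    proof -
      have "u i = 0 \<or> u i = 1" using u01 that interior_sub by blast
      then show ?thesis using that unfolding y_def by auto
    qed
    then have "\<forall>i\<in>?I. \<bar>k y (p i) - k u (p i)\<bar> = 1/6" using p(2)[OF ys] by simp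
    moreover have "?J = p ` ?I" using p(1) unfolding bij_betw_def by simp
    ultimately show "\<forall>j\<in>?J. \<bar>k y j - k u j\<bar> = 1/6" by simp
    show "ch d (k y) = ch c y" using glue_chart[OF gk] ys unfolding support_face by metis
    show "k y \<in> face ?m w ?J" using k.h_face[OF ys] .
    show "interior_dirs ?m (k y) = ?J"
      using isometry_interior[OF glue_isometry[OF gk] _ u p, of y] ys Iy p(1)
        unfolding support_face bij_betw_def by blast
    show "k u \<in> rel_corners ?m w ?J" using k.h_antipode(1)[OF u] .
  qed
  note v = val[OF g] and v' = val[OF g']
  have "support ?m (h y) = support ?m (h' y)"
    unfolding support_face v(4) v'(4) using v(3) v'(3) unfolding face_def by auto
  then have hy: "h y = h' y"
    using chart_inj[OF zw(2) face_cube[OF v(3)] face_cube[OF v'(3)]] v(2) v'(2) by simp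
  show ?thesis
  proof (rule cube_eqI)
    show "h u \<in> cube ?m" "h' u \<in> cube ?m" using v(5) v'(5) unfolding rel_corners_def face_def
      by auto
    fix j assume j: "j < ?m"
    show "h u j = h' u j"
    proof (cases "j \<in> ?J")
      case True
      then have "\<bar>h y j - h u j\<bar> = 1/6" "\<bar>h y j - h' u j\<bar> = 1/6" "h u j = 0 \<or> h u j = 1"
        "h' u j = 0 \<or> h' u j = 1"
        using v(1,5) v'(1,5) hy unfolding rel_corners_def by auto
      then show ?thesis by auto
    next
      case False
      then show ?thesis using v(5) v'(5) j unfolding rel_corners_def face_def by auto
    qed
  qed
qed

lemma glue_edge:
  assumes g: "glue c z d w h" and u: "u \<in> verts (dm c) z" and i: "i \<in> interior_dirs (dm c) z"
  obtains j where "j < dm d" "h (flip i u) = flip j (h u)"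
    "edge_path X c u i = edge_path X d (h u) j"
proof -
  interpret face_isometry "dm c" z "interior_dirs (dm c) z" "dm d" w "interior_dirs (dm d) w" h
    using glue_isometry[OF g] .
  obtain j where j: "j \<in> interior_dirs (dm d) w" "h (flip i u) = flip j (h u)" using h_flip[OF u i]
    by blast
  have "edge_path X c u i t = edge_path X d (h u) j t" for t
  proof -
    have "seg u i (clamp01 t) \<in> support (dm c) z"
      unfolding support_face using u i F unfolding rel_corners_def by (intro seg_in_face) auto
    then show ?thesis
      using glue_chart[OF g] h_seg[OF u i j(2,1), of "clamp01 t"] unfolding edge_path_def by simp
  qed
  moreover have "j < dm d" using j(1) unfolding interior_dirs_def by auto
  ultimately show thesis using that j(2) by blast
qed

text \<open>Signed permutations preserve the distance of a coordinate from the ends of its interval,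
  so the margin depends only on the image point.\<close>

lemma glue_clear:
  assumes g: "glue c z d w h" and cl: "clear (dm c) \<delta> z"
  shows "clear (dm d) \<delta> w"
  unfolding clear_def
proof
  let ?I = "interior_dirs (dm c) z" and ?J = "interior_dirs (dm d) w"
  interpret face_isometry "dm c" z ?I "dm d" w ?J h using glue_isometry[OF g] .
  have z: "z \<in> cube (dm c)" "h z = w" using g unfolding glue_def by auto
  obtain a where a: "a \<in> verts (dm c) z" using verts_nonempty[OF z(1)] by blast
  obtain p where p: "bij_betw p ?I ?J"
    "\<And>z' i. z' \<in> face (dm c) z ?I \<Longrightarrow> i \<in> ?I \<Longrightarrow> \<bar>h z' (p i) - h a (p i)\<bar> = \<bar>z' i - a i\<bar>"
    using coordinates[OF a] by metis
  fix j assume j: "j \<in> ?J"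
  then obtain i where i: "i \<in> ?I" "j = p i" using p(1) unfolding bij_betw_def by blast
  have "\<bar>w j - h a j\<bar> = \<bar>z i - a i\<bar>" using p(2)[of z i] i z support_self[OF z(1)]
    unfolding support_face by simp
  moreover have "a i = 0 \<or> a i = 1" "h a j = 0 \<or> h a j = 1"
    using a h_antipode(1)[OF a] i j unfolding rel_corners_def by auto
  moreover have "\<delta> \<le> z i \<and> z i \<le> 1 - \<delta>" using cl i unfolding clear_def by blast
  moreover have "0 < w j" "w j < 1" "0 < z i" "z i < 1" using i j unfolding interior_dirs_def
    by auto
  ultimately show "\<delta> \<le> w j \<and> w j \<le> 1 - \<delta>" by auto
qed

section \<open>Small balls in the realization\<close>

definition good_radius :: "'p \<Rightarrow> real \<Rightarrow> bool"
  where "good_radius q e \<longleftrightarrow> 0 < e \<and> e < 1/4 \<and> (\<forall>c\<in>cells X. \<forall>z\<in>cube (dm c). ch c z = q \<longrightarrow>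
    clear (dm c) (4 * e) z)"

text \<open>One radius must serve all preimages of \<open>q\<close>, possibly infinitely many; by
  \<open>glue_clear\<close> a single preimage decides.\<close>

lemma good_radius_exists: "\<exists>e. good_radius q e"
proof (cases "\<exists>c\<in>cells X. \<exists>z\<in>cube (dm c). ch c z = q")
  case False
  then show ?thesis unfolding good_radius_def by (intro exI[of _ "1/8"]) auto
next
  case True
  then obtain c z where cz: "c \<in> cells X" "z \<in> cube (dm c)" "ch c z = q" by blast
  \<comment> \<open>The entry 1/2 keeps the minimum defined at corners and the radius
    \<open>\<delta> / 4\<close> below 1/4.\<close>
  let ?S = "insert (1/2) ((\<lambda>i. min (z i) (1 - z i)) ` interior_dirs (dm c) z)"
  define \<delta> where "\<delta> = Min ?S"
  have fin: "finite ?S" unfolding interior_dirs_def by auto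
  have "\<delta> > 0" unfolding \<delta>_def using fin by (subst Min_gr_iff) (auto simp: interior_dirs_def)
  moreover have "\<delta> \<le> 1/2" unfolding \<delta>_def using fin by (intro Min_le) auto
  moreover have "\<delta> \<le> min (z i) (1 - z i)" if "i \<in> interior_dirs (dm c) z" for i
    unfolding \<delta>_def using fin that by (intro Min_le) auto
  then have "clear (dm c) \<delta> z" unfolding clear_def by fastforce
  then have "clear (dm d) \<delta> w" if "d \<in> cells X" "w \<in> cube (dm d)" "ch d w = q" for d w
    using glue_exists[OF cz(1) that(1) cz(2) that(2)] glue_clear cz(3) that(3) by metis
  ultimately show ?thesis unfolding good_radius_def by (intro exI[of _ "\<delta> / 4"]) auto
qed

definition radius :: "'p \<Rightarrow> real"
  where "radius q = (SOME e. good_radius q e)"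

lemma radius: "good_radius q (radius q)"
  unfolding radius_def using good_radius_exists by (rule someI_ex)

lemma radius_bounds: "0 < radius q" "radius q < 1/4"
  using radius[of q] unfolding good_radius_def by auto

lemma radius_clear: "c \<in> cells X \<Longrightarrow> z \<in> cube (dm c) \<Longrightarrow> clear (dm c) (4 * radius (ch c z)) z"
  using radius unfolding good_radius_def by blast

lemma near_support_radius:
  "c \<in> cells X \<Longrightarrow> z \<in> cube (dm c) \<Longrightarrow> w \<in> cube (dm c) \<Longrightarrow> cube_dist (dm c) z w < radius (ch c z) \<Longrightarrow>
    z \<in> support (dm c) w"
  using near_support radius_clear radius_bounds by blast

text \<open>Preimages of one point at such small distance have the same carrier, and charts are
  injective on its interior.\<close>

lemma near_equal:
  assumes "c \<in> cells X" "z \<in> cube (dm c)" "w \<in> cube (dm c)" "ch c z = ch c w"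
    "cube_dist (dm c) z w < 2 * radius (ch c z)"
  shows "z = w"
  using chart_inj[OF assms(1-3)] near_same_support[OF assms(2,3)] radius_clear[OF assms(1,2)]
    radius_clear[OF assms(1,3)] radius_bounds assms(4,5) by metis

text \<open>The gluing at \<open>w'\<close> and \<open>v'\<close> sends \<open>w\<close> to a
  preimage of the same point as \<open>v\<close>, less than twice the radius away from
  \<open>v\<close>, hence to \<open>v\<close> itself.\<close>

lemma glue_near:
  assumes g: "glue d w' e v' k" and w: "w \<in> cube (dm d)" "cube_dist (dm d) w w' < radius (ch d w)"
    and v: "v \<in> cube (dm e)" "ch e v = ch d w" "cube_dist (dm e) v v' < radius (ch d w)"
  shows "w \<in> support (dm d) w'" "k w = v" "glue d w e v k"
proof -
  have de: "d \<in> cells X" "e \<in> cells X" "w' \<in> cube (dm d)" "v' \<in> cube (dm e)" "k w' = v'" using g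
    unfolding glue_def by auto
  show s: "w \<in> support (dm d) w'" using near_support_radius de w by blast
  have gw: "glue d w e (k w) k" using glue_restrict[OF g s] .
  have kw: "k w \<in> cube (dm e)" "ch e (k w) = ch d w" using gw support_self[OF w(1)]
    unfolding glue_def by auto
  have "cube_dist (dm e) (k w) v' = cube_dist (dm d) w w'"
    using glue_dist[OF g s support_self[OF de(3)]] de(5) by simp
  then have "cube_dist (dm e) (k w) v < 2 * radius (ch e (k w))"
    using cube_dist_tri[of "dm e" "k w" v v'] cube_dist_sym[of "dm e" v' v] w(2) v(3) kw(2) by simp
  then show "k w = v" using near_equal[OF de(2) kw(1) v(1)] kw(2) v(2) by simp
  then show "glue d w e v k" using gw by simp
qed

definition chart_ball :: "'p \<Rightarrow> real \<Rightarrow> 'p set"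
  where "chart_ball q r = {p. \<exists>c\<in>cells X. \<exists>z\<in>cube (dm c). \<exists>w\<in>cube (dm c). ch c z = q \<and> ch c w = p \<and>
    cube_dist (dm c) z w < r}"

text \<open>The centre lies in the carrier of every nearby point, so a gluing at that point carries
  the centre along. Membership can thus be tested in any cell, which makes the preimage of the ball
  a union of open balls in each cell.\<close>

lemma chart_ball_iff:
  assumes "r \<le> radius q" "d \<in> cells X" "w \<in> cube (dm d)"
  shows "ch d w \<in> chart_ball q r \<longleftrightarrow> (\<exists>z\<in>cube (dm d). ch d z = q \<and> cube_dist (dm d) z w < r)"
proof
  assume "ch d w \<in> chart_ball q r"
  then obtain c z w' where c: "c \<in> cells X" "z \<in> cube (dm c)" "w' \<in> cube (dm c)" "ch c z = q"
    "ch c w' = ch d w"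
    "cube_dist (dm c) z w' < r" unfolding chart_ball_def by blast
  obtain k where k: "glue c w' d w k" using glue_exists[OF c(1) assms(2) c(3) assms(3) c(5)] .
  have s: "z \<in> support (dm c) w'" using near_support_radius[OF c(1,2,3)] c(4,6) assms(1) by simp
  have "k z \<in> cube (dm d)" "ch d (k z) = q" "cube_dist (dm d) (k z) w = cube_dist (dm c) z w'"
    using glue_restrict[OF k s] glue_chart[OF k s] glue_dist[OF k s support_self[OF c(3)]] c(4) k
    unfolding glue_def by auto
  then show "\<exists>z\<in>cube (dm d). ch d z = q \<and> cube_dist (dm d) z w < r" using c(6) by auto
next
  assume "\<exists>z\<in>cube (dm d). ch d z = q \<and> cube_dist (dm d) z w < r"
  then show "ch d w \<in> chart_ball q r" unfolding chart_ball_def using assms by blast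
qed

lemma topspace_cube: "topspace (cube_topology n) = cube n"
  unfolding cube_topology_def cube_def by simp

lemma open_cube_ball: "openin (cube_topology n) {w \<in> cube n. cube_dist n z w < r}"
proof -
  have "continuous_map (cube_topology n) euclideanreal (\<lambda>w. w i)" if "i < n" for i
  proof -
    have "continuous_map (cube_topology n) (top_of_set {0..1}) (\<lambda>w. w i)"
      unfolding cube_topology_def by (rule continuous_map_product_projection) (use that in auto)
    then show ?thesis by (rule continuous_map_into_fulltopology)
  qed
  then have "continuous_map (cube_topology n) euclideanreal (\<lambda>w. \<Sum>i<n. (z i - w i)\<^sup>2)"
    by (intro continuous_map_sum continuous_map_real_pow continuous_map_diff) auto
  moreover have "continuous_map euclideanreal euclideanreal sqrt"
    using continuous_on_real_sqrt[OF continuous_on_id] by simp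
  ultimately have "continuous_map (cube_topology n) euclideanreal (sqrt \<circ> (\<lambda>w. \<Sum>i<n. (z i - w i)\<^sup>2))"
    by (rule continuous_map_compose)
  then have "continuous_map (cube_topology n) euclideanreal (\<lambda>w. cube_dist n z w)"
    unfolding cube_dist_def L2_set_def o_def .
  from openin_continuous_map_preimage[OF this, of "{..<r}"] show ?thesis
    by (simp add: topspace_cube)
qed

lemma open_realization:
  assumes "U \<subseteq> topspace (realization X)"
    "\<And>d. d \<in> cells X \<Longrightarrow> openin (cube_topology (dm d)) {w \<in> cube (dm d). ch d w \<in> U}"
  shows "openin (realization X) U"
proof -
  let ?S = "sum_topology (\<lambda>c. cube_topology (dm c)) (cells X)"
  have q: "quotient_map ?S (realization X) (\<lambda>(c, x). ch c x)" using cx unfolding cube_complex_def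
    by blast
  have "{y \<in> topspace ?S. (\<lambda>(c, x). ch c x) y \<in> U} =
    Sigma (cells X) (\<lambda>d. {w \<in> cube (dm d). ch d w \<in> U})"
    by (auto simp: topspace_cube)
  then have "openin ?S {y \<in> topspace ?S. (\<lambda>(c, x). ch c x) y \<in> U}"
    unfolding openin_sum_topology_alt using assms(2) by blast
  then show ?thesis using q assms(1) unfolding quotient_map_def by blast
qed

lemma realization_points: "topspace (realization X) = (\<Union>c\<in>cells X. ch c ` cube (dm c))"
proof -
  let ?S = "sum_topology (\<lambda>c. cube_topology (dm c)) (cells X)"
  have "quotient_map ?S (realization X) (\<lambda>(c, x). ch c x)" using cx unfolding cube_complex_def
    by blast
  then have "topspace (realization X) = (\<lambda>(c, x). ch c x) ` topspace ?S"
    using quotient_imp_surjective_map[of ?S "realization X"] by simp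
  moreover have "topspace ?S = Sigma (cells X) (\<lambda>c. cube (dm c))" by (auto simp: topspace_cube)
  ultimately show ?thesis by (simp only:) force
qed

lemma open_chart_ball:
  assumes "r \<le> radius q" shows "openin (realization X) (chart_ball q r)"
proof (rule open_realization)
  show "chart_ball q r \<subseteq> topspace (realization X)" unfolding chart_ball_def realization_points
    by blast
  fix d assume d: "d \<in> cells X"
  have "{w \<in> cube (dm d). ch d w \<in> chart_ball q r} =
      (\<Union>z\<in>{z \<in> cube (dm d). ch d z = q}. {w \<in> cube (dm d). cube_dist (dm d) z w < r})"
    using chart_ball_iff[OF assms d] by blast
  then show "openin (cube_topology (dm d)) {w \<in> cube (dm d). ch d w \<in> chart_ball q r}"
    by (simp only:) (rule openin_Union, use open_cube_ball in auto)
qed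

lemma continuous_chart: "c \<in> cells X \<Longrightarrow> continuous_map (cube_topology (dm c)) (realization X) (ch c)"
proof -
  assume c: "c \<in> cells X"
  have "continuous_map (sum_topology (\<lambda>c. cube_topology (dm c)) (cells X)) (realization X) (\<lambda>(c, x). ch c x)"
    using cx quotient_imp_continuous_map unfolding cube_complex_def by blast
  from continuous_map_compose[OF continuous_map_component_injection[OF c] this]
  show ?thesis by (simp add: o_def)
qed

end

section \<open>Local systems\<close>

lemma rel_corners_sub_corners: "u \<in> corners n \<Longrightarrow> F \<subseteq> {..<n} \<Longrightarrow> rel_corners n u F \<subseteq> corners n"
proof
  fix a assume u: "u \<in> corners n" and a: "a \<in> rel_corners n u F"
  have "a i = 0 \<or> a i = 1" if "i < n" for i
    using a u that unfolding rel_corners_def face_def corners_iff by (cases "i \<in> F") auto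
  moreover have "a \<in> cube n" using a unfolding rel_corners_def face_def by blast
  ultimately show "a \<in> corners n" unfolding corners_iff by blast
qed

lemma rel_corners_all: "u \<in> corners n \<Longrightarrow> rel_corners n u {..<n} = corners n"
  unfolding rel_corners_def face_def corners_iff[of u n]
  by (auto simp: corners_iff)

text \<open>The last edge is again the head, so \<open>foldr\<close> lets the edges act in the order
  in which they are traversed.\<close>

inductive path_word :: "('c, 'p) cube_data \<Rightarrow> 'p \<Rightarrow> (real \<Rightarrow> 'p) list \<Rightarrow> 'p \<Rightarrow> bool" for X b where
  Nil: "b \<in> vertices X \<Longrightarrow> path_word X b [] b"
| Cons: "path_word X b w (chart X c x) \<Longrightarrow> c \<in> cells X \<Longrightarrow> x \<in> corners (cdim X c) \<Longrightarrow> i < cdim X c \<Longrightarrow>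
    path_word X b (edge_path X c x i # w) (chart X c (flip i x))"

text \<open>Fibres sit over vertices only. Invertibility along edges and flatness on squares suffice
  to extend a value at a corner to a whole cube.\<close>

locale local_system = cube_cx X for X :: "('c, 'p) cube_data" +
  fixes Fib :: "'p \<Rightarrow> 'a set" and act :: "(real \<Rightarrow> 'p) \<Rightarrow> 'a \<Rightarrow> 'a"
  assumes act_Fib: "c \<in> cells X \<Longrightarrow> x \<in> corners (cdim X c) \<Longrightarrow> i < cdim X c \<Longrightarrow> a \<in> Fib (chart X c x) \<Longrightarrow>
      act (edge_path X c x i) a \<in> Fib (chart X c (flip i x))"
    and act_back: "c \<in> cells X \<Longrightarrow> x \<in> corners (cdim X c) \<Longrightarrow> i < cdim X c \<Longrightarrow> a \<in> Fib (chart X c x) \<Longrightarrow>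
      act (edge_path X c (flip i x) i) (act (edge_path X c x i) a) = a"
    and act_sq: "c \<in> cells X \<Longrightarrow> x \<in> corners (cdim X c) \<Longrightarrow> i < cdim X c \<Longrightarrow> j < cdim X c \<Longrightarrow> i \<noteq> j \<Longrightarrow>
      a \<in> Fib (chart X c x) \<Longrightarrow>
      act (edge_path X c (flip i x) j) (act (edge_path X c x i) a) = act (edge_path X c (flip j x) i) (act (edge_path X c x j) a)"
begin

abbreviation "ep \<equiv> edge_path X"

definition flat_on :: "'c \<Rightarrow> (nat \<Rightarrow> real) \<Rightarrow> nat set \<Rightarrow> ((nat \<Rightarrow> real) \<Rightarrow> 'a) \<Rightarrow> bool"
  where "flat_on c u F S \<longleftrightarrow> (\<forall>x\<in>rel_corners (dm c) u F. S x \<in> Fib (ch c x) \<and> (\<forall>i\<in>F. S (flip i x) =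
    act (ep c x i) (S x)))"

definition flat :: "'c \<Rightarrow> ((nat \<Rightarrow> real) \<Rightarrow> 'a) \<Rightarrow> bool"
  where "flat c S \<longleftrightarrow> (\<forall>x\<in>corners (dm c). S x \<in> Fib (ch c x) \<and> (\<forall>i<dm c. S (flip i x) =
    act (ep c x i) (S x)))"

text \<open>The section is copied across direction \<open>i\<close>; on the new side, compatibility
  with the directions in \<open>F\<close> is the square condition.\<close>

lemma flat_extend:
  assumes c: "c \<in> cells X" and u: "u \<in> corners (dm c)" and F: "insert i F \<subseteq> {..<dm c}" "i \<notin> F"
    and S: "flat_on c u F S"
  shows "flat_on c u (insert i F) (\<lambda>x. if x i =
    u i then S x else act (ep c (flip i x) i) (S (flip i x)))"
    (is "flat_on _ _ _ ?S")
  unfolding flat_on_def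
proof
  let ?R = "rel_corners (dm c) u F"
  fix x assume x: "x \<in> rel_corners (dm c) u (insert i F)"
  have R: "y \<in> ?R" if "y \<in> rel_corners (dm c) u (insert i F)" "y i = u i" for y
    using that F unfolding rel_corners_def face_def by fastforce
  have ui: "u i = 0 \<or> u i = 1" "i < dm c" using u F unfolding corners_iff by auto
  have val: "y i \<noteq> u i \<Longrightarrow> flip i y i = u i" "y i = u i \<Longrightarrow> flip i y i \<noteq> u i"
    if "y \<in> rel_corners (dm c) u (insert i F)" for y
  proof -
    have "y i = 0 \<or> y i = 1" using that unfolding rel_corners_def by blast
    then show "y i \<noteq> u i \<Longrightarrow> flip i y i = u i" "y i = u i \<Longrightarrow> flip i y i \<noteq> u i" using ui
      unfolding flip_apply by auto
  qed
  have fl: "flip j y \<in> rel_corners (dm c) u (insert i F)" if "y \<in> rel_corners (dm c) u (insert i F)"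
    "j \<in> insert i F" for y j
    using flip_rel_corners[OF that(1) F(1) that(2)] .
  have cor: "y \<in> corners (dm c)" if "y \<in> rel_corners (dm c) u (insert i F)" for y
    using rel_corners_sub_corners[OF u F(1)] that by blast
  have S1: "S y \<in> Fib (ch c y)" "\<And>j. j \<in> F \<Longrightarrow> S (flip j y) = act (ep c y j) (S y)" if "y \<in> ?R" for y
    using S that unfolding flat_on_def by auto
  have Fl: "j < dm c" if "j \<in> F" for j using F that by auto
  show "?S x \<in> Fib (ch c x) \<and> (\<forall>j\<in>insert i F. ?S (flip j x) = act (ep c x j) (?S x))"
  proof (cases "x i = u i")
    case True
    have xR: "x \<in> ?R" using R[OF x True] .
    have "?S (flip j x) = act (ep c x j) (?S x)" if "j \<in> F" for j
    proof -
      have "flip j x i = u i" using True that F(2) unfolding flip_apply by auto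
      then show ?thesis using S1(2)[OF xR that] True by simp
    qed
    moreover have "?S (flip i x) = act (ep c x i) (?S x)" using val(2)[OF x True] True by simp
    ultimately show ?thesis using S1(1)[OF xR] True by simp
  next
    case False
    let ?w = "flip i x"
    have w: "?w \<in> ?R" "?w \<in> corners (dm c)"
      using R[OF fl[OF x, of i] val(1)[OF x False]] cor[OF fl[OF x, of i]] by auto
    have Sx: "?S x = act (ep c ?w i) (S ?w)" using False by simp
    have "?S x \<in> Fib (ch c x)" using act_Fib[OF c w(2) ui(2) S1(1)[OF w(1)]] Sx by simp
    moreover have "?S ?w = act (ep c x i) (?S x)"
      using act_back[OF c w(2) ui(2) S1(1)[OF w(1)]] val(1)[OF x False] Sx by simp
    moreover have "?S (flip j x) = act (ep c x j) (?S x)" if j: "j \<in> F" for j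
    proof -
      have ij: "j \<noteq> i" using j F(2) by auto
      then have "flip j x i \<noteq> u i" using False unfolding flip_apply by auto
      then have "?S (flip j x) = act (ep c (flip j ?w) i) (act (ep c ?w j) (S ?w))"
        using S1(2)[OF w(1) j] by (simp add: flip_commute)
      also have "\<dots> = act (ep c (flip i ?w) j) (act (ep c ?w i) (S ?w))"
        using act_sq[OF c w(2) Fl[OF j] ui(2) ij S1(1)[OF w(1)]] .
      finally show ?thesis using Sx by simp
    qed
    ultimately show ?thesis by blast
  qed
qed

lemma flat_exists:
  assumes c: "c \<in> cells X" and u: "u \<in> corners (dm c)" and a: "a \<in> Fib (ch c u)"
  obtains S where "flat c S" "S u = a"
proof -
  have "\<exists>S. flat_on c u F S \<and> S u = a" if "finite F" "F \<subseteq> {..<dm c}" for F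
    using that
  proof (induction F)
    case empty
    have "rel_corners (dm c) u {} = {u}"
      using u unfolding rel_corners_def face_def corners_iff by (auto intro: cube_eqI)
    then show ?case using a unfolding flat_on_def by (intro exI[of _ "\<lambda>_. a"]) simp
  next
    case (insert i F)
    then obtain S where S: "flat_on c u F S" "S u = a" by auto
    then show ?case using flat_extend[OF c u insert(4,2) S(1)] S(2)
      by (intro exI[of _ "\<lambda>x. if x i = u i then S x else act (ep c (flip i x) i) (S (flip i x))"]) simp
  qed
  from this[of "{..<dm c}"] show thesis
    using that unfolding flat_on_def flat_def rel_corners_all[OF u] by auto
qed

text \<open>Gluing maps preserve edges as parametrised paths, so agreement at one vertex of the
  carrier spreads along its edges.\<close>

lemma flat_glue:
  assumes g: "glue c z d w h" and S: "flat c S" and R: "flat d R"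
    and u0: "u0 \<in> verts (dm c) z" "R (h u0) = S u0" and u: "u \<in> verts (dm c) z"
  shows "R (h u) = S u"
proof (rule rel_corners_induct[OF interior_sub u u0(1), where P = "\<lambda>u. R (h u) = S u"])
  show "R (h u0) = S u0" by fact
  have zw: "z \<in> cube (dm c)" "w \<in> cube (dm d)" using g unfolding glue_def by auto
  fix a i assume a: "a \<in> verts (dm c) z" "i \<in> interior_dirs (dm c) z" "R (h a) = S a"
  obtain j where j: "j < dm d" "h (flip i a) = flip j (h a)" "ep c a i = ep d (h a) j"
    using glue_edge[OF g a(1,2)] .
  have "a \<in> corners (dm c)" "h a \<in> corners (dm d)" "i < dm c"
    using verts_corners[OF zw(1) a(1)] verts_corners[OF zw(2) glue_verts[OF g a(1)]] a(2)
      unfolding interior_dirs_def by auto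
  then show "R (h (flip i a)) = S (flip i a)" using S R j a(3) unfolding flat_def by simp
qed

section \<open>The covering associated with a local system\<close>

definition total :: "('c \<times> (nat \<Rightarrow> real) \<times> ((nat \<Rightarrow> real) \<Rightarrow> 'a)) set"
  where "total = {(c, z, S). c \<in> cells X \<and> z \<in> cube (dm c) \<and> flat c S}"

definition proj :: "'c \<times> (nat \<Rightarrow> real) \<times> ((nat \<Rightarrow> real) \<Rightarrow> 'a) \<Rightarrow> 'p"
  where "proj t = (case t of (c, z, S) \<Rightarrow> ch c z)"

text \<open>Sections are defined on all corners of a cell, but only their values on the carrier of
  the point are compared.\<close>

definition sim where
  "sim s t \<longleftrightarrow> s \<in> total \<and> t \<in> total \<and> (case s of (c, z, S) \<Rightarrow> case t of (d, w, R) \<Rightarrow>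
    (\<exists>h. glue c z d w h \<and> (\<forall>u\<in>verts (dm c) z. R (h u) = S u)))"

definition sheet where
  "sheet s t \<longleftrightarrow> (\<exists>d w w' S. sim s (d, w, S) \<and> sim t (d, w', S) \<and>
    cube_dist (dm d) w w' < radius (proj s))"

lemma total_iff: "(c, z, S) \<in> total \<longleftrightarrow> c \<in> cells X \<and> z \<in> cube (dm c) \<and> flat c S"
  unfolding total_def by simp

lemma proj_simp [simp]: "proj (c, z, S) = ch c z"
  unfolding proj_def by simp

lemma simI:
  assumes "flat c S" "flat d R" "glue c z d w h" "u \<in> verts (dm c) z" "R (h u) = S u"
  shows "sim (c, z, S) (d, w, R)"
  using assms flat_glue[OF assms(3,1,2,4,5)] unfolding sim_def total_iff glue_def by auto

lemma simE:
  assumes "sim (c, z, S) (d, w, R)"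
  obtains h where "flat c S" "flat d R" "glue c z d w h" "\<And>u. u \<in> verts (dm c) z \<Longrightarrow> R (h u) = S u"
  using assms unfolding sim_def total_iff by auto

lemma sim_total: "sim s t \<Longrightarrow> s \<in> total \<and> t \<in> total"
  unfolding sim_def by blast

lemma sim_proj: "sim s t \<Longrightarrow> proj s = proj t"
proof -
  assume st: "sim s t"
  obtain c z S where s: "s = (c, z, S)" by (cases s)
  obtain d w R where t: "t = (d, w, R)" by (cases t)
  obtain h where h: "glue c z d w h" using simE[OF st[unfolded s t]] by metis
  then show ?thesis using glue_chart[OF h support_self] unfolding s t glue_def by auto
qed

lemma sim_refl: "t \<in> total \<Longrightarrow> sim t t"
proof -
  assume t: "t \<in> total"
  obtain c z S where s: "t = (c, z, S)" by (cases t)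
  then have cz: "c \<in> cells X" "z \<in> cube (dm c)" "flat c S" using t total_iff by auto
  obtain u where "u \<in> verts (dm c) z" using verts_nonempty[OF cz(2)] by blast
  then show ?thesis unfolding s using simI[OF cz(3,3) glue_id[OF cz(1,2)]] by simp
qed

lemma sim_sym: "sim s t \<Longrightarrow> sim t s"
proof -
  assume st: "sim s t"
  obtain c z S where s: "s = (c, z, S)" by (cases s)
  obtain d w R where t: "t = (d, w, R)" by (cases t)
  obtain h where h: "flat c S" "flat d R" "glue c z d w h" "\<And>u. u \<in> verts (dm c) z \<Longrightarrow> R (h u) = S u"
    using simE[OF st[unfolded s t]] by metis
  have z: "z \<in> cube (dm c)" using h(3) unfolding glue_def by blast
  obtain u where u: "u \<in> verts (dm c) z" using verts_nonempty[OF z] by blast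
  have "u \<in> support (dm c) z" using u unfolding support_face rel_corners_def by auto
  moreover have "inj_on h (support (dm c) z)" using h(3)
    unfolding glue_def cube_isometry_def bij_betw_def by blast
  ultimately have "S (inv_into (support (dm c) z) h (h u)) = R (h u)" using h(4)[OF u] by simp
  then show ?thesis unfolding s t by (rule simI[OF h(2,1) glue_sym[OF h(3)] glue_verts[OF h(3) u]])
qed

lemma sim_trans: "sim s t \<Longrightarrow> sim t r \<Longrightarrow> sim s r"
proof -
  assume st: "sim s t" and tr: "sim t r"
  obtain c z S where s: "s = (c, z, S)" by (cases s)
  obtain d w R where t: "t = (d, w, R)" by (cases t)
  obtain e v Q where r: "r = (e, v, Q)" by (cases r)
  obtain h where h: "flat c S" "flat d R" "glue c z d w h" "\<And>u. u \<in> verts (dm c) z \<Longrightarrow> R (h u) = S u"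
    using simE[OF st[unfolded s t]] by metis
  obtain k where k: "flat e Q" "glue d w e v k" "\<And>u. u \<in> verts (dm d) w \<Longrightarrow> Q (k u) = R u"
    using simE[OF tr[unfolded t r]] by metis
  have z: "z \<in> cube (dm c)" using h(3) unfolding glue_def by blast
  obtain u where u: "u \<in> verts (dm c) z" using verts_nonempty[OF z] by blast
  have "Q ((k \<circ> h) u) = S u" using h(4)[OF u] k(3)[OF glue_verts[OF h(3) u]] by simp
  then show ?thesis unfolding s r by (rule simI[OF h(1) k(1) glue_comp[OF h(3) k(2)] u])
qed

text \<open>By \<open>glue_unique\<close> the isometry hidden in \<open>sim\<close> may be replaced
  by any gluing map at the same points.\<close>

lemma sim_glue:
  assumes "sim (c, z, S) (d, w, R)" "glue c z d w h" "u \<in> verts (dm c) z"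
  shows "R (h u) = S u"
proof -
  obtain k where k: "glue c z d w k" "\<And>u. u \<in> verts (dm c) z \<Longrightarrow> R (k u) = S u"
    using simE[OF assms(1)] by metis
  show ?thesis unfolding glue_unique[OF assms(2) k(1) assms(3)] by (rule k(2)[OF assms(3)])
qed

lemma sim_exists:
  assumes t: "(c, z, S) \<in> total" and d: "d \<in> cells X" "w \<in> cube (dm d)" "ch c z = ch d w"
  obtains R where "sim (c, z, S) (d, w, R)"
proof -
  have cz: "c \<in> cells X" "z \<in> cube (dm c)" "flat c S" using t unfolding total_iff by auto
  obtain h where h: "glue c z d w h" using glue_exists[OF cz(1) d(1) cz(2) d(2,3)] .
  obtain u where u: "u \<in> verts (dm c) z" using verts_nonempty[OF cz(2)] by blast
  have us: "u \<in> support (dm c) z" using u unfolding support_face rel_corners_def by auto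
  have "S u \<in> Fib (ch c u)" using cz(3) verts_corners[OF cz(2) u] unfolding flat_def by blast
  then have "S u \<in> Fib (ch d (h u))" using glue_chart[OF h us] by simp
  then obtain R where R: "flat d R" "R (h u) = S u"
    using flat_exists[OF d(1) verts_corners[OF d(2) glue_verts[OF h u]]] by blast
  then show thesis using that simI[OF cz(3) R(1) h u R(2)] by blast
qed

lemma sheet_total: "sheet s t \<Longrightarrow> s \<in> total \<and> t \<in> total"
  unfolding sheet_def using sim_total by blast

lemma sheetE:
  assumes "sheet s t"
  obtains d w w' S where "sim s (d, w, S)" "sim t (d, w', S)"
    "cube_dist (dm d) w w' < radius (ch d w)"
    "d \<in> cells X" "w \<in> cube (dm d)" "w' \<in> cube (dm d)" "flat d S" "proj s = ch d w"
      "proj t = ch d w'"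
proof -
  obtain d w w' S where *: "sim s (d, w, S)" "sim t (d, w', S)"
    "cube_dist (dm d) w w' < radius (proj s)"
    using assms unfolding sheet_def by blast
  then show thesis
    using that[OF *(1,2)] sim_total[OF *(1)] sim_total[OF *(2)] sim_proj[OF *(1)] sim_proj[OF *(2)]
      unfolding total_iff by simp
qed

lemma sheetI: "sim s (d, w, S) \<Longrightarrow> sim t (d, w', S) \<Longrightarrow> cube_dist (dm d) w w' < radius (ch d w) \<Longrightarrow>
  sheet s t"
  using sim_proj[of s "(d, w, S)"] unfolding sheet_def by auto

text \<open>The common core of \<open>sheet_det\<close> and \<open>sheet_inj\<close>. A gluing at
  \<open>w'\<close> and \<open>v'\<close> restricts to one at the centres \<open>w\<close> and
  \<open>v\<close>, and agreement of flat sections may be tested at one vertex of the smaller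
  carrier.\<close>

lemma sheet_glue:
  assumes w: "d \<in> cells X" "w \<in> cube (dm d)" "w' \<in> cube (dm d)"
    "cube_dist (dm d) w w' < radius (ch d w)" "flat d S"
    and v: "e \<in> cells X" "v \<in> cube (dm e)" "v' \<in> cube (dm e)"
      "cube_dist (dm e) v v' < radius (ch e v)" "flat e R"
    and eq: "ch d w = ch e v" "ch d w' = ch e v'"
  shows "sim (d, w, S) (e, v, R) \<longleftrightarrow> sim (d, w', S) (e, v', R)"
proof -
  obtain k where k: "glue d w' e v' k" using glue_exists[OF w(1) v(1) w(3) v(3) eq(2)] .
  have near: "w \<in> support (dm d) w'" "k w = v" "glue d w e v k"
    using glue_near[OF k w(2,4) v(2)] eq(1) v(4) by auto
  have sub: "verts (dm d) w \<subseteq> verts (dm d) w'" using verts_sub(1)[OF w(3) near(1)] .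
  obtain u where u: "u \<in> verts (dm d) w" using verts_nonempty[OF w(2)] by blast
  then have u': "u \<in> verts (dm d) w'" using sub by blast
  show ?thesis
  proof
    assume "sim (d, w, S) (e, v, R)"
    then have "R (k u) = S u" using sim_glue near(3) u by blast
    then show "sim (d, w', S) (e, v', R)" using simI[OF w(5) v(5) k u'] by blast
  next
    assume "sim (d, w', S) (e, v', R)"
    then have "R (k u) = S u" using sim_glue k u' by blast
    then show "sim (d, w, S) (e, v, R)" using simI[OF w(5) v(5) near(3) u] by blast
  qed
qed

lemma sheet_det:
  assumes "sheet t s" "sheet t s'" "proj s = proj s'" shows "sim s s'"
proof -
  obtain d w w' S where 1: "sim t (d, w, S)" "sim s (d, w', S)"
    "cube_dist (dm d) w w' < radius (ch d w)"
    "d \<in> cells X" "w \<in> cube (dm d)" "w' \<in> cube (dm d)" "flat d S" "proj t = ch d w"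
      "proj s = ch d w'"
    using sheetE[OF assms(1)] .
  obtain e v v' R where 2: "sim t (e, v, R)" "sim s' (e, v', R)"
    "cube_dist (dm e) v v' < radius (ch e v)"
    "e \<in> cells X" "v \<in> cube (dm e)" "v' \<in> cube (dm e)" "flat e R" "proj t = ch e v"
      "proj s' = ch e v'"
    using sheetE[OF assms(2)] .
  have "sim (d, w, S) (e, v, R)" using sim_trans[OF sim_sym[OF 1(1)] 2(1)] .
  then have "sim (d, w', S) (e, v', R)"
    using sheet_glue[OF 1(4-6,3,7) 2(4-6,3,7)] 1(8,9) 2(8,9) assms(3) by simp
  then show ?thesis using sim_trans[OF sim_trans[OF 1(2)]] sim_sym[OF 2(2)] by blast
qed

lemma sheet_inj:
  assumes "sheet t s" "sheet t' s" "proj t = proj t'" shows "sim t t'"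
proof -
  obtain d w w' S where 1: "sim t (d, w, S)" "sim s (d, w', S)"
    "cube_dist (dm d) w w' < radius (ch d w)"
    "d \<in> cells X" "w \<in> cube (dm d)" "w' \<in> cube (dm d)" "flat d S" "proj t = ch d w"
      "proj s = ch d w'"
    using sheetE[OF assms(1)] .
  obtain e v v' R where 2: "sim t' (e, v, R)" "sim s (e, v', R)"
    "cube_dist (dm e) v v' < radius (ch e v)"
    "e \<in> cells X" "v \<in> cube (dm e)" "v' \<in> cube (dm e)" "flat e R" "proj t' = ch e v"
      "proj s = ch e v'"
    using sheetE[OF assms(2)] .
  have "sim (d, w', S) (e, v', R)" using sim_trans[OF sim_sym[OF 1(2)] 2(2)] .
  then have "sim (d, w, S) (e, v, R)"
    using sheet_glue[OF 1(4-6,3,7) 2(4-6,3,7)] 1(8,9) 2(8,9) assms(3) by simp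
  then show ?thesis using sim_trans[OF sim_trans[OF 1(1)]] sim_sym[OF 2(1)] by blast
qed

lemma sheet_open:
  assumes q: "q \<in> topspace (realization X)"
  shows "\<exists>W. openin (realization X) W \<and> q \<in> W \<and>
      (\<forall>t\<in>total. proj t = q \<longrightarrow> (\<forall>p\<in>W. \<exists>s. proj s = p \<and> sheet t s)) \<and>
      (\<forall>s\<in>total. proj s \<in> W \<longrightarrow> (\<exists>t. proj t = q \<and> sheet t s))"
proof (intro exI[of _ "chart_ball q (radius q)"] conjI ballI impI)
  show "openin (realization X) (chart_ball q (radius q))" by (rule open_chart_ball) simp
  obtain c z where cz: "c \<in> cells X" "z \<in> cube (dm c)" "ch c z = q" using q
    unfolding realization_points by blast
  then show "q \<in> chart_ball q (radius q)"
    unfolding chart_ball_def using radius_bounds(1)[of q]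
      by (auto intro!: bexI[of _ c] bexI[of _ z])
next
  fix t p assume t: "t \<in> total" "proj t = q" and p: "p \<in> chart_ball q (radius q)"
  obtain d w w' where d: "d \<in> cells X" "w \<in> cube (dm d)" "w' \<in> cube (dm d)" "ch d w = q"
    "ch d w' = p"
    "cube_dist (dm d) w w' < radius q" using p unfolding chart_ball_def by blast
  obtain c z S where tc: "t = (c, z, S)" by (cases t)
  obtain R where R: "sim t (d, w, R)" using sim_exists[OF t(1)[unfolded tc] d(1,2)] t(2) d(4)
    unfolding tc by auto
  then have "(d, w', R) \<in> total" using sim_total[OF R] d unfolding total_iff by blast
  then have "sheet t (d, w', R)" using sheetI[OF R sim_refl] d by simp
  then show "\<exists>s. proj s = p \<and> sheet t s" using d(5) by (intro exI[of _ "(d, w', R)"]) simp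
next
  fix s assume s: "s \<in> total" "proj s \<in> chart_ball q (radius q)"
  obtain d w w' where d: "d \<in> cells X" "w \<in> cube (dm d)" "w' \<in> cube (dm d)" "ch d w = q"
    "ch d w' = proj s"
    "cube_dist (dm d) w w' < radius q" using s(2) unfolding chart_ball_def by blast
  obtain c z S where sc: "s = (c, z, S)" by (cases s)
  obtain R where R: "sim s (d, w', R)" using sim_exists[OF s(1)[unfolded sc] d(1,3)] d(5)
    unfolding sc by auto
  then have "(d, w, R) \<in> total" using sim_total[OF R] d unfolding total_iff by blast
  then have "sheet (d, w, R) s" using sheetI[OF sim_refl R] d by simp
  then show "\<exists>t. proj t = q \<and> sheet t s" using d(4) by (intro exI[of _ "(d, w, R)"]) simp
qed

lemma sheet_trans:
  assumes "sheet t s"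
  shows "\<exists>W. openin (realization X) W \<and> proj s \<in> W \<and> (\<forall>u. sheet s u \<and> proj u \<in> W \<longrightarrow> sheet t u)"
proof -
  obtain d w w' S where 1: "sim t (d, w, S)" "sim s (d, w', S)"
    "cube_dist (dm d) w w' < radius (ch d w)"
    "d \<in> cells X" "w \<in> cube (dm d)" "w' \<in> cube (dm d)" "flat d S" "proj t = ch d w"
      "proj s = ch d w'"
    using sheetE[OF assms] .
  \<comment> \<open>The second term is the room left at \<open>w'\<close> inside the ball around
    \<open>w\<close>.\<close>
  define \<delta> where "\<delta> = min (radius (proj s)) (radius (ch d w) - cube_dist (dm d) w w')"
  have \<delta>: "0 < \<delta>" "\<delta> \<le> radius (proj s)" unfolding \<delta>_def using radius_bounds(1) 1(3) by auto
  have "sheet t u" if u: "sheet s u" "proj u \<in> chart_ball (proj s) \<delta>" for u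
  proof -
    obtain e v v' R where 2: "sim s (e, v, R)" "sim u (e, v', R)"
      "cube_dist (dm e) v v' < radius (ch e v)"
      "e \<in> cells X" "v \<in> cube (dm e)" "v' \<in> cube (dm e)" "flat e R" "proj s = ch e v"
        "proj u = ch e v'"
      using sheetE[OF u(1)] .
    obtain z where z: "z \<in> cube (dm e)" "ch e z = proj s" "cube_dist (dm e) z v' < \<delta>"
      using u(2) chart_ball_iff[OF \<delta>(2) 2(4,6)] 2(9) by auto
    have "cube_dist (dm e) z v < 2 * radius (ch e z)"
      using cube_dist_tri[of "dm e" z v v'] cube_dist_sym[of "dm e" v v'] z(2,3) \<delta>(2) 2(3,8) by simp
    then have "z = v" using near_equal[OF 2(4) z(1) 2(5)] z(2) 2(8) by simp
    \<comment> \<open>The gluing at \<open>w'\<close> and \<open>v\<close> carries the centre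
      \<open>w\<close> into the cell \<open>e\<close>, where the triangle inequality can be
      applied.\<close>
    have svd: "sim (d, w', S) (e, v, R)" using sim_trans[OF sim_sym[OF 1(2)] 2(1)] .
    obtain k where k: "glue d w' e v k" using simE[OF svd] by metis
    have ws: "w \<in> support (dm d) w'" using near_support_radius[OF 1(4,5,6,3)] .
    have gw: "glue d w e (k w) k" using glue_restrict[OF k ws] .
    obtain a where a: "a \<in> verts (dm d) w" using verts_nonempty[OF 1(5)] by blast
    have "a \<in> verts (dm d) w'" using a verts_sub(1)[OF 1(6) ws] by blast
    then have "R (k a) = S a" using sim_glue[OF svd k] by blast
    then have 3: "sim (d, w, S) (e, k w, R)" using simI[OF 1(7) 2(7) gw a] by blast
    have "k w' = v" using k unfolding glue_def by blast
    then have "cube_dist (dm e) (k w) v = cube_dist (dm d) w w'"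
      using glue_dist[OF k ws support_self[OF 1(6)]] by simp
    then have "cube_dist (dm e) (k w) v' < radius (ch d w)"
      using cube_dist_tri[of "dm e" "k w" v' v] z(3) \<open>z = v\<close> unfolding \<delta>_def by simp
    moreover have "ch e (k w) = ch d w" using sim_proj[OF 3] by simp
    ultimately show ?thesis using sheetI[OF sim_trans[OF 1(1) 3] 2(2)] by simp
  qed
  moreover have "proj s \<in> chart_ball (proj s) \<delta>"
    unfolding 1(9) using chart_ball_iff[OF \<delta>(2)[unfolded 1(9)] 1(4,6)] \<delta>(1) 1(6)
      by (auto intro!: bexI[of _ w'])
  ultimately show ?thesis using open_chart_ball[OF \<delta>(2)] by blast
qed

sublocale cov: covering "realization X" total proj sim sheet
proof
  show "sheet s' t'" if st: "sheet s t" "sim s s'" "sim t t'" for s t s' t'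
  proof -
    obtain d w w' S where 1: "sim s (d, w, S)" "sim t (d, w', S)"
      "cube_dist (dm d) w w' < radius (ch d w)"
      using sheetE[OF st(1)] by metis
    show ?thesis
      using sheetI[OF sim_trans[OF sim_sym[OF st(2)] 1(1)] sim_trans[OF sim_sym[OF st(3)] 1(2)] 1(3)] .
  qed
  show "sheet t t" if "t \<in> total" for t
  proof -
    obtain c z S where t: "t = (c, z, S)" by (cases t)
    show ?thesis unfolding t
      using sheetI[of _ c z S _ z] sim_refl[OF that[unfolded t]] radius_bounds(1) by simp
  qed
  show "proj t \<in> topspace (realization X)" if "t \<in> total" for t
  proof -
    obtain c z S where t: "t = (c, z, S)" by (cases t)
    then have "c \<in> cells X" "z \<in> cube (dm c)" using that total_iff by blast+
    then show ?thesis unfolding t realization_points by auto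
  qed
  show "s \<in> total \<and> t \<in> total \<and> proj s = proj t" if "sim s t" for s t
    using sim_total[OF that] sim_proj[OF that] by simp
qed (fact sim_refl sim_sym sim_trans sheet_total sheet_det sheet_inj sheet_open sheet_trans)+

lemma pathin_edge:
  assumes c: "c \<in> cells X" and x: "x \<in> corners (dm c)" and i: "i < dm c"
  shows "pathin (realization X) (ep c x i)"
proof -
  let ?f = "\<lambda>t. seg x i (clamp01 t)"
  have xc: "x \<in> cube (dm c)" using x corners_cube by blast
  have "continuous_map (top_of_set {0..1}) (cube_topology (dm c)) ?f"
    unfolding cube_topology_def continuous_map_componentwise
  proof (intro conjI ballI)
    show "?f ` topspace (top_of_set {0..1}) \<subseteq> extensional {..<dm c}"
      using seg_cube[OF xc i] unfolding cube_def by (auto simp: PiE_iff)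
    fix k assume k: "k \<in> {..<dm c}"
    have "continuous_on {0..1} (\<lambda>t. ?f t k)"
      unfolding seg_apply clamp01_def by (cases "k = i") (auto intro!: continuous_intros)
    moreover have "?f t k \<in> {0..1}" for t
      using cube_bounds[OF seg_cube[OF xc i], of "clamp01 t" k] k by simp
    ultimately show "continuous_map (top_of_set {0..1}) (top_of_set {0..1}) (\<lambda>t. ?f t k)"
      by (simp add: continuous_map_in_subtopology image_subset_iff del: clamp01_id)
  qed
  from continuous_map_compose[OF this continuous_chart[OF c]]
  show ?thesis unfolding pathin_def edge_path_def o_def .
qed

lemma reach_edge:
  assumes c: "c \<in> cells X" and x: "x \<in> corners (dm c)" and i: "i < dm c" and S: "flat c S"
  shows "cov.reach (c, x, S) (c, flip i x, S)"
proof -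
  let ?l = "\<lambda>t. (c, seg x i (clamp01 t), S)"
  have xc: "x \<in> cube (dm c)" using x corners_cube by blast
  have tot: "?l t \<in> total" for t unfolding total_iff using c S seg_cube[OF xc i] by simp
  have "cov.lift {0..1} (ep c x i) ?l"
    unfolding cov.lift_def
  proof (intro conjI ballI)
    fix s :: real assume s: "s \<in> {0..1}"
    show "?l s \<in> total" using tot .
    show "proj (?l s) = ep c x i s" unfolding edge_path_def by simp
    have "sheet (?l s) (?l t)" if t: "t \<in> {0..1}" "dist s t < radius (proj (?l s))" for t
    proof (rule sheetI[OF sim_refl sim_refl])
      have "cube_dist (dm c) (seg x i s) (seg x i t) = \<bar>s - t\<bar>"
        unfolding cube_dist_def L2_set_def seg_sum[OF x i] by simp
      then show "cube_dist (dm c) (seg x i (clamp01 s)) (seg x i (clamp01 t)) < radius (ch c (seg x i (clamp01 s)))"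
        using s t by (simp add: dist_real_def)
    qed (rule tot)+
    then show "\<exists>\<delta>>0. \<forall>t\<in>{0..1}. dist s t < \<delta> \<longrightarrow> sheet (?l s) (?l t)" using radius_bounds(1) by blast
  qed
  moreover have "sim (?l 0) (c, x, S)" "sim (?l 1) (c, flip i x, S)"
    using sim_refl[OF tot[of 0]] sim_refl[OF tot[of 1]] by simp_all
  ultimately show ?thesis unfolding cov.reach_def using pathin_edge[OF c x i] by blast
qed

definition over :: "'p \<Rightarrow> 'a \<Rightarrow> 'c \<times> (nat \<Rightarrow> real) \<times> ((nat \<Rightarrow> real) \<Rightarrow> 'a) \<Rightarrow> bool"
  where "over v a t \<longleftrightarrow> (\<exists>c x S. t = (c, x, S) \<and> t \<in> total \<and> x \<in> corners (dm c) \<and> ch c x = v \<and> S x =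
    a)"

text \<open>The carrier of a corner is the corner itself, so over a vertex \<open>sim\<close>
  compares a single value and the fibre of the covering is \<open>Fib v\<close>.\<close>

lemma over_sim: "over v a t \<Longrightarrow> over v a' t' \<Longrightarrow> sim t t' \<longleftrightarrow> a = a'"
proof -
  assume "over v a t" "over v a' t'"
  then obtain c x S d y R where t: "t = (c, x, S)" "(c, x, S) \<in> total" "x \<in> corners (dm c)"
    "ch c x = v" "S x = a"
    "t' = (d, y, R)" "(d, y, R) \<in> total" "y \<in> corners (dm d)" "ch d y = v" "R y = a'"
    unfolding over_def by blast
  have T: "c \<in> cells X" "x \<in> cube (dm c)" "flat c S" "d \<in> cells X" "y \<in> cube (dm d)" "flat d R"
    using t(2,7) unfolding total_iff by auto
  obtain h where h: "glue c x d y h" using glue_exists[OF T(1,4,2,5)] t(4,9) by auto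
  have "h x = y" using h unfolding glue_def by blast
  moreover have "x \<in> verts (dm c) x" using verts_corner[OF t(3)] by simp
  ultimately show ?thesis
    using simI[OF T(3,6) h] sim_glue[OF _ h] t(1,5,6,10) by metis
qed

lemma over_exists:
  assumes "c \<in> cells X" "x \<in> corners (dm c)" "a \<in> Fib (ch c x)"
  obtains S where "over (ch c x) a (c, x, S)" "flat c S" "S x = a"
proof -
  obtain S where "flat c S" "S x = a" using flat_exists[OF assms] .
  then show thesis using that assms corners_cube unfolding over_def total_iff by blast
qed

text \<open>The edge path is lifted edge by edge; at each vertex the section is replaced by one on
  the cell of the next edge with the same value there.\<close>

lemma word_reach:
  assumes "path_word X b w v" "a \<in> Fib b" "over b a t"
  shows "foldr act w a \<in> Fib v \<and> (\<exists>t'. over v (foldr act w a) t' \<and> cov.reach t t')"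
  using assms(1)
proof (induction rule: path_word.induct)
  case Nil
  have "t \<in> total" using assms(3) unfolding over_def by blast
  then show ?case using assms cov.reach_refl by (intro conjI exI[of _ t]) simp_all
next
  case (Cons w c x i)
  let ?a = "foldr act w a"
  obtain t' where t': "over (ch c x) ?a t'" "cov.reach t t'" "?a \<in> Fib (ch c x)" using Cons by blast
  obtain S where S: "over (ch c x) ?a (c, x, S)" "flat c S" "S x = ?a"
    using over_exists[OF Cons(2,3) t'(3)] .
  have "sim t' (c, x, S)" using over_sim[OF t'(1) S(1)] by simp
  then have "cov.reach t (c, x, S)"
    using t'(2) unfolding cov.reach_def using sim_trans by blast
  then have r: "cov.reach t (c, flip i x, S)" using cov.reach_trans reach_edge[OF Cons(2-4) S(2)]
    by blast
  have "S (flip i x) = act (ep c x i) ?a" using S Cons(3,4) unfolding flat_def by simp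
  moreover have "flip i x \<in> corners (dm c)" using flip_corners Cons by blast
  ultimately have "over (ch c (flip i x)) (act (ep c x i) ?a) (c, flip i x, S)"
    using Cons(2) S(2) corners_cube unfolding over_def total_iff by blast
  then show ?case using r act_Fib[OF Cons(2-4) t'(3)] by auto
qed

text \<open>The lifts of both words from one start end over the same vertex and are joined by a
  lifted path, so trivial monodromy identifies them.\<close>

lemma word_unique:
  assumes sc: "simply_connected_space (realization X)" and w: "path_word X b w v"
    "path_word X b w' v"
    and a: "a \<in> Fib b" and b: "b \<in> vertices X"
  shows "foldr act w a = foldr act w' a"
proof -
  obtain c x where cx: "c \<in> cells X" "x \<in> corners (dm c)" "ch c x = b" using b
    unfolding vertices_def by blast
  obtain S where S: "over b a (c, x, S)" using over_exists[OF cx(1,2)] a cx(3) by metis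
  obtain t where t: "over v (foldr act w a) t" "cov.reach (c, x, S) t" using word_reach[OF w(1) a S]
    by blast
  obtain t' where t': "over v (foldr act w' a) t'" "cov.reach (c, x, S) t'"
    using word_reach[OF w(2) a S] by blast
  have "proj t = v" "proj t' = v" using t(1) t'(1) unfolding over_def by auto
  then have "sim t t'"
    using cov.reach_closed[OF sc cov.reach_trans[OF cov.reach_sym[OF t(2)] t'(2)]] by simp
  then show ?thesis using over_sim[OF t(1) t'(1)] by simp
qed

end

section \<open>Edge paths in CAT(0) cube complexes\<close>

locale cat0_complex =
  fixes X :: "('c, 'p) cube_data" and N :: nat
  assumes cat0: "CAT0_cube_complex X" and dim: "c \<in> cells X \<Longrightarrow> cdim X c \<le> N"
begin

sublocale flag_links X
  using cat0 unfolding CAT0_cube_complex_def by unfold_locales blast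

sublocale cube_cx X
  using cat0 unfolding CAT0_cube_complex_def by unfold_locales blast

lemma sc: "simply_connected_space (realization X)"
  using cat0 unfolding CAT0_cube_complex_def by blast

abbreviation "V \<equiv> vertices X"
abbreviation "pw \<equiv> path_word X"

definition edge :: "(real \<Rightarrow> 'p) \<Rightarrow> bool"
  where "edge e \<longleftrightarrow> (\<exists>c x i. c \<in> cells X \<and> x \<in> corners (dm c) \<and> i < dm c \<and> e = edge_path X c x i)"

lemma edge_ends: "edge e \<Longrightarrow> e 0 \<in> V \<and> e 1 \<in> V"
  unfolding edge_def using vertexI flip_corners by (metis edge_path_0 edge_path_1)

lemma edge_reverse: "edge e \<Longrightarrow> edge (reverse e)"
  unfolding edge_def using reverse_edge_path flip_corners by metis

lemma reverse_0 [simp]: "reverse e 0 = e 1" and reverse_1 [simp]: "reverse e 1 = e 0"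
  unfolding reverse_def by auto

lemma pw_Nil_iff [simp]: "pw b [] v \<longleftrightarrow> b \<in> V \<and> v = b"
  by (auto intro: path_word.intros elim: path_word.cases)

lemma pw_Cons_iff [simp]: "pw b (e # w) v \<longleftrightarrow> edge e \<and> pw b w (e 0) \<and> v = e 1"
proof
  assume "pw b (e # w) v"
  then show "edge e \<and> pw b w (e 0) \<and> v = e 1"
    by (cases rule: path_word.cases) (auto simp: edge_def edge_path_0 edge_path_1)
next
  assume *: "edge e \<and> pw b w (e 0) \<and> v = e 1"
  then obtain c x i where "c \<in> cells X" "x \<in> corners (dm c)" "i < dm c" "e = edge_path X c x i"
    unfolding edge_def by blast
  then show "pw b (e # w) v" using * path_word.Cons[of X b w c x i]
    by (simp add: edge_path_0 edge_path_1)
qed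

lemma perp_ends: "perp X e f \<Longrightarrow> edge e \<and> edge f \<and> edge (transport X e f) \<and> f 0 = e 0 \<and>
    transport X e f 0 = e 1 \<and> transport X f e 1 = transport X e f 1"
proof -
  assume "perp X e f"
  then obtain c x i j where s: "spans X e f c x i j" unfolding perp_def by blast
  have t: "transport X e f = edge_path X c (flip i x) j"
    "transport X f e = edge_path X c (flip j x) i"
    using transport_eq[OF s] transport_eq[OF spans_commute[OF s]] .
  have "flip i x \<in> corners (dm c)" using flip_corners s unfolding spans_def by blast
  then show ?thesis using s t unfolding spans_def edge_def
    by (auto simp: edge_path_0 edge_path_1 flip_commute)
qed

lemma pw_vertex: "pw b w v \<Longrightarrow> b \<in> V \<and> v \<in> V"
  by (induction w arbitrary: v) (use edge_ends in auto)

lemma pw_swap: "swap w w' \<Longrightarrow> pw b w v \<Longrightarrow> pw b w' v"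
proof (induction arbitrary: v rule: swap.induct)
  case (swap_hd e f w)
  have ef: "edge f" "f 0 = e 0" "transport X f e 1 = transport X e f 1"
    using perp_ends[OF swap_hd(1)] by auto
  have fe: "edge (transport X f e)" "transport X f e 0 = f 1"
    using perp_ends[OF perp_sym[OF swap_hd(1)]] by auto
  show ?case using swap_hd(2) by (simp add: ef fe)
qed auto

lemma pw_eqv: "eqv w w' \<Longrightarrow> pw b w v \<Longrightarrow> pw b w' v"
  by (induction rule: rtranclp_induct) (auto intro: pw_swap)

section \<open>Reduced paths are geodesics\<close>

definition fibre :: "'p \<Rightarrow> 'p \<Rightarrow> (real \<Rightarrow> 'p) list set set"
  where "fibre b v = {cls w | w. pw b w v \<and> reduced w}"

lemma act_step:
  assumes "edge e" "pw b w (e 0)" "reduced w"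
  obtains w' where "act e (cls w) = cls w'" "pw b w' (e 1)" "reduced w'"
    "w' = e # w \<or> eqv w (reverse e # w')"
proof -
  obtain w' where w': "reduced w'" "act e (cls w) = cls w'" "w' = e # w \<or> eqv w (reverse e # w')"
    using act_reduced[OF assms(3)] by blast
  have "pw b w' (e 1)"
    using w'(3)
  proof
    assume "eqv w (reverse e # w')"
    then show ?thesis using pw_eqv[OF _ assms(2)] by force
  qed (use assms in simp)
  then show thesis using that w' by blast
qed

lemma local_system_fibre: "local_system X (fibre b) act"
proof
  fix c x i a
  assume cx: "c \<in> cells X" "x \<in> corners (cdim X c)" "i < cdim X c"
    and a: "a \<in> fibre b (chart X c x)"
  then obtain w where w: "a = cls w" "pw b w (chart X c x)" "reduced w" unfolding fibre_def by blast
  let ?e = "edge_path X c x i"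
  have e: "edge ?e" using cx unfolding edge_def by blast
  show "act ?e a \<in> fibre b (chart X c (flip i x))"
  proof -
    have "pw b w (?e 0)" using w(2) by (simp add: edge_path_0)
    then obtain w' where "act ?e (cls w) = cls w'" "pw b w' (?e 1)" "reduced w'"
      using act_step[OF e _ w(3)] by metis
    then show ?thesis unfolding fibre_def w(1) edge_path_1 by blast
  qed
  show "act (edge_path X c (flip i x) i) (act ?e a) = a"
    using act_inv[OF w(3), of ?e] w(1) unfolding reverse_edge_path by simp
  fix j assume j: "j < cdim X c" "i \<noteq> j"
  have s: "spans X ?e (edge_path X c x j) c x i j" using cx j unfolding spans_def by simp
  then have "perp X ?e (edge_path X c x j)" unfolding perp_def by blast
  from act_square[OF this w(3)]
  show "act (edge_path X c (flip i x) j) (act ?e a) =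
    act (edge_path X c (flip j x) i) (act (edge_path X c x j) a)"
    unfolding w(1) transport_eq[OF s] transport_eq[OF spans_commute[OF s]] .
qed

text \<open>Letting the letters act one by one on the empty class reduces the word. A cancellation
  makes the result strictly shorter, so equal length means that nothing was cancelled.\<close>

lemma reduce_word:
  assumes "pw b w v"
  obtains r where "pw b r v" "reduced r" "foldr act w (cls []) = cls r" "length r \<le> length w"
    "length r = length w \<Longrightarrow> reduced w \<and> r = w"
proof -
  have "\<exists>r. pw b r v \<and> reduced r \<and> foldr act w (cls []) = cls r \<and> length r \<le> length w \<and>
      (length r = length w \<longrightarrow> reduced w \<and> r = w)"
    using assms
  proof (induction w arbitrary: v)
    case Nil then show ?case by (intro exI[of _ "[]"]) simp
  next
    case (Cons e w)
    then obtain r where r: "pw b r (e 0)" "reduced r" "foldr act w (cls []) = cls r"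
      "length r \<le> length w"
      "length r = length w \<longrightarrow> reduced w \<and> r = w" by fastforce
    obtain w' where w': "act e (cls r) = cls w'" "pw b w' (e 1)" "reduced w'"
      "w' = e # r \<or> eqv r (reverse e # w')"
    proof (rule act_step[of e b r])
      show "edge e" using Cons(2) by simp
      show "pw b r (e 0)" "reduced r" using r by auto
    qed blast
    have L: "length w' = Suc (length r) \<or> length r = Suc (length w')"
      using w'(4) eqv_length[of r "reverse e # w'"] by auto
    have full: "reduced (e # w) \<and> w' = e # w" if "length w' = length (e # w)"
    proof -
      have "length r = length w" using that L r(4) by auto
      moreover have "w' = e # r" using w'(4) eqv_length[of r "reverse e # w'"] that L r(4) by auto
      ultimately show ?thesis using r(5) w'(3) by auto
    qed
    show ?case
    proof (intro exI[of _ w'] conjI impI)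
      show "pw b w' v" "reduced w'" using w'(2,3) Cons(2) by simp_all
      show "foldr act (e # w) (cls []) = cls w'" using r(3) w'(1) by simp
      show "length w' \<le> length (e # w)" using L r(4) by auto
    qed (use full in blast)+
  qed
  then show thesis using that by blast
qed

text \<open>Simple connectedness enters here: the action of a word on the class of the empty path
  depends only on the ends, and a reduced word returns its own class.\<close>

lemma reduced_unique:
  assumes "pw b w v" "pw b w' v" "reduced w" "reduced w'"
  shows "eqv w w'"
proof -
  interpret local_system X "fibre b" act by (rule local_system_fibre)
  have b: "b \<in> V" using pw_vertex assms(1) by blast
  then have "cls [] \<in> fibre b b" unfolding fibre_def by force
  then have "foldr act w (cls []) = foldr act w' (cls [])" using word_unique[OF sc assms(1,2)] b
    by blast
  moreover have "foldr act u (cls []) = cls u" if "reduced u" for u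
    using that by (induction u) (auto simp: act_push)
  ultimately show ?thesis using assms(3,4) cls_eq by metis
qed

lemma edges_iff: "(u, v) \<in> edges X \<longleftrightarrow> (\<exists>e. edge e \<and> e 0 = u \<and> e 1 = v)"
  unfolding edges_def edge_def
    by (auto simp: edge_path_0 edge_path_1 flip_def) (metis edge_path_0 edge_path_1 flip_def)+

lemma relpow_iff: "b \<in> V \<Longrightarrow> (b, v) \<in> edges X ^^ n \<longleftrightarrow> (\<exists>w. pw b w v \<and> length w = n)"
proof (induction n arbitrary: v)
  case (Suc n)
  have "(b, v) \<in> edges X ^^ Suc n \<longleftrightarrow> (\<exists>u. (b, u) \<in> edges X ^^ n \<and> (u, v) \<in> edges X)" by auto
  also have "\<dots> \<longleftrightarrow> (\<exists>w e. pw b (e # w) v \<and> length w = n)" using Suc edges_iff by auto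
  also have "\<dots> \<longleftrightarrow> (\<exists>w. pw b w v \<and> length w = Suc n)"
    unfolding length_Suc_conv by blast
  finally show ?case .
qed auto

abbreviation "edist \<equiv> edge_dist X"

text \<open>Reduced words with the same ends have equal length, since flips preserve length, and
  every word reduces to one that is at most as long.\<close>

lemma dist_reduced:
  assumes "pw b r v" "reduced r"
  shows "edist b v = length r"
  unfolding edge_dist_def
proof (rule Least_equality)
  have b: "b \<in> V" using pw_vertex assms(1) by blast
  show "(b, v) \<in> edges X ^^ length r" using relpow_iff[OF b] assms(1) by blast
  fix n assume "(b, v) \<in> edges X ^^ n"
  then obtain w where w: "pw b w v" "length w = n" using relpow_iff[OF b] by blast
  obtain r' where r': "pw b r' v" "reduced r'" "length r' \<le> length w" using reduce_word[OF w(1)]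
    by metis
  then show "length r \<le> n"
    using eqv_length[OF reduced_unique[OF assms(1) r'(1) assms(2) r'(2)]] w(2) by simp
qed

lemma dist_le: "pw b w v \<Longrightarrow> edist b v \<le> length w"
  using reduce_word dist_reduced by metis

lemma geodesic_reduced: "pw b w v \<Longrightarrow> length w = edist b v \<Longrightarrow> reduced w"
  using reduce_word dist_reduced by metis

text \<open>The cells with corners reachable from \<open>b\<close> and the remaining cells have
  disjoint open images that cover the connected realization.\<close>

lemma word_exists:
  assumes b: "b \<in> V" and v: "v \<in> V"
  shows "\<exists>w. pw b w v"
proof -
  define R where "R c \<longleftrightarrow> (\<exists>x\<in>corners (dm c). \<exists>w. pw b w (ch c x))" for c
  have all: "\<exists>w. pw b w (ch c y)" if Rc: "R c" "c \<in> cells X" "y \<in> corners (dm c)" for c y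
  proof -
    obtain x where x: "x \<in> corners (dm c)" "\<exists>w. pw b w (ch c x)" using Rc(1) unfolding R_def
      by blast
    show ?thesis
    proof (rule rel_corners_induct[of "{..<dm c}" "dm c" y x x "\<lambda>y. \<exists>w. pw b w (ch c y)"])
      fix a i assume "a \<in> rel_corners (dm c) x {..<dm c}" "i \<in> {..<dm c}" "\<exists>w. pw b w (ch c a)"
      then obtain w where "pw b w (ch c a)" "a \<in> corners (dm c)" "i < dm c"
        using rel_corners_all[OF x(1)] by auto
      from path_word.Cons[OF this(1) Rc(2) this(2,3)] show "\<exists>w. pw b w (ch c (flip i a))" ..
    qed (use Rc x rel_corners_all[OF x(1)] in auto)
  qed
  have R_iff: "R c \<longleftrightarrow> R d" if cd: "c \<in> cells X" "d \<in> cells X" "z \<in> cube (dm c)" "w \<in> cube (dm d)"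
    "ch c z = ch d w" for c d z w
  proof -
    have half: "R d" if cd: "c \<in> cells X" "d \<in> cells X" "z \<in> cube (dm c)" "w \<in> cube (dm d)"
      "ch c z = ch d w" "R c" for c d z w
    proof -
      obtain h where h: "glue c z d w h" using glue_exists[OF cd(1-5)] .
      obtain u where u: "u \<in> verts (dm c) z" using verts_nonempty[OF cd(3)] by blast
      have "u \<in> support (dm c) z" using u unfolding support_face rel_corners_def by auto
      then have "ch c u = ch d (h u)" using glue_chart[OF h] by blast
      moreover have "h u \<in> corners (dm d)" using verts_corners[OF cd(4) glue_verts[OF h u]] .
      moreover have "\<exists>w. pw b w (ch c u)" using all[OF cd(6,1) verts_corners[OF cd(3) u]] .
      ultimately show ?thesis unfolding R_def by metis
    qed
    show ?thesis by (rule iffI, erule half[OF cd], erule half[OF cd(2,1,4,3) cd(5)[symmetric]])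
  qed
  \<comment> \<open>Gluing never mixes the two kinds of cells, so the preimage of each set in a cell
    is everything or empty.\<close>
  define U where "U P = (\<Union>c\<in>{c \<in> cells X. R c = P}. ch c ` cube (dm c))" for P
  have open_U: "openin (realization X) (U P)" for P
  proof (rule open_realization)
    show "U P \<subseteq> topspace (realization X)" unfolding U_def realization_points by blast
    fix d assume d: "d \<in> cells X"
    have "ch d w \<in> U P \<longleftrightarrow> R d = P" if "w \<in> cube (dm d)" for w
      using R_iff[OF d _ that] d that unfolding U_def by blast
    then have "{w \<in> cube (dm d). ch d w \<in> U P} = (if R d = P then cube (dm d) else {})" by auto
    then show "openin (cube_topology (dm d)) {w \<in> cube (dm d). ch d w \<in> U P}"
      using openin_topspace[of "cube_topology (dm d)"] by (simp add: topspace_cube)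
  qed
  have disj: "U True \<inter> U False = {}" using R_iff unfolding U_def by blast
  have un: "topspace (realization X) = U True \<union> U False" unfolding U_def realization_points by auto
  have "connected_space (realization X)"
    using sc path_connected_imp_connected_space unfolding simply_connected_space_def by blast
  then have "U True = {} \<or> U False = {}"
    using open_U disj un unfolding connected_space_def by (metis order_refl)
  moreover have "b \<in> U True"
  proof -
    obtain c x where "c \<in> cells X" "x \<in> corners (dm c)" "ch c x = b" using b unfolding vertices_def
      by blast
    moreover have "R c" using calculation b unfolding R_def
      by (intro bexI[of _ x] exI[of _ "[]"]) auto
    ultimately show ?thesis unfolding U_def using corners_cube by blast
  qed
  ultimately have "U False = {}" by blast
  obtain d y where d: "d \<in> cells X" "y \<in> corners (dm d)" "ch d y = v" using v unfolding vertices_def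
    by blast
  have "R d" using \<open>U False = {}\<close> d(1) corners_cube[OF d(2)] unfolding U_def by blast
  then show ?thesis using all d by blast
qed

lemma reduced_exists:
  assumes "b \<in> V" "v \<in> V"
  obtains r where "pw b r v" "reduced r" "length r = edist b v"
  using word_exists[OF assms] reduce_word dist_reduced by metis

text \<open>Acting by one edge on a reduced word lengthens or shortens it by exactly one.\<close>

lemma edge_dist_step:
  assumes b: "b \<in> V" and e: "edge e"
  shows "edist b (e 1) = Suc (edist b (e 0)) \<or> edist b (e 0) = Suc (edist b (e 1))"
proof -
  obtain r where r: "pw b r (e 0)" "reduced r" "length r = edist b (e 0)"
    using reduced_exists[OF b] edge_ends[OF e] by blast
  obtain w' where w': "pw b w' (e 1)" "reduced w'" "w' = e # r \<or> eqv r (reverse e # w')"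
    using act_step[OF e r(1,2)] by metis
  then show ?thesis using dist_reduced[OF w'(1,2)] r(3) eqv_length[of r "reverse e # w'"] by auto
qed

text \<open>The geodesics ending in \<open>e1\<close> and in \<open>e2\<close> are flip equivalent,
  and the normal form at the last edge exhibits the square.\<close>

lemma corner_below:
  assumes b: "b \<in> V" and e: "edge e1" "edge e2" "e1 1 = e2 1" "e1 \<noteq> e2"
    and d: "edist b (e1 1) = Suc (edist b (e1 0))" "edist b (e1 1) = Suc (edist b (e2 0))"
  obtains e f where "perp X e f" "e1 = transport X e f" "e2 = transport X f e"
    "edist b (e1 0) = Suc (edist b (e 0))"
proof -
  obtain r1 where r1: "pw b r1 (e1 0)" "reduced r1" "length r1 = edist b (e1 0)"
    using reduced_exists[OF b] edge_ends[OF e(1)] by blast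
  obtain r2 where r2: "pw b r2 (e2 0)" "reduced r2" "length r2 = edist b (e2 0)"
    using reduced_exists[OF b] edge_ends[OF e(2)] by blast
  have 1: "pw b (e1 # r1) (e1 1)" "pw b (e2 # r2) (e1 1)" using r1 r2 e by auto
  have "reduced (e1 # r1)" "reduced (e2 # r2)"
    using geodesic_reduced[OF 1(1)] geodesic_reduced[OF 1(2)] r1(3) r2(3) d by simp_all
  then have "heads e1 r1 e2 r2" using eqv_heads reduced_unique[OF 1] by blast
  then obtain a f u where af: "perp X a f" "e1 = transport X a f" "e2 = transport X f a"
    "eqv r1 (a # u)"
    using e(4) unfolding heads_def by blast
  have "pw b (a # u) (e1 0)" "reduced (a # u)"
    using pw_eqv[OF af(4) r1(1)] reduced_eqv[OF af(4)] r1(2) by auto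
  then have "pw b u (a 0)" "reduced u" by auto
  then have "edist b (e1 0) = Suc (edist b (a 0))" using dist_reduced r1(3) eqv_length[OF af(4)]
    by simp
  then show thesis using that af by blast
qed

lemma dist_self: "b \<in> V \<Longrightarrow> edist b b = 0"
  using dist_reduced[of b "[]" b] by simp

lemma not_ends_Nil: "\<not> ends [] e"
  unfolding ends_def using eqv_length by force

lemma edge_dist_1: "edge e \<Longrightarrow> edist (e 0) (e 1) = 1"
  using dist_reduced[of "e 0" "[e]" "e 1"] edge_ends[of e] not_ends_Nil by simp

text \<open>By parity both paths of length 2 are geodesics, hence flip equivalent, and with
  different last edges this is a single flip.\<close>

lemma square_through:
  assumes V: "a \<in> V" and e: "edge e" "edge e'" "e 0 = a" "e' 0 = e 1" and f: "edge f" "edge f'"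
    "f 0 = a" "f' 0 = f 1"
    and ab: "e' 1 \<noteq> a" "f' 1 = e' 1" "e 1 \<noteq> f 1"
  shows "perp X e f \<and> e' = transport X e f"
proof -
  have "edist a (e 1) = 1" using edge_dist_1[OF e(1)] e(3) by simp
  then have "edist a (e' 1) = 2 \<or> edist a (e' 1) = 0" using edge_dist_step[OF V e(2)] e(4) by auto
  moreover have "edist a (e' 1) \<noteq> 0"
  proof
    assume "edist a (e' 1) = 0"
    moreover obtain r where "pw a r (e' 1)" "length r = edist a (e' 1)"
      using reduced_exists[OF V] edge_ends[OF e(2)] by blast
    ultimately show False using ab(1) by simp
  qed
  ultimately have d: "edist a (e' 1) = 2" by blast
  have w: "pw a [e', e] (e' 1)" "pw a [f', f] (e' 1)" using e f ab V by auto
  then have "reduced [e', e]" "reduced [f', f]"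
    using geodesic_reduced[OF w(1)] geodesic_reduced[OF w(2)] d ab(2)
    by (simp_all del: reduced.simps)
  then have "heads e' [e] f' [f]" using eqv_heads reduced_unique[OF w] by blast
  moreover have "e' \<noteq> f'" using e(4) f(4) ab(3) by auto
  ultimately obtain p q u where pq: "perp X p q" "e' = transport X p q" "eqv [e] (p # u)"
    "eqv [f] (q # u)" unfolding heads_def by blast
  have single: "g = p \<and> u = []" if "eqv [g] (p # u)" for g p u
    using eqv_heads[OF that] eqv_length[of "[]" u] eqv_length[of "[]" "_ # _"] unfolding heads_def
      by force
  then show ?thesis using pq single[OF pq(3)] single[OF pq(4)] by simp
qed

lemma edges_sym: "(u, v) \<in> edges X \<Longrightarrow> (v, u) \<in> edges X"
  unfolding edges_iff using edge_reverse reverse_0 reverse_1 by metis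

lemma relpow_edges_sym: "(u, v) \<in> edges X ^^ n \<Longrightarrow> (v, u) \<in> edges X ^^ n"
proof (induction n arbitrary: v)
  case (Suc n)
  then obtain w where "(u, w) \<in> edges X ^^ n" "(w, v) \<in> edges X" by auto
  then show ?case using Suc(1) edges_sym relpow_Suc_I2 by metis
qed simp

lemma pw_append: "pw a w c \<Longrightarrow> pw c w' e \<Longrightarrow> pw a (w' @ w) e"
  by (induction w' arbitrary: e) auto

sublocale quadrangle_graph V "\<lambda>u v. (u, v) \<in> edges X" edist
proof
  show "x \<in> V" if "(x, y) \<in> edges X" for x y using that edge_ends unfolding edges_iff by blast
  show "y \<in> V" if "(x, y) \<in> edges X" for x y using that edge_ends unfolding edges_iff by blast
  show "(y, x) \<in> edges X" if "(x, y) \<in> edges X" for x y using that by (rule edges_sym)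
  show "edist x y = 0 \<longleftrightarrow> x = y" if xy: "x \<in> V" "y \<in> V" for x y
  proof -
    obtain r where r: "pw x r y" "reduced r" "length r = edist x y" by (rule reduced_exists[OF xy])
    then show ?thesis using dist_self xy by (cases r) auto
  qed
  show "edist x y = edist y x" if "x \<in> V" "y \<in> V" for x y
    unfolding edge_dist_def using relpow_edges_sym by metis
  show "edist x z \<le> edist x y + edist y z" if xyz: "x \<in> V" "y \<in> V" "z \<in> V" for x y z
  proof -
    obtain r where r: "pw x r y" "length r = edist x y" by (rule reduced_exists[OF xyz(1,2)])
    obtain s where s: "pw y s z" "length s = edist y z" by (rule reduced_exists[OF xyz(2,3)])
    show ?thesis using dist_le[OF pw_append[OF r(1) s(1)]] r(2) s(2) by simp
  qed
  show "edist x y = 1" if "(x, y) \<in> edges X" for x y using that edge_dist_1 unfolding edges_iff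
    by blast
  show "\<exists>z. (y, z) \<in> edges X \<and> edist x z = n" if xy: "x \<in> V" "y \<in> V" "edist x y = Suc n" for x y n
  proof -
    obtain r where r: "pw x r y" "reduced r" "length r = edist x y"
      by (rule reduced_exists[OF xy(1,2)])
    then obtain e w where ew: "r = e # w" using xy(3) by (cases r) auto
    then have "edist x (e 0) = n" using r xy(3) dist_reduced[of x w "e 0"] by simp
    moreover have "(y, e 0) \<in> edges X" using r(1) ew edges_sym edges_iff by auto
    ultimately show ?thesis by blast
  qed
  show "edist b x = Suc (edist b y) \<or> edist b y = Suc (edist b x)" if "b \<in> V" "(x, y) \<in> edges X"
    for b x y
    using that edge_dist_step unfolding edges_iff by blast
  show "\<exists>u. (x, u) \<in> edges X \<and> (z, u) \<in> edges X \<and> edist b x = Suc (edist b u)"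
    if q: "b \<in> V" "(y, x) \<in> edges X" "(y, z) \<in> edges X" "x \<noteq> z" "edist b y = Suc (edist b x)"
      "edist b y = Suc (edist b z)" for b x y z
  proof -
    obtain e1 where e1: "edge e1" "e1 0 = x" "e1 1 = y" using edges_sym[OF q(2)] unfolding edges_iff
      by blast
    obtain e2 where e2: "edge e2" "e2 0 = z" "e2 1 = y" using edges_sym[OF q(3)] unfolding edges_iff
      by blast
    obtain e f where ef: "perp X e f" "e1 = transport X e f" "e2 = transport X f e"
      "edist b (e1 0) = Suc (edist b (e 0))"
      using corner_below[OF q(1) e1(1) e2(1)] e1 e2 q(4-6) by metis
    have "(x, e 0) \<in> edges X" "(z, e 0) \<in> edges X"
      using perp_ends[OF ef(1)] perp_ends[OF perp_sym[OF ef(1)]] ef(2,3) e1 e2 edges_sym edges_iff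
        by metis+
    then show ?thesis using ef(4) e1(2) by blast
  qed
  show "x = y \<or> x = z \<or> y = z" if k: "a \<noteq> b" "(a, x) \<in> edges X" "(a, y) \<in> edges X"
    "(a, z) \<in> edges X"
    "(b, x) \<in> edges X" "(b, y) \<in> edges X" "(b, z) \<in> edges X" for a b x y z
  proof (rule ccontr)
    assume ne: "\<not> ?thesis"
    obtain ex ey ez where e: "edge ex" "ex 0 = a" "ex 1 = x" "edge ey" "ey 0 = a" "ey 1 = y"
      "edge ez" "ez 0 = a" "ez 1 = z"
      using k(2-4) unfolding edges_iff by blast
    obtain fx fy fz where f: "edge fx" "fx 0 = x" "fx 1 = b" "edge fy" "fy 0 = y" "fy 1 = b"
      "edge fz" "fz 0 = z" "fz 1 = b"
      using k(5-7)[THEN edges_sym] unfolding edges_iff by blast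
    have aV: "a \<in> V" using edge_ends[OF e(1)] e(2) by simp
    \<comment> \<open>The squares through \<open>ey\<close> and through \<open>ez\<close> share two
      consecutive sides \<open>ex\<close> and \<open>fx\<close>, and \<open>res_inject\<close> then
      identifies \<open>ey\<close> with \<open>ez\<close>.\<close>
    have "perp X ex ey \<and> fx = transport X ex ey"
      using square_through[OF aV e(1) f(1) e(2) _ e(4) f(4) e(5)] e f ne k(1) by auto
    moreover have "perp X ex ez \<and> fx = transport X ex ez"
      using square_through[OF aV e(1) f(1) e(2) _ e(7) f(7) e(8)] e f ne k(1) by auto
    ultimately have "ey = ez" using res_inject by metis
    then show False using e ne by auto
  qed
qed

text \<open>Any two lower edges at \<open>y\<close> span a square by \<open>corner_below\<close>.
  Flagness of the link of \<open>y\<close> puts all of them into one cube, whose dimension bounds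
  their number.\<close>

lemma down_card:
  assumes b: "b \<in> V" and Z: "finite Z" "\<And>z. z \<in> Z \<Longrightarrow> (y, z) \<in> edges X \<and> edist b y = Suc (edist b z)"
  shows "card Z \<le> N"
proof (cases "Z = {}")
  case False
  have "\<forall>z\<in>Z. \<exists>e. edge e \<and> e 0 = y \<and> e 1 = z" using Z(2) edges_iff by blast
  then obtain g where g: "\<And>z. z \<in> Z \<Longrightarrow> edge (g z) \<and> g z 0 = y \<and> g z 1 = z" by metis
  have inj: "inj_on g Z" using g by (metis inj_onI)
  have perp: "perp X (g z) (g z')" if z: "z \<in> Z" "z' \<in> Z" "z \<noteq> z'" for z z'
  proof -
    have ne: "reverse (g z) \<noteq> reverse (g z')" using g z by (metis reverse_0)
    obtain e f where "perp X e f" "reverse (g z) = transport X e f"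
      "reverse (g z') = transport X f e"
    proof (rule corner_below[OF b _ _ _ ne])
      show "edge (reverse (g z))" "edge (reverse (g z'))" using edge_reverse g z by blast+
      show "reverse (g z) 1 = reverse (g z') 1" using g z by simp
      show "edist b (reverse (g z) 1) = Suc (edist b (reverse (g z) 0))"
        using g[OF z(1)] Z(2)[OF z(1)] by simp
      show "edist b (reverse (g z) 1) = Suc (edist b (reverse (g z') 0))"
        using g[OF z(1)] g[OF z(2)] Z(2)[OF z(2)] by simp
    qed
    \<comment> \<open>The square was found from its lowest corner; \<open>perp_top\<close> views it
      from \<open>y\<close>.\<close>
    then show ?thesis using perp_top reverse_reverse by metis
  qed
  obtain z0 where z0: "z0 \<in> Z" using False by blast
  have "\<exists>c x F. c \<in> cells X \<and> x \<in> corners (dm c) \<and> F \<subseteq> {..<dm c} \<and> g ` Z = edge_path X c x ` F"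
  proof (rule cube_of_perp[of "g ` Z" "g z0"])
    show "finite (g ` Z)" "g z0 \<in> g ` Z" using Z(1) z0 by auto
    show "e 0 = g z0 0" if "e \<in> g ` Z" for e using that g z0 by auto
    show "\<exists>c x i. c \<in> cells X \<and> x \<in> corners (dm c) \<and> i < dm c \<and> e = edge_path X c x i"
      if "e \<in> g ` Z" for e
      using that g unfolding edge_def by blast
    show "perp X e f" if "e \<in> g ` Z" "f \<in> g ` Z" "e \<noteq> f" for e f using that perp by blast
  qed blast
  then obtain c x F where F: "c \<in> cells X" "F \<subseteq> {..<dm c}" "g ` Z = edge_path X c x ` F" by blast
  have "card Z = card (g ` Z)" using card_image[OF inj] by simp
  also have "\<dots> \<le> card F" unfolding F(3) using F(2)
    by (intro card_image_le) (auto intro: finite_subset)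
  also have "\<dots> \<le> dm c" using card_mono[OF _ F(2)] by simp
  finally show ?thesis using dim[OF F(1)] by simp
qed simp

lemma finite_asdim_vertices: "finite_asdim V (\<lambda>u v. real (edist u v))"
proof (cases "V = {}")
  case True
  then show ?thesis unfolding finite_asdim_def asdim_le_def
    by (intro exI[of _ 0] allI impI exI[of _ "\<lambda>_. {}"]) (auto simp: r_disjoint_def)
next
  case False
  then obtain b where b: "b \<in> V" by blast
  interpret pointed_quadrangle_graph V "\<lambda>u v. (u, v) \<in> edges X" edist b
    by unfold_locales (rule b)
  have "\<exists>Col :: nat set. finite Col \<and> (\<forall>r. \<exists>R \<kappa>. \<kappa> ` V \<subseteq> Col \<and>
      (\<forall>x y. x \<in> V \<longrightarrow> (r_step edist V \<kappa> r)\<^sup>*\<^sup>* x y \<longrightarrow> edist x y \<le> R))"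
    by (rule coloring[of N], rule down_card[OF b]) (simp_all add: down_def)
  then obtain Col :: "nat set" where Col: "finite Col" and col: "\<forall>r. \<exists>R \<kappa>. \<kappa> ` V \<subseteq> Col \<and>
      (\<forall>x y. x \<in> V \<longrightarrow> (r_step edist V \<kappa> r)\<^sup>*\<^sup>* x y \<longrightarrow> edist x y \<le> R)"
    by (elim exE conjE) (rule that)
  \<comment> \<open>The bound on the dimension is independent of \<open>r\<close> because
    \<open>Col\<close> is; indices that are not colours contribute empty families.\<close>
  have "asdim_le V (\<lambda>u v. real (edist u v)) (Max Col)"
    unfolding asdim_le_def
  proof (intro allI impI)
    fix r :: real assume "r > 0"
    obtain R \<kappa> where \<kappa>: "\<kappa> ` V \<subseteq> Col" "\<And>x y. x \<in> V \<Longrightarrow> (r_step edist V \<kappa> (nat \<lceil>r\<rceil>))\<^sup>*\<^sup>* x y \<Longrightarrow>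
      edist x y \<le> R"
      using spec[OF col, of "nat \<lceil>r\<rceil>"] by blast
    let ?s = "(r_step edist V \<kappa> (nat \<lceil>r\<rceil>))\<^sup>*\<^sup>*"
    have step_sym: "r_step edist V \<kappa> (nat \<lceil>r\<rceil>) y x" if "r_step edist V \<kappa> (nat \<lceil>r\<rceil>) x y" for x y
      using that d_sym[of x y] unfolding r_step_def by auto
    have sym: "?s y x" if "?s x y" for x y
      using that
        by (induction rule: rtranclp_induct) (auto dest: step_sym intro: converse_rtranclp_into_rtranclp)
    define \<U> where "\<U> i = {{y. ?s x y} | x. x \<in> V \<and> \<kappa> x = i}" for i
    have same: "\<kappa> y = \<kappa> x" if "?s x y" for x y
      using that by (induction rule: rtranclp_induct) (auto simp: r_step_def)
    have "V = (\<Union>i\<le>Max Col. \<Union>(\<U> i))"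
    proof (intro subset_antisym subsetI)
      fix x assume x: "x \<in> V"
      then have "\<kappa> x \<le> Max Col" using \<kappa>(1) Col by (intro Max_ge) auto
      moreover have "{y. ?s x y} \<in> \<U> (\<kappa> x)" "x \<in> {y. ?s x y}" using x unfolding \<U>_def by blast+
      ultimately show "x \<in> (\<Union>i\<le>Max Col. \<Union>(\<U> i))" by blast
    next
      fix x assume "x \<in> (\<Union>i\<le>Max Col. \<Union>(\<U> i))"
      then show "x \<in> V" unfolding \<U>_def using r_step_rtranclp_in by fastforce
    qed
    moreover have "r_disjoint (\<lambda>u v. real (edist u v)) r (\<U> i)" for i
      unfolding r_disjoint_def
    proof (intro ballI impI)
      fix A B a c assume AB: "A \<in> \<U> i" "B \<in> \<U> i" "A \<noteq> B" and ac: "a \<in> A" "c \<in> B"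
      obtain x y where xy: "A = {z. ?s x z}" "x \<in> V" "\<kappa> x = i" "B = {z. ?s y z}" "y \<in> V" "\<kappa> y = i"
        using AB(1,2) unfolding \<U>_def by blast
      have sa: "?s x a" "?s y c" using ac xy by auto
      show "r \<le> real (edist a c)"
      proof (rule ccontr)
        assume "\<not> r \<le> real (edist a c)"
        \<comment> \<open>Rounding \<open>r\<close> up loses nothing: points closer than
          \<open>r\<close> are joined by a jump, and equal colours then put them into one
          component.\<close>
        then have "edist a c \<le> nat \<lceil>r\<rceil>" by linarith
        then have "r_step edist V \<kappa> (nat \<lceil>r\<rceil>) a c"
          using r_step_rtranclp_in[OF sa(1) xy(2)] r_step_rtranclp_in[OF sa(2) xy(5)]
            same[OF sa(1)] same[OF sa(2)] xy(3,6) unfolding r_step_def by simp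
        then have s: "?s x y"
          by (rule rtranclp_trans[OF rtranclp.rtrancl_into_rtrancl[OF sa(1)] sym[OF sa(2)]])
        have "A = B" unfolding xy(1,4)
          by (intro Collect_cong iffI) (erule rtranclp_trans[OF sym[OF s]], erule rtranclp_trans[OF s])
        then show False using AB(3) by blast
      qed
    qed
    moreover have "real (edist a c) \<le> real R" if A: "A \<in> \<U> i" "a \<in> A" "c \<in> A" for i A a c
    proof -
      obtain x where x: "A = {z. ?s x z}" "x \<in> V" using A(1) unfolding \<U>_def by blast
      have xa: "?s x a" "?s x c" using A(2,3) x by auto
      have "edist a c \<le> R"
        using \<kappa>(2)[OF r_step_rtranclp_in[OF xa(1) x(2)] rtranclp_trans[OF sym[OF xa(1)] xa(2)]] .
      then show ?thesis by simp
    qed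
    ultimately show "\<exists>\<U>. V = (\<Union>i\<le>Max Col. \<Union>(\<U> i)) \<and>
      (\<forall>i\<le>Max Col. r_disjoint (\<lambda>u v. real (edist u v)) r (\<U> i)) \<and>
        (\<exists>D. \<forall>i\<le>Max Col. \<forall>A\<in>\<U> i. \<forall>a\<in>A. \<forall>b\<in>A. real (edist a b) \<le> D)"
      by (intro exI[of _ \<U>] conjI exI[of _ "real R"]) blast+
  qed
  then show ?thesis unfolding finite_asdim_def by blast
qed

end

theorem theorem1p1:
  fixes X :: "('c, 'p) cube_data"
  assumes "CAT0_cube_complex X"
    and "finite_dimensional X"
  shows "finite_asdim (vertices X) (\<lambda>u v. real (edge_dist X u v))"
proof -
  obtain N where "\<forall>c\<in>cells X. cdim X c \<le> N" using assms(2) unfolding finite_dimensional_def by blast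
  then interpret cat0_complex X N using assms(1) by unfold_locales auto
  show ?thesis by (rule finite_asdim_vertices)
qed

end
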